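(* Let $n=2$. For $l=1,2$ let $$V_l(x)=a_{l0}+\sum_{j=1}^{3}\left(\lambda_{lj}e^{i2\pi k_{lj}\cdot x}+\overline{\lambda_{lj}}e^{-i2\pi k_{lj}\cdot x}\right),$$ where $a_{l0}\in\mathbb{R}$, $\lambda_{lj}\in\mathbb{C}\setminus\{0\}$, $k_{lj}\in\mathbb{Z}^2\setminus\{0\}$ for $1\le j\le 3$, and for each $l$ the three vectors $k_{l1},k_{l2},k_{l3}$ are pairwise non-parallel. Let $\overline{H}_l$ be the effective Hamiltonian associated with the Hamiltonian $\frac12|p|^2+V_l(x)$. Assume that $$\overline{H}_1(p)=\overline{H}_2(p)\quad\text{for all }p\in\mathbb{R}^2.$$ Then there exist $c\in\mathbb{Q}\setminus\{0\}$ and $x_0\in\mathbb{T}^2$ such that $$V_1(x)=V_2\left(\frac{x}{c}+x_0\right)\quad\text{for all }x\in\mathbb{T}^2.$$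
   Context: $\mathbb{T}^n=\mathbb{R}^n/\mathbb{Z}^n$ is the flat torus. For a continuous $\mathbb{Z}^n$-periodic $V:\mathbb{R}^n\to\mathbb{R}$, the effective Hamiltonian $\overline{H}:\mathbb{R}^n\to\mathbb{R}$ associated with $\frac12|p|^2+V(x)$ is defined as follows: for each $p\in\mathbb{R}^n$, $\overline{H}(p)$ is the unique constant $c\in\mathbb{R}$ such that the cell problem $\frac12|p+Dv|^2+V(x)=c$ in $\mathbb{T}^n$ has a continuous ($\mathbb{Z}^n$-periodic) viscosity solution $v$. Vectors $u,w$ are parallel ($u\parallel w$) if they are linearly dependent. The identity $V_1(x)=V_2(x/c+x_0)$ for all $x\in\mathbb{T}^n$ is understood as an identity for all $x\in\mathbb{R}^n$, with $V_1,V_2$ regarded as $\mathbb{Z}^n$-periodic functions on $\mathbb{R}^n$ (it does not depend on the choice of representative of $x_0$). *)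

theory Defs
  imports "HOL-Analysis.Analysis"
begin

text \<open>
  Functions on the flat torus are represented by their periodic lifts to the whole space.
\<close>

definition int_periodic :: "(real ^ 'n \<Rightarrow> 'b) \<Rightarrow> bool" where
  "int_periodic f \<longleftrightarrow> (\<forall>x z. (\<forall>i. z $ i \<in> \<int>) \<longrightarrow> f (x + z) = f x)"

definition C1_with_gradient :: "('a::real_inner \<Rightarrow> real) \<Rightarrow> ('a \<Rightarrow> 'a) \<Rightarrow> bool" where
  "C1_with_gradient \<phi> D\<phi> \<longleftrightarrow> (\<forall>x. GDERIV \<phi> x :> D\<phi> x) \<and> continuous_on UNIV D\<phi>"

text \<open>
  Continuous viscosity sub- and supersolutions, in the sense of Crandall and Lions, of the
  equation \<open>H x (Dv x) = c\<close> on the whole space. Since these are local notions, for periodic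
  data and periodic \<open>v\<close> they agree with the corresponding notions on the torus.
\<close>

definition viscosity_subsolution ::
    "('a::real_inner \<Rightarrow> 'a \<Rightarrow> real) \<Rightarrow> real \<Rightarrow> ('a \<Rightarrow> real) \<Rightarrow> bool" where
  "viscosity_subsolution H c v \<longleftrightarrow> continuous_on UNIV v \<and>
     (\<forall>\<phi> D\<phi> x. C1_with_gradient \<phi> D\<phi> \<longrightarrow>
        (\<forall>\<^sub>F y in nhds x. v y - \<phi> y \<le> v x - \<phi> x) \<longrightarrow> H x (D\<phi> x) \<le> c)"

definition viscosity_supersolution ::
    "('a::real_inner \<Rightarrow> 'a \<Rightarrow> real) \<Rightarrow> real \<Rightarrow> ('a \<Rightarrow> real) \<Rightarrow> bool" where
  "viscosity_supersolution H c v \<longleftrightarrow> continuous_on UNIV v \<and>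
     (\<forall>\<phi> D\<phi> x. C1_with_gradient \<phi> D\<phi> \<longrightarrow>
        (\<forall>\<^sub>F y in nhds x. v y - \<phi> y \<ge> v x - \<phi> x) \<longrightarrow> H x (D\<phi> x) \<ge> c)"

definition viscosity_solution ::
    "('a::real_inner \<Rightarrow> 'a \<Rightarrow> real) \<Rightarrow> real \<Rightarrow> ('a \<Rightarrow> real) \<Rightarrow> bool" where
  "viscosity_solution H c v \<longleftrightarrow> viscosity_subsolution H c v \<and> viscosity_supersolution H c v"

definition cell_solution ::
    "(real ^ 'n \<Rightarrow> real) \<Rightarrow> real ^ 'n \<Rightarrow> real \<Rightarrow> (real ^ 'n \<Rightarrow> real) \<Rightarrow> bool" where
  "cell_solution V p c v \<longleftrightarrow>
     int_periodic v \<and> viscosity_solution (\<lambda>x q. 1/2 * (norm (p + q))\<^sup>2 + V x) c v"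

text \<open>
  Meaningful for continuous periodic \<open>V\<close>, where the constant exists and is unique
  (Lions, Papanicolaou and Varadhan).
\<close>

definition effective_Hamiltonian :: "(real ^ 'n \<Rightarrow> real) \<Rightarrow> real ^ 'n \<Rightarrow> real" where
  "effective_Hamiltonian V p = (THE c. \<exists>v. cell_solution V p c v)"

definition real_vec :: "int ^ 'n \<Rightarrow> real ^ 'n" where
  "real_vec k = (\<chi> i. real_of_int (k $ i))"

text \<open>
  Linear dependence of the pair \<open>(u, w)\<close>; \<open>dependent {u, w}\<close> would be wrong for
  \<open>u = w \<noteq> 0\<close>, because the set then has a single element.
\<close>

definition parallel :: "'a::real_vector \<Rightarrow> 'a \<Rightarrow> bool" where
  "parallel u w \<longleftrightarrow> (\<exists>a b::real. (a \<noteq> 0 \<or> b \<noteq> 0) \<and> a *\<^sub>R u + b *\<^sub>R w = 0)"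

end

theory Submission
  imports Defs "HOL-Complex_Analysis.Great_Picard"
begin

text \<open>
  The effective Hamiltonian is compared with explicit correctors. If \<open>w\<close> is a smooth periodic function,
  then the constant of the cell problem at \<open>p\<close> lies between the minimum and the maximum of
  \<open>1/2 \<bar>p + Dw\<bar>^2 + V\<close>. The lower bound remains valid for a minimum of smooth functions, since such
  a function still touches a subsolution from above along one of its branches. Everything that the
  effective Hamiltonian has to reveal is read off from these two bounds; the existence of a cell
  solution for every \<open>p\<close>, without which the effective Hamiltonian would not be related to its equation,
  comes from a discrete Lax-Oleinik operator with a vanishing discount.

  Write \<open>V = a + \<Sum> A\<^sub>j cos (2 pi K\<^sub>j \<bullet> x + \<theta>\<^sub>j)\<close> with three modes and \<open>A\<^sub>j > 0\<close>. Three features of the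
  effective Hamiltonian determine \<open>V\<close> up to the change of variables in the theorem.

  \<^item> Let \<open>p = s Q\<close> with \<open>s\<close> large. To leading order \<open>V\<close> is averaged along \<open>Q\<close>. The term that does not grow with
  \<open>s\<close> is \<open>a\<close> for a generic \<open>Q\<close>, and \<open>a + A\<^sub>j\<close> if \<open>Q\<close> is orthogonal to \<open>K\<^sub>j\<close>: the mean-zero potential
  that survives raises the constant to its maximum. Hence \<open>a\<close>, the directions of the
  \<open>K\<^sub>j\<close> and the \<open>A\<^sub>j\<close> are determined (\<open>first_order_match\<close>).

  \<^item> At order \<open>1/s^2\<close> the interaction of two modes that are not orthogonal produces the frequencies
  \<open>K\<^sub>i + K\<^sub>j\<close> and \<open>K\<^sub>i - K\<^sub>j\<close>. The coefficient can jump up only when \<open>Q\<close> is orthogonal to such a frequency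
  (\<open>nonresonant_upper\<close>). For such a pair it does jump when \<open>Q\<close> is orthogonal to \<open>K\<^sub>i - K\<^sub>j\<close>, if the signs of the frequencies are chosen
  such that a linear relation between them has positive coefficients (\<open>resonant_lower\<close>). If the second potential has the frequencies
  \<open>\<nu>\<^sub>j K\<^sub>j\<close> with \<open>\<nu>\<^sub>j > 0\<close>, the jumps must occur in the same directions for both potentials. This gives a finite list
  of alternatives for the \<open>\<nu>\<^sub>j\<close> (\<open>second_order_alternatives\<close>), and together they force
  \<open>\<nu>\<^sub>1 = \<nu>\<^sub>2 = \<nu>\<^sub>3\<close> (\<open>frequency_ratios_equal\<close>).

  \<^item> At \<open>p = 0\<close> the effective Hamiltonian is the maximum of \<open>V\<close>. Up to translation the phases enter only through
  the combination \<open>T = \<Sum> M\<^sub>j \<theta>\<^sub>j\<close> modulo \<open>2 pi\<close>, where \<open>M\<close> is the primitive integer relation between the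
  \<open>K\<^sub>j\<close>. The maximum strictly decreases as \<open>T\<close> moves from 0 to \<open>pi\<close>, because shrinking all three phases at
  a maximum point by the same factor increases every cosine (\<open>maximum_decreases_with_phase\<close>). So \<open>T\<close> is determined up to
  its sign, and the sign is absorbed by the reflection \<open>x \<mapsto> - x\<close>, that is, by the sign of \<open>c\<close>.
\<close>

section \<open>Comparison of cell solutions with test functions\<close>

lemma cell_subsolutionD:
  assumes "cell_solution V p c v" "C1_with_gradient \<phi> D\<phi>" "\<And>y. v y - \<phi> y \<le> v x - \<phi> x"
  shows "1/2 * (norm (p + D\<phi> x))^2 + V x \<le> c"
  using assms unfolding cell_solution_def viscosity_solution_def viscosity_subsolution_def
  by (auto intro: always_eventually)

lemma cell_supersolutionD:
  assumes "cell_solution V p c v" "C1_with_gradient \<phi> D\<phi>" "\<And>y. v y - \<phi> y \<ge> v x - \<phi> x"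
  shows "c \<le> 1/2 * (norm (p + D\<phi> x))^2 + V x"
  using assms unfolding cell_solution_def viscosity_solution_def viscosity_supersolution_def
  by (auto intro: always_eventually)

lemma cell_solution_continuous: "cell_solution V p c v \<Longrightarrow> continuous_on UNIV v"
  and cell_solution_periodic: "cell_solution V p c v \<Longrightarrow> int_periodic v"
  unfolding cell_solution_def viscosity_solution_def viscosity_subsolution_def by auto

lemma integer_translate_into_cube:
  fixes y :: "real ^ 'n"
  obtains z where "\<forall>i. z $ i \<in> \<int>" "y + z \<in> cbox 0 1"
proof
  show "\<forall>i. (\<chi> i. - real_of_int \<lfloor>y $ i\<rfloor>) $ i \<in> \<int>" by simp
  show "y + (\<chi> i. - real_of_int \<lfloor>y $ i\<rfloor>) \<in> cbox 0 1"
    by (auto simp: mem_box_cart) linarith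
qed

lemma int_periodicD: "int_periodic f \<Longrightarrow> \<forall>i. z $ i \<in> \<int> \<Longrightarrow> f (x + z) = f x"
  unfolding int_periodic_def by blast

lemma int_periodic_attains_max:
  fixes f :: "real ^ 'n \<Rightarrow> real"
  assumes "int_periodic f" "continuous_on UNIV f"
  obtains x where "\<And>y. f y \<le> f x"
proof -
  have "continuous_on (cbox 0 1) f" using assms(2) continuous_on_subset by blast
  moreover have "cbox 0 (1 :: real ^ 'n) \<noteq> {}" by (auto simp: interval_ne_empty_cart)
  ultimately obtain x where x: "\<forall>y\<in>cbox 0 1. f y \<le> f x"
    using continuous_attains_sup[OF compact_cbox] by blast
  have "f y \<le> f x" for y
    using integer_translate_into_cube[of y] x int_periodicD[OF assms(1)] by metis
  then show thesis using that by blast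
qed

lemma int_periodic_bounded:
  fixes f :: "real ^ 'n \<Rightarrow> real"
  assumes "int_periodic f" "continuous_on UNIV f"
  obtains B where "B > 0" "\<And>x. \<bar>f x\<bar> \<le> B"
proof -
  have "int_periodic (\<lambda>x. \<bar>f x\<bar>)" "continuous_on UNIV (\<lambda>x. \<bar>f x\<bar>)"
    using assms by (auto simp: int_periodic_def intro: continuous_intros)
  then obtain x where "\<And>y. \<bar>f y\<bar> \<le> \<bar>f x\<bar>" by (rule int_periodic_attains_max) blast
  then have "\<bar>f y\<bar> \<le> \<bar>f x\<bar> + 1" for y
    by (metis add_increasing2 zero_le_one)
  then show thesis by (intro that[of "\<bar>f x\<bar> + 1"]) auto
qed

lemma int_periodic_uniformly_continuous:
  fixes f :: "real ^ 'n \<Rightarrow> real"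
  assumes "int_periodic f" "continuous_on UNIV f" "e > 0"
  obtains d where "d > 0" "\<And>x y. norm (x - y) < d \<Longrightarrow> \<bar>f x - f y\<bar> < e"
proof -
  let ?K = "cbox (-1) (2 :: real ^ 'n)"
  have "uniformly_continuous_on ?K f"
    using assms(2) continuous_on_subset by (intro compact_uniformly_continuous) auto
  then obtain d where d: "d > 0" "\<And>x y. x \<in> ?K \<Longrightarrow> y \<in> ?K \<Longrightarrow> dist y x < d \<Longrightarrow> dist (f y) (f x) < e"
    using \<open>e > 0\<close> unfolding uniformly_continuous_on_def by metis
  have "\<bar>f x - f y\<bar> < e" if xy: "norm (x - y) < min d 1" for x y
  proof -
    obtain z where z: "\<forall>i. z $ i \<in> \<int>" "x + z \<in> cbox 0 1" by (rule integer_translate_into_cube)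
    have "\<bar>(x - y) $ i\<bar> < 1" for i
      using component_le_norm_cart[of "x - y" i] xy by simp
    then have "\<bar>x $ i - y $ i\<bar> < 1" for i by simp
    moreover have "0 \<le> x $ i + z $ i" "x $ i + z $ i \<le> 1" for i using z(2) by (auto simp: mem_box_cart)
    ultimately have "- 1 \<le> x $ i + z $ i \<and> x $ i + z $ i \<le> 2 \<and> - 1 \<le> y $ i + z $ i \<and> y $ i + z $ i \<le> 2" for i
      by (smt (verit))
    then have "x + z \<in> ?K" "y + z \<in> ?K" by (auto simp: mem_box_cart)
    moreover have "dist (x + z) (y + z) < d" using xy by (simp add: dist_norm)
    ultimately have "dist (f (x + z)) (f (y + z)) < e" using d by blast
    then show ?thesis using z int_periodicD[OF assms(1)] by (simp add: dist_norm)
  qed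
  then show thesis using that[of "min d 1"] d by auto
qed

lemma C1_quadratic:
  fixes a :: "'a::real_inner"
  shows "C1_with_gradient (\<lambda>x. c / 2 * (norm (x - a))^2) (\<lambda>x. c *\<^sub>R (x - a))"
  unfolding C1_with_gradient_def gderiv_def power2_norm_eq_inner
  by (auto intro!: derivative_eq_intros continuous_intros simp: inner_commute inner_diff_left inner_diff_right field_simps)

lemma C1_add:
  "C1_with_gradient f Df \<Longrightarrow> C1_with_gradient g Dg \<Longrightarrow>
    C1_with_gradient (\<lambda>x. f x + g x) (\<lambda>x. Df x + Dg x)"
  unfolding C1_with_gradient_def by (auto intro!: GDERIV_add continuous_on_add)

lemma C1_minus:
  "C1_with_gradient f Df \<Longrightarrow> C1_with_gradient (\<lambda>x. - f x) (\<lambda>x. - Df x)"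
  unfolding C1_with_gradient_def by (auto intro!: GDERIV_minus continuous_on_minus)

lemma C1_diff:
  "C1_with_gradient f Df \<Longrightarrow> C1_with_gradient g Dg \<Longrightarrow>
    C1_with_gradient (\<lambda>x. f x - g x) (\<lambda>x. Df x - Dg x)"
  unfolding C1_with_gradient_def by (auto intro!: GDERIV_diff continuous_on_diff)

lemma C1_imp_continuous: "C1_with_gradient f Df \<Longrightarrow> continuous_on UNIV f"
  unfolding C1_with_gradient_def gderiv_def
  by (auto intro!: continuous_at_imp_continuous_on dest: has_derivative_continuous)

text \<open>
  At a minimum of \<open>v - w\<close> the corrector \<open>w\<close> itself is an admissible test function.
\<close>

lemma cell_constant_le:
  fixes V :: "real ^ 'n \<Rightarrow> real"
  assumes v: "cell_solution V p c v" and w: "C1_with_gradient w Dw" "int_periodic w"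
    and C: "\<And>x. 1/2 * (norm (p + Dw x))^2 + V x \<le> C"
  shows "c \<le> C"
proof -
  have "int_periodic (\<lambda>x. w x - v x)"
    using w(2) cell_solution_periodic[OF v] by (auto simp: int_periodic_def)
  moreover have "continuous_on UNIV (\<lambda>x. w x - v x)"
    using C1_imp_continuous[OF w(1)] cell_solution_continuous[OF v] by (intro continuous_intros)
  ultimately obtain x where x: "\<And>y. w y - v y \<le> w x - v x"
    by (rule int_periodic_attains_max) blast
  have "v x - w x \<le> v y - w y" for y using x[of y] by linarith
  from cell_supersolutionD[OF v w(1) this] C[of x] show ?thesis by linarith
qed

text \<open>
  The function \<open>W - \<bar>G\<bar>\<close> is the minimum of the smooth functions \<open>W - G\<close> and \<open>W + G\<close>. At a maximum
  of \<open>v - (W - \<bar>G\<bar>)\<close> the branch that attains this minimum touches \<open>v\<close> from above, so kinks of this kind do no harm.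
  Periodicity is asked of \<open>\<bar>G\<bar>\<close>: a function \<open>G\<close> that changes sign under integer translations is
  what makes the bound strong enough at a resonance.
\<close>

lemma cell_constant_ge:
  fixes V :: "real ^ 'n \<Rightarrow> real"
  assumes v: "cell_solution V p c v"
    and W: "C1_with_gradient W DW" "int_periodic W"
    and G: "C1_with_gradient G DG" "int_periodic (\<lambda>x. \<bar>G x\<bar>)"
    and C1: "\<And>x. C \<le> 1/2 * (norm (p + (DW x - DG x)))^2 + V x"
    and C2: "\<And>x. C \<le> 1/2 * (norm (p + (DW x + DG x)))^2 + V x"
  shows "C \<le> c"
proof -
  have "int_periodic (\<lambda>x. v x - (W x - \<bar>G x\<bar>))"
    using W(2) G(2) cell_solution_periodic[OF v] by (auto simp: int_periodic_def)
  moreover have "continuous_on UNIV (\<lambda>x. v x - (W x - \<bar>G x\<bar>))"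
    using C1_imp_continuous[OF W(1)] C1_imp_continuous[OF G(1)] cell_solution_continuous[OF v]
    by (intro continuous_intros)
  ultimately obtain x where x: "\<And>y. v y - (W y - \<bar>G y\<bar>) \<le> v x - (W x - \<bar>G x\<bar>)"
    by (rule int_periodic_attains_max) blast
  show ?thesis
  proof (cases "G x \<ge> 0")
    case True
    have "v y - (W y - G y) \<le> v x - (W x - G x)" for y
      using x[of y] True by linarith
    from cell_subsolutionD[OF v C1_diff[OF W(1) G(1)] this] C1[of x] show ?thesis by linarith
  next
    case False
    have "v y - (W y + G y) \<le> v x - (W x + G x)" for y
      using x[of y] False by linarith
    from cell_subsolutionD[OF v C1_add[OF W(1) G(1)] this] C2[of x] show ?thesis by linarith
  qed
qed

text \<open>
  A steep paraboloid centred at \<open>x0\<close> touches \<open>v\<close> from above at a point near \<open>x0\<close>, and there the kinetic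
  part of the Hamiltonian is nonnegative.
\<close>

lemma cell_constant_zero_ge:
  fixes V :: "real ^ 'n \<Rightarrow> real"
  assumes v: "cell_solution V 0 c v" and V: "continuous_on UNIV V"
  shows "V x0 \<le> c"
proof (rule ccontr)
  assume "\<not> V x0 \<le> c"
  then have pos: "V x0 - c > 0" by simp
  have cont: "isCont V x0" using V by (simp add: continuous_on_eq_continuous_at)
  obtain d where d: "d > 0" "\<And>x. norm (x - x0) < d \<Longrightarrow> \<bar>V x - V x0\<bar> < V x0 - c"
    using cont pos unfolding continuous_at_eps_delta dist_norm real_norm_def by blast
  obtain B where B: "B > 0" "\<And>x. \<bar>v x\<bar> \<le> B"
    using int_periodic_bounded[OF cell_solution_periodic[OF v] cell_solution_continuous[OF v]] by blast
  \<comment> \<open>With this value the paraboloid is \<open>4 * B\<close> at distance \<open>d\<close>, which is more than \<open>v\<close> can vary.\<close>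
  define a where "a = 8 * B / d^2"
  let ?\<phi> = "\<lambda>x. a / 2 * (norm (x - x0))^2"
  have "continuous_on (cball x0 d) (\<lambda>x. v x - ?\<phi> x)"
    using continuous_on_subset[OF cell_solution_continuous[OF v]] by (intro continuous_intros) auto
  moreover have "cball x0 d \<noteq> {}" using d(1) by auto
  ultimately obtain x where x: "x \<in> cball x0 d" "\<And>y. y \<in> cball x0 d \<Longrightarrow> v y - ?\<phi> y \<le> v x - ?\<phi> x"
    using continuous_attains_sup[OF compact_cball, of x0 d "\<lambda>x. v x - ?\<phi> x"] by blast
  have a: "a > 0" using B d by (simp add: a_def)
  have far: "v y - ?\<phi> y < v x0 - ?\<phi> x0" if "norm (y - x0) \<ge> d" for y
  proof -
    have "d^2 \<le> (norm (y - x0))^2" using that d by (intro power_mono) auto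
    then have "a / 2 * d^2 \<le> ?\<phi> y" using a by (intro mult_left_mono) auto
    moreover have "a / 2 * d^2 = 4 * B" using d by (simp add: a_def)
    ultimately show ?thesis using B(1) B(2)[of y] B(2)[of x0] by simp
  qed
  have x0x: "v x0 - ?\<phi> x0 \<le> v x - ?\<phi> x" using x(2)[of x0] d by simp
  have "v y - ?\<phi> y \<le> v x - ?\<phi> x" for y
    using x(2)[of y] far[of y] x0x by (force simp: dist_norm norm_minus_commute)
  from cell_subsolutionD[OF v C1_quadratic this]
  have "1/2 * (norm (0 + a *\<^sub>R (x - x0)))^2 + V x \<le> c" .
  moreover have "0 \<le> 1/2 * (norm (0 + a *\<^sub>R (x - x0)))^2" by simp
  ultimately have "V x \<le> c" by linarith
  moreover have "norm (x - x0) < d" using far[of x] x0x by force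
  ultimately show False using d(2)[of x] by linarith
qed

text \<open>
  Doubling of variables: at a maximum of \<open>v1 x - v2 y - a / 2 * (norm (y - x))^2\<close> both test functions have the
  same gradient, so the two equations differ only by \<open>V\<close> at two points that are close to each other for large \<open>a\<close>.
  In particular the constant of the cell problem is unique.
\<close>

lemma cell_constant_le_doubling:
  fixes V :: "real ^ 'n \<Rightarrow> real"
  assumes V: "continuous_on UNIV V" "int_periodic V"
    and v1: "cell_solution V p c1 v1" and v2: "cell_solution V p c2 v2"
  shows "c2 \<le> c1"
proof (rule ccontr)
  assume "\<not> c2 \<le> c1"
  then have "c2 - c1 > 0" by simp
  then obtain d where d: "d > 0" "\<And>x y. norm (x - y) < d \<Longrightarrow> \<bar>V x - V y\<bar> < c2 - c1"
    using int_periodic_uniformly_continuous[OF V(2,1)] by blast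
  note per = cell_solution_periodic[OF v1] cell_solution_periodic[OF v2]
  note cont = cell_solution_continuous[OF v1] cell_solution_continuous[OF v2]
  obtain B1 where B1: "B1 > 0" "\<And>x. \<bar>v1 x\<bar> \<le> B1" using int_periodic_bounded[OF per(1) cont(1)] by blast
  obtain B2 where B2: "B2 > 0" "\<And>x. \<bar>v2 x\<bar> \<le> B2" using int_periodic_bounded[OF per(2) cont(2)] by blast
  define a where "a = 8 * (B1 + B2) / d^2"
  have a: "a > 0" using B1 B2 d by (simp add: a_def)
  \<comment> \<open>In the variables \<open>x\<close> and \<open>z = y - x\<close> periodicity confines \<open>x\<close> to a compact cube and the penalty confines \<open>z\<close>.\<close>
  let ?g = "\<lambda>(x, z). v1 x - v2 (x + z) - a / 2 * (norm z)^2"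
  have "continuous_on (cbox 0 1 \<times> cball 0 d) ?g"
    unfolding case_prod_beta
    by (intro continuous_intros continuous_on_compose2[OF cont(1)] continuous_on_compose2[OF cont(2)]) auto
  moreover have "cbox 0 (1 :: real ^ 'n) \<times> cball 0 d \<noteq> {}"
    using d(1) by (auto simp: interval_ne_empty_cart)
  moreover have "compact (cbox 0 (1 :: real ^ 'n) \<times> cball (0 :: real ^ 'n) d)" by (intro compact_Times) auto
  ultimately obtain X where X: "X \<in> cbox 0 1 \<times> cball 0 d" "\<And>Y. Y \<in> cbox 0 1 \<times> cball 0 d \<Longrightarrow> ?g Y \<le> ?g X"
    using continuous_attains_sup[of "cbox 0 1 \<times> cball 0 d" ?g] by blast
  obtain x z where xz: "X = (x, z)" by force
  have far: "?g (x', z') < ?g (x'', 0)" if "norm z' \<ge> d" for x' x'' z'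
  proof -
    have "d^2 \<le> (norm z')^2" using that d by (intro power_mono) auto
    then have "a / 2 * d^2 \<le> a / 2 * (norm z')^2" using a by (intro mult_left_mono) auto
    moreover have "a / 2 * d^2 = 4 * (B1 + B2)" using d by (simp add: a_def)
    ultimately show ?thesis
      using B1(1) B2(1) B1(2)[of x'] B2(2)[of "x' + z'"] B1(2)[of x''] B2(2)[of x'']
      by (simp add: abs_le_iff)
  qed
  have x0: "?g (x, 0) \<le> ?g (x, z)" using X(2)[of "(x, 0)"] X(1) d(1) xz by auto
  have z: "norm z < d" using far[of z x x] x0 by force
  have "?g (x', z') \<le> ?g (x, z)" for x' z'
  proof (cases "norm z' \<ge> d")
    case True
    then show ?thesis using far[of z' x' x] x0 by linarith
  next
    case False
    obtain t where t: "\<forall>i. t $ i \<in> \<int>" "x' + t \<in> cbox 0 1" by (rule integer_translate_into_cube)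
    have "?g (x' + t, z') = ?g (x', z')"
      using int_periodicD[OF per(1) t(1), of x'] int_periodicD[OF per(2) t(1), of "x' + z'"]
      by (simp add: add.commute add.left_commute)
    moreover have "?g (x' + t, z') \<le> ?g (x, z)" using X(2)[of "(x' + t, z')"] t False xz by simp
    ultimately show ?thesis by linarith
  qed
  then have mx: "v1 x' - v2 y - a / 2 * (norm (y - x'))^2 \<le> v1 x - v2 (x + z) - a / 2 * (norm z)^2" for x' y
  proof -
    have "?g (x', y - x') \<le> ?g (x, z)" by fact
    then show ?thesis by simp
  qed
  let ?y = "x + z"
  have "v1 x' - a / 2 * (norm (x' - ?y))^2 \<le> v1 x - a / 2 * (norm (x - ?y))^2" for x'
    using mx[of x' ?y] by (simp add: norm_minus_commute)
  from cell_subsolutionD[OF v1 C1_quadratic this]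
  have 1: "1/2 * (norm (p + a *\<^sub>R (x - ?y)))^2 + V x \<le> c1" .
  have "v2 ?y - - (a / 2 * (norm (?y - x))^2) \<le> v2 y - - (a / 2 * (norm (y - x))^2)" for y
    using mx[of x y] by simp
  from cell_supersolutionD[OF v2 C1_minus[OF C1_quadratic] this]
  have 2: "c2 \<le> 1/2 * (norm (p + - (a *\<^sub>R (?y - x))))^2 + V ?y" .
  have "- (a *\<^sub>R (?y - x)) = a *\<^sub>R (x - ?y)" by (simp add: algebra_simps)
  with 1 2 have "c2 - c1 \<le> V ?y - V x" by simp
  with d(2)[of ?y x] z show False by simp
qed

section \<open>Existence of cell solutions\<close>

text \<open>
  One time step of length \<open>h\<close> of the Lax-Oleinik evolution for the Lagrangian \<open>\<bar>q\<bar>^2 / 2 - p \<bullet> q\<close>, where the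
  displacement is \<open>z = h q\<close>.
\<close>

definition lax :: "real \<Rightarrow> 'a::real_inner \<Rightarrow> ('a \<Rightarrow> real) \<Rightarrow> 'a \<Rightarrow> real" where
  "lax h p g x = (INF z. g (x - z) + ((norm z)^2 / (2 * h) - p \<bullet> z))"

lemma kinetic_ge:
  fixes p z :: "'a::real_inner"
  assumes "h > 0"
  shows "(norm z)^2 / (2 * h) - p \<bullet> z \<ge> - h * (norm p)^2 / 2"
proof -
  have "0 \<le> (norm (z - h *\<^sub>R p))^2" by simp
  also have "\<dots> = (norm z)^2 - 2 * h * (p \<bullet> z) + h^2 * (norm p)^2"
    unfolding power2_norm_eq_inner
    by (simp add: inner_diff_left inner_diff_right inner_commute power2_eq_square algebra_simps)
  finally have "0 \<le> ((norm z)^2 - 2 * h * (p \<bullet> z) + h^2 * (norm p)^2) / (2 * h)"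
    using assms by simp
  also have "\<dots> = (norm z)^2 / (2 * h) - p \<bullet> z + h * (norm p)^2 / 2"
    using assms by (simp add: field_simps power2_eq_square)
  finally show ?thesis by simp
qed

lemma quadratic_growth_bound:
  fixes r a b :: real
  assumes "r^2 \<le> a * r + b" "a \<ge> 0" "b \<ge> 0"
  shows "r \<le> a + b + 1"
proof (rule ccontr)
  assume r: "\<not> r \<le> a + b + 1"
  have "b * 1 \<le> b * r" using r assms by (intro mult_left_mono) auto
  moreover have "(a + b + 1) * r \<le> r * r" using r assms by (intro mult_right_mono) auto
  ultimately show False using assms r by (simp add: power2_eq_square algebra_simps)
qed

context
  fixes h :: real and p :: "'a::real_inner"
  assumes h: "h > 0"
begin

lemma lax_bdd:
  assumes "\<forall>x. - m \<le> g x"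
  shows "bdd_below (range (\<lambda>z. g (x - z) + ((norm z)^2 / (2 * h) - p \<bullet> z)))"
proof (rule bdd_belowI2)
  fix z
  show "- m + - h * (norm p)^2 / 2 \<le> g (x - z) + ((norm z)^2 / (2 * h) - p \<bullet> z)"
    using assms[rule_format, of "x - z"] kinetic_ge[OF h, of p z] by linarith
qed

lemma lax_le:
  assumes "\<forall>x. - m \<le> g x"
  shows "lax h p g x \<le> g (x - z) + ((norm z)^2 / (2 * h) - p \<bullet> z)"
  unfolding lax_def by (rule cINF_lower[OF lax_bdd[OF assms]]) auto

lemma lax_ge:
  assumes "\<And>z. C \<le> g (x - z) + ((norm z)^2 / (2 * h) - p \<bullet> z)"
  shows "C \<le> lax h p g x"
  unfolding lax_def by (rule cINF_greatest) (use assms in auto)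

lemma lax_near_minimizer:
  assumes "\<forall>x. - m \<le> g x" "\<eta> > 0"
  obtains z where "g (x - z) + ((norm z)^2 / (2 * h) - p \<bullet> z) < lax h p g x + \<eta>"
proof -
  have "(INF z. g (x - z) + ((norm z)^2 / (2 * h) - p \<bullet> z)) < lax h p g x + \<eta>"
    using assms(2) by (simp add: lax_def)
  then show thesis
    using that unfolding cINF_less_iff[OF UNIV_not_empty lax_bdd[OF assms(1)]] by auto
qed

lemma lax_contraction:
  assumes "\<forall>x. - m \<le> g x" "\<forall>x. g x \<le> g' x + e"
  shows "lax h p g x \<le> lax h p g' x + e"
proof -
  have "lax h p g x - e \<le> lax h p g' x"
  proof (rule lax_ge)
    fix z
    show "lax h p g x - e \<le> g' (x - z) + ((norm z)^2 / (2 * h) - p \<bullet> z)"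
      using lax_le[OF assms(1), of x z] assms(2)[rule_format, of "x - z"] by simp
  qed
  then show ?thesis by simp
qed

text \<open>
  The minimizing point \<open>x - z\<close> for \<open>x\<close> is a competitor for \<open>x'\<close>, so only the cost of the displacement
  changes; this change is controlled by the length \<open>R\<close> of a minimizing displacement. A crude
  \<open>R\<close> yields continuity, and an \<open>R\<close> proportional to \<open>h\<close> a Lipschitz constant independent of \<open>h\<close>.
\<close>

lemma lax_lipschitz:
  assumes g: "\<forall>x. - m \<le> g x" and "\<eta> > 0"
    and R: "\<And>z. g (x - z) + ((norm z)^2 / (2 * h) - p \<bullet> z) < lax h p g x + \<eta> \<Longrightarrow> norm z \<le> R"
    and d: "norm (x' - x) \<le> d"
  shows "lax h p g x' - lax h p g x \<le> norm (x' - x) * ((d + 2 * R) / (2 * h) + norm p)"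
proof (rule field_le_epsilon)
  fix e :: real assume "e > 0"
  then obtain z where z: "g (x - z) + ((norm z)^2 / (2 * h) - p \<bullet> z) < lax h p g x + min e \<eta>"
    using lax_near_minimizer[OF g, of "min e \<eta>" x] \<open>\<eta> > 0\<close> by (metis min_less_iff_conj)
  have zR: "norm z \<le> R" by (rule R) (use z in auto)
  let ?d = "x' - x"
  have "lax h p g x' \<le> g (x' - (z + ?d)) + ((norm (z + ?d))^2 / (2 * h) - p \<bullet> (z + ?d))"
    by (rule lax_le[OF g])
  also have "x' - (z + ?d) = x - z" by simp
  also have "(norm (z + ?d))^2 / (2 * h) - p \<bullet> (z + ?d) \<le>
      ((norm z)^2 / (2 * h) - p \<bullet> z) + norm ?d * ((d + 2 * R) / (2 * h) + norm p)"
  proof -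
    have "(norm (z + ?d))^2 = (norm z)^2 + 2 * (z \<bullet> ?d) + (norm ?d)^2"
      unfolding power2_norm_eq_inner by (simp add: inner_add_left inner_add_right inner_commute)
    also have "z \<bullet> ?d \<le> R * norm ?d"
      using Cauchy_Schwarz_ineq2[of z ?d] mult_right_mono[OF zR, of "norm ?d"] by simp
    also have "(norm ?d)^2 \<le> d * norm ?d"
      unfolding power2_eq_square using d by (intro mult_right_mono) auto
    finally have "(norm (z + ?d))^2 \<le> (norm z)^2 + norm ?d * (d + 2 * R)"
      by (simp add: algebra_simps)
    then have "(norm (z + ?d))^2 / (2 * h) \<le> ((norm z)^2 + norm ?d * (d + 2 * R)) / (2 * h)"
      using h by (intro divide_right_mono) auto
    moreover have "- (p \<bullet> ?d) \<le> norm ?d * norm p"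
      using Cauchy_Schwarz_ineq2[of p ?d] by (simp add: mult.commute)
    ultimately show ?thesis
      by (simp add: inner_add_right add_divide_distrib distrib_left)
  qed
  finally show "lax h p g x' - lax h p g x \<le> norm ?d * ((d + 2 * R) / (2 * h) + norm p) + e"
    using z by simp
qed

lemma lax_continuous:
  assumes g: "\<And>x. \<bar>g x\<bar> \<le> m"
  shows "continuous_on UNIV (lax h p g)"
proof -
  have gm: "\<forall>x. - m \<le> g x" using g by (simp add: abs_le_iff minus_le_iff)
  have m: "m \<ge> 0" using g[of undefined] by linarith
  define R where "R = 2 * h * norm p + (2 * h * (2 * m + 1)) + 1"
  define L where "L = (1 + 2 * R) / (2 * h) + norm p"
  have R: "norm z \<le> R" if "g (x - z) + ((norm z)^2 / (2 * h) - p \<bullet> z) < lax h p g x + 1" for x z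
  proof -
    have "lax h p g x \<le> m" using lax_le[OF gm, of x 0] g[of x] by simp
    then have "(norm z)^2 / (2 * h) \<le> 2 * m + 1 + p \<bullet> z"
      using that gm[rule_format, of "x - z"] by linarith
    also have "p \<bullet> z \<le> norm p * norm z" by (rule norm_cauchy_schwarz)
    finally have "(norm z)^2 \<le> (2 * h * norm p) * norm z + 2 * h * (2 * m + 1)"
      using h by (simp add: field_simps)
    then show ?thesis unfolding R_def using h m by (intro quadratic_growth_bound) auto
  qed
  have R0: "R \<ge> 0" unfolding R_def using h m by simp
  have L: "L \<ge> 0" unfolding L_def using h R0 by simp
  have one: "lax h p g x' - lax h p g x \<le> norm (x' - x) * L" if "norm (x' - x) \<le> 1" for x x'
    unfolding L_def using R by (intro lax_lipschitz[OF gm, where \<eta>=1] that) auto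
  have "dist (lax h p g x') (lax h p g x) \<le> norm (x' - x) * L" if "norm (x' - x) \<le> 1" for x x'
    using one[of x' x] one[of x x'] that by (simp add: dist_real_def abs_le_iff norm_minus_commute)
  note lip = this
  show ?thesis unfolding continuous_on_iff
  proof (intro ballI allI impI)
    fix x and e :: real assume "e > 0"
    show "\<exists>d>0. \<forall>x'\<in>UNIV. dist x' x < d \<longrightarrow> dist (lax h p g x') (lax h p g x) < e"
    proof (intro exI[of _ "min 1 (e / (L + 1))"] conjI ballI impI)
      show "0 < min 1 (e / (L + 1))" using \<open>e > 0\<close> L by simp
      fix x' assume x': "dist x' x < min 1 (e / (L + 1))"
      have "dist (lax h p g x') (lax h p g x) \<le> norm (x' - x) * L"
        using x' by (intro lip) (simp add: dist_norm)
      also have "\<dots> \<le> norm (x' - x) * (L + 1)" by (intro mult_left_mono) auto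
      also have "\<dots> < e" using x' L by (simp add: dist_norm field_simps)
      finally show "dist (lax h p g x') (lax h p g x) < e" .
    qed
  qed
qed

end

text \<open>
  Uniqueness part of the contraction principle for functions that are merely bounded.
\<close>

lemma bounded_iterate_zero:
  fixes f :: "'a \<Rightarrow> real"
  assumes "\<And>x. \<bar>f x\<bar> \<le> D" "0 \<le> b" "b < 1"
    and step: "\<And>D. (\<And>x. \<bar>f x\<bar> \<le> D) \<Longrightarrow> (\<And>x. \<bar>f x\<bar> \<le> b * D)"
  shows "f x = 0"
proof -
  have "\<forall>x. \<bar>f x\<bar> \<le> b ^ n * D" for n
  proof (induction n)
    case (Suc n)
    then show ?case using step[of "b ^ n * D"] by (simp add: mult.assoc)
  qed (use assms in auto)
  moreover have "(\<lambda>n. b ^ n * D) \<longlonglongrightarrow> 0 * D"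
    using assms by (intro tendsto_intros LIMSEQ_realpow_zero) auto
  ultimately have "\<bar>f x\<bar> \<le> 0"
    by (intro LIMSEQ_le_const[of "\<lambda>n. b ^ n * D"]) auto
  then show ?thesis by simp
qed

text \<open>
  The discount \<open>b < 1\<close> makes the time step a contraction for the supremum norm. Periodicity of the fixed point
  follows from uniqueness, since its integer translates solve the same equation.
\<close>

lemma discounted_fixed_point:
  fixes V :: "real ^ 'n \<Rightarrow> real"
  assumes V: "continuous_on UNIV V" "int_periodic V" and h: "0 < h" and b: "0 \<le> b" "b < 1"
  obtains u where "continuous_on UNIV u" "int_periodic u"
    "\<And>x. u x = lax h p (\<lambda>y. b * u y - h * V y) x"
proof -
  obtain M where M: "M > 0" "\<And>x. \<bar>V x\<bar> \<le> M" using int_periodic_bounded[OF V(2,1)] by blast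
  define G where "G u = (\<lambda>y. b * u y - h * V y)" for u :: "real ^ 'n \<Rightarrow> real"
  have Gb: "\<bar>G u y\<bar> \<le> b * B + h * M" if "\<forall>x. \<bar>u x\<bar> \<le> B" for u B y
  proof -
    have "\<bar>b * u y - h * V y\<bar> \<le> \<bar>b * u y\<bar> + \<bar>h * V y\<bar>" by (rule abs_triangle_ineq4)
    also have "\<dots> \<le> b * B + h * M"
      unfolding abs_mult using h b M(2)[of y] that[rule_format, of y] by (intro add_mono mult_mono) auto
    finally show ?thesis unfolding G_def .
  qed
  have Gb': "\<forall>y. - (b * B + h * M) \<le> G u y" if "\<forall>x. \<bar>u x\<bar> \<le> B" for u B
  proof
    fix y
    show "- (b * B + h * M) \<le> G u y" using Gb[OF that, of y] by linarith
  qed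
  have contr: "\<bar>lax h p (G u) x - lax h p (G u') x\<bar> \<le> b * D"
    if u: "\<forall>x. \<bar>u x\<bar> \<le> B" and u': "\<forall>x. \<bar>u' x\<bar> \<le> B'" and D: "\<forall>x. \<bar>u x - u' x\<bar> \<le> D" for u u' B B' D x
  proof -
    have "\<bar>b * u y - b * u' y\<bar> \<le> b * D" for y
      using mult_left_mono[OF D[rule_format, of y] b(1)] b(1) by (simp add: abs_mult flip: right_diff_distrib)
    then have 1: "\<forall>y. G u y \<le> G u' y + b * D" "\<forall>y. G u' y \<le> G u y + b * D"
      unfolding G_def by (auto simp: abs_le_iff algebra_simps)
    show ?thesis
      using lax_contraction[OF h Gb'[OF u] 1(1), of p x] lax_contraction[OF h Gb'[OF u'] 1(2), of p x]
      by (simp add: abs_le_iff)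
  qed
  have bound: "\<bar>lax h p (G u) x\<bar> \<le> (b * B + h * M) + h * (norm p)^2 / 2"
    if u: "\<forall>x. \<bar>u x\<bar> \<le> B" for u B x
  proof -
    have "- (b * B + h * M) - h * (norm p)^2 / 2 \<le> lax h p (G u) x"
    proof (rule lax_ge[OF h])
      fix z
      show "- (b * B + h * M) - h * (norm p)^2 / 2 \<le> G u (x - z) + ((norm z)^2 / (2 * h) - p \<bullet> z)"
        using Gb'[OF u, rule_format, of "x - z"] kinetic_ge[OF h, of p z] by linarith
    qed
    moreover have "lax h p (G u) x \<le> b * B + h * M"
      using lax_le[OF h Gb'[OF u], where p=p and x=x and z=0] Gb[OF u, of x] by (simp add: abs_le_iff)
    moreover have "0 \<le> h * (norm p)^2 / 2" using h by simp
    ultimately show ?thesis by (simp add: abs_le_iff)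
  qed
  define F where "F f = Bcontfun (lax h p (G (apply_bcontfun f)))" for f
  have bcf: "\<exists>B. \<forall>x. \<bar>apply_bcontfun f x\<bar> \<le> B" for f :: "(real ^ 'n) \<Rightarrow>\<^sub>C real"
    using norm_bounded[of f] by (metis real_norm_def)
  have F: "apply_bcontfun (F f) = lax h p (G (apply_bcontfun f))" for f
  proof -
    obtain B where B: "\<forall>x. \<bar>apply_bcontfun f x\<bar> \<le> B" using bcf by blast
    have "lax h p (G (apply_bcontfun f)) \<in> bcontfun"
      using bound[OF B] lax_continuous[OF h, where g="G (apply_bcontfun f)" and p=p] Gb[OF B]
      by (intro bcontfun_normI) auto
    then show ?thesis unfolding F_def by (simp add: Bcontfun_inverse)
  qed
  have "dist (F f) (F f') \<le> b * dist f f'" for f f'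
  proof (rule dist_bound)
    fix x
    obtain B B' where B: "\<forall>x. \<bar>apply_bcontfun f x\<bar> \<le> B" "\<forall>x. \<bar>apply_bcontfun f' x\<bar> \<le> B'"
      using bcf by blast
    have "\<forall>x. \<bar>apply_bcontfun f x - apply_bcontfun f' x\<bar> \<le> dist f f'"
      using dist_bounded[of f _ f'] by (simp add: dist_real_def)
    from contr[OF B this] show "dist (apply_bcontfun (F f) x) (apply_bcontfun (F f') x) \<le> b * dist f f'"
      by (simp add: F dist_real_def)
  qed
  then have "\<exists>!f. F f = f" using b by (intro banach_fix_type[of b]) auto
  then obtain f where f: "F f = f" by blast
  let ?u = "apply_bcontfun f"
  have eq: "?u x = lax h p (G ?u) x" for x by (metis F f)
  obtain B where B: "\<forall>x. \<bar>?u x\<bar> \<le> B" using bcf by blast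
  have "?u (x + z) = ?u x" if z: "\<forall>i. z $ i \<in> \<int>" for x z
  proof -
    let ?w = "\<lambda>x. ?u (x + z)"
    have Bw: "\<forall>x. \<bar>?w x\<bar> \<le> B" using B by blast
    have eqw: "?w x = lax h p (G ?w) x" for x
    proof -
      have "?w x = lax h p (G ?u) (x + z)" by (rule eq)
      also have "\<dots> = lax h p (G ?w) x"
      proof -
        have "G ?u (x + z - z') = G ?w (x - z')" for z'
        proof -
          have "x + z - z' = x - z' + z" by simp
          then show ?thesis unfolding G_def by (simp only: int_periodicD[OF V(2) z, of "x - z'"])
        qed
        then show ?thesis unfolding lax_def by simp
      qed
      finally show ?thesis .
    qed
    have "?w x - ?u x = 0"
    proof (rule bounded_iterate_zero[of "\<lambda>x. ?w x - ?u x"])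
      show "\<bar>?w x - ?u x\<bar> \<le> 2 * B" for x using B[rule_format, of x] B[rule_format, of "x + z"] by linarith
      show "\<bar>?w x - ?u x\<bar> \<le> b * D" if "\<And>x. \<bar>?w x - ?u x\<bar> \<le> D" for x D
      proof -
        have "\<forall>x. \<bar>?w x - ?u x\<bar> \<le> D" using that by blast
        from contr[OF Bw B this, of x] show ?thesis unfolding eqw[symmetric] eq[symmetric] .
      qed
    qed (use b in auto)
    then show ?thesis by simp
  qed
  then have "int_periodic ?u" unfolding int_periodic_def by blast
  show thesis
  proof (rule that[of ?u])
    show "?u x = lax h p (\<lambda>y. b * ?u y - h * V y) x" for x using eq[of x] unfolding G_def .
  qed (use \<open>int_periodic ?u\<close> in auto)
qed

text \<open>
  An increment bound at scale \<open>h\<close> is added up along a segment.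
\<close>

lemma chaining:
  fixes u :: "'a::real_normed_vector \<Rightarrow> real"
  assumes step: "\<And>x y. norm (x - y) \<le> h \<Longrightarrow> u x - u y \<le> c" and h: "h > 0" and c: "c \<ge> 0"
  shows "u x - u y \<le> c * (norm (x - y) / h + 1)"
proof -
  have iter: "u (y + real n *\<^sub>R w) - u y \<le> real n * c" if w: "norm w \<le> h" for n w
  proof (induction n)
    case (Suc n)
    have "u (y + real (Suc n) *\<^sub>R w) - u (y + real n *\<^sub>R w) \<le> c"
      by (rule step) (use w in \<open>simp add: algebra_simps\<close>)
    with Suc show ?case by (simp add: algebra_simps)
  qed simp
  define n where "n = nat \<lceil>norm (x - y) / h\<rceil>"
  have n: "norm (x - y) / h \<le> real n" "real n \<le> norm (x - y) / h + 1"
    unfolding n_def using h by (auto simp: of_nat_nat)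
  show ?thesis
  proof (cases "n = 0")
    case True
    then have "x = y" using n h by (simp add: divide_le_0_iff)
    then show ?thesis using c by simp
  next
    case False
    define w where "w = (1 / real n) *\<^sub>R (x - y)"
    have "norm w \<le> h" using n(1) False h unfolding w_def norm_scaleR by (simp add: field_simps)
    moreover have "y + real n *\<^sub>R w = x" using False by (simp add: w_def)
    ultimately have "u x - u y \<le> real n * c" using iter by metis
    also have "\<dots> \<le> (norm (x - y) / h + 1) * c" using n c by (intro mult_right_mono) auto
    finally show ?thesis by (simp add: mult.commute)
  qed
qed

text \<open>
  At a minimum point of \<open>u\<close> the fixed point equation bounds \<open>h^2 * u\<close> from below by a constant times
  \<open>- h\<close>; the competitor without displacement gives the upper bound.
\<close>

lemma discounted_bound:
  fixes V :: "real ^ 'n \<Rightarrow> real"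
  assumes u: "continuous_on UNIV u" "int_periodic u"
    "\<And>x. u x = lax h p (\<lambda>y. (1 - h^2) * u y - h * V y) x"
    and M: "\<And>x. \<bar>V x\<bar> \<le> M" and h: "0 < h" "h < 1"
  shows "\<bar>u x\<bar> \<le> (M + (norm p)^2 / 2) / h"
proof -
  obtain B where B: "B > 0" "\<And>x. \<bar>u x\<bar> \<le> B" using int_periodic_bounded[OF u(2,1)] by blast
  have hh: "h^2 < 1" using h by (simp add: power_less_one_iff)
  have bdd: "\<forall>y. - (B + h * M) \<le> (1 - h^2) * u y - h * V y"
  proof
    fix y
    have "(1 - h^2) * \<bar>u y\<bar> \<le> 1 * B" using hh B(2)[of y] by (intro mult_mono) auto
    moreover have "h * \<bar>V y\<bar> \<le> h * M" using h M[of y] by (intro mult_left_mono) auto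
    moreover have "- ((1 - h^2) * \<bar>u y\<bar>) \<le> (1 - h^2) * u y"
      using hh mult_left_mono[of "- \<bar>u y\<bar>" "u y" "1 - h^2"] by simp
    moreover have "h * V y \<le> h * \<bar>V y\<bar>" using h by (intro mult_left_mono) auto
    ultimately show "- (B + h * M) \<le> (1 - h^2) * u y - h * V y" by linarith
  qed
  have "- u x \<le> (M + (norm p)^2 / 2) / h"
  proof -
    have "int_periodic (\<lambda>x. - u x)" "continuous_on UNIV (\<lambda>x. - u x)"
      using u(1,2) by (auto simp: int_periodic_def intro!: continuous_on_minus)
    then obtain x0 where x0: "\<And>y. - u y \<le> - u x0"
      by (rule int_periodic_attains_max) blast
    have "(1 - h^2) * u x0 - h * M - h * (norm p)^2 / 2 \<le> lax h p (\<lambda>y. (1 - h^2) * u y - h * V y) x0"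
    proof (rule lax_ge[OF h(1)])
      fix z
      have "(1 - h^2) * u x0 \<le> (1 - h^2) * u (x0 - z)"
        using hh x0[of "x0 - z"] by (intro mult_left_mono) auto
      moreover have "h * V (x0 - z) \<le> h * M" using h M[of "x0 - z"] by (intro mult_left_mono) auto
      ultimately show "(1 - h^2) * u x0 - h * M - h * (norm p)^2 / 2
          \<le> (1 - h^2) * u (x0 - z) - h * V (x0 - z) + ((norm z)^2 / (2 * h) - p \<bullet> z)"
        using kinetic_ge[OF h(1), of p z] by linarith
    qed
    then have "h * (h * - u x0) \<le> h * (M + (norm p)^2 / 2)"
      using u(3)[of x0] by (simp add: algebra_simps power2_eq_square)
    then have "h * - u x0 \<le> M + (norm p)^2 / 2" using h by (simp only: mult_le_cancel_left_pos)
    then have "- u x0 \<le> (M + (norm p)^2 / 2) / h" using h by (simp add: field_simps)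
    then show ?thesis using x0[of x] by linarith
  qed
  moreover have "u x \<le> (M + (norm p)^2 / 2) / h"
  proof -
    have "u x \<le> (1 - h^2) * u x - h * V x"
      using lax_le[OF h(1) bdd, of p x 0] u(3)[of x] by simp
    also have "\<dots> \<le> (1 - h^2) * u x + h * M"
      using mult_left_mono[of "- V x" M h] M[of x] h by (simp add: abs_le_iff)
    finally have "h * (h * u x) \<le> h * M" by (simp add: algebra_simps power2_eq_square)
    then have "h * u x \<le> M" using h by (simp only: mult_le_cancel_left_pos)
    then have "u x \<le> M / h" using h by (simp add: field_simps)
    also have "\<dots> \<le> (M + (norm p)^2 / 2) / h" using h by (intro divide_right_mono) auto
    finally show ?thesis .
  qed
  ultimately show ?thesis by (simp add: abs_le_iff)
qed

text \<open>
  The discount \<open>1 - h^2\<close> for a time step \<open>h\<close> is the discount rate \<open>h\<close> per unit of time, which vanishes together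
  with the step. The last two conjuncts express the fixed point equation of the discounted step by velocities \<open>q\<close>. An
  \<open>h^2\<close>-optimal velocity takes the place of a minimizer; its error is negligible after division by \<open>h\<close>.
\<close>

definition discounted_solution ::
    "(real ^ 'n \<Rightarrow> real) \<Rightarrow> real ^ 'n \<Rightarrow> real \<Rightarrow> real \<Rightarrow> real \<Rightarrow> real \<Rightarrow> (real ^ 'n \<Rightarrow> real) \<Rightarrow> bool" where
  "discounted_solution V p C L R h u \<longleftrightarrow> continuous_on UNIV u \<and> int_periodic u \<and>
    (\<forall>x. \<bar>h * u x\<bar> \<le> C) \<and> (\<forall>x y. \<bar>u x - u y\<bar> \<le> L * norm (x - y)) \<and>
    (\<forall>x q. u x \<le> (1 - h^2) * u (x - h *\<^sub>R q) - h * V (x - h *\<^sub>R q) + h * ((norm q)^2 / 2 - p \<bullet> q)) \<and>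
    (\<forall>x. \<exists>q. norm q \<le> R \<and> (1 - h^2) * u (x - h *\<^sub>R q) - h * V (x - h *\<^sub>R q) + h * ((norm q)^2 / 2 - p \<bullet> q) \<le> u x + h^2)"

text \<open>
  The bounds do not depend on \<open>h\<close>. Chaining single steps gives \<open>\<bar>u x - u y\<bar> \<le> K (\<bar>x - y\<bar> + h)\<close>; with this, a nearly minimizing
  displacement has length at most \<open>h R\<close>, and using it as a competitor at a nearby
  point turns the estimate into a true Lipschitz bound.
\<close>

lemma discounted_estimates:
  fixes V :: "real ^ 'n \<Rightarrow> real" and p :: "real ^ 'n"
  assumes V: "continuous_on UNIV V" "int_periodic V"
  obtains C R L where "\<And>h. 0 < h \<Longrightarrow> h < 1 \<Longrightarrow> \<exists>u. discounted_solution V p C L R h u"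
proof -
  obtain M where M: "M > 0" "\<And>x. \<bar>V x\<bar> \<le> M" using int_periodic_bounded[OF V(2,1)] by blast
  define C where "C = M + (norm p)^2 / 2"
  define K where "K = C + M + 1/2 + norm p"
  define R where "R = 2 * (K + norm p) + 2 * (K + C + M + 1) + 1"
  define L where "L = (1 + 2 * R) / 2 + norm p"
  have C: "C \<ge> 0" using M by (simp add: C_def)
  have K: "K \<ge> 0" using C M by (simp add: K_def)
  have R: "R \<ge> 0" using K C M by (simp add: R_def)
  have L: "L \<ge> 0" using R by (simp add: L_def)
  show thesis
  proof (rule that[of C L R])
    fix h :: real assume h: "0 < h" "h < 1"
    then have h2: "0 < h^2" "h^2 < 1" by (auto simp: power_less_one_iff)
    have b: "0 \<le> 1 - h^2" "1 - h^2 < 1" using h2 by auto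
    obtain u where u: "continuous_on UNIV u" "int_periodic u"
      "\<And>x. u x = lax h p (\<lambda>y. (1 - h^2) * u y - h * V y) x"
      using discounted_fixed_point[OF V h(1) b, of p] by blast
    let ?g = "\<lambda>y. (1 - h^2) * u y - h * V y"
    have uC: "\<bar>h * u x\<bar> \<le> C" for x
      using discounted_bound[OF u M(2) h, of x] h by (simp add: C_def abs_mult field_simps)
    have huC: "\<bar>h^2 * u x\<bar> \<le> h * C" for x
      using mult_left_mono[OF uC[of x], of h] h by (simp add: abs_mult power2_eq_square)
    have hV: "\<bar>h * V x\<bar> \<le> h * M" for x
      using M(2)[of x] h by (simp add: abs_mult)
    have u_g: "\<bar>?g x - u x\<bar> \<le> h * (C + M)" for x
      using huC[of x] hV[of x] by (simp add: algebra_simps)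
    obtain B where B: "\<And>x. \<bar>u x\<bar> \<le> B" using int_periodic_bounded[OF u(2,1)] by blast
    have bdd: "\<forall>y. - (B + h * (C + M)) \<le> ?g y"
      using u_g B by (smt (verit))
    have le: "u x \<le> ?g (x - z) + ((norm z)^2 / (2 * h) - p \<bullet> z)" for x z
      using lax_le[OF h(1) bdd, of p x z] u(3)[of x] by simp
    \<comment> \<open>The competitor that jumps from \<open>x\<close> to \<open>y\<close> in one step has speed at most 1.\<close>
    have step: "u x - u y \<le> h * K" if "norm (x - y) \<le> h" for x y
    proof -
      have "(norm (x - y))^2 / (2 * h) \<le> h^2 / (2 * h)"
        using that h by (intro divide_right_mono power_mono) auto
      also have "\<dots> = h / 2" using h by (simp add: power2_eq_square)
      finally have "(norm (x - y))^2 / (2 * h) \<le> h / 2" .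
      moreover have "- (p \<bullet> (x - y)) \<le> norm p * h"
        using Cauchy_Schwarz_ineq2[of p "x - y"] mult_left_mono[OF that, of "norm p"] by (simp add: abs_le_iff)
      ultimately show ?thesis
        using le[of x "x - y"] u_g[of y] by (simp add: K_def algebra_simps)
    qed
    have near: "u x - u y \<le> K * (norm (x - y) + h)" for x y
    proof -
      have "u x - u y \<le> h * K * (norm (x - y) / h + 1)"
        using h K by (intro chaining step) auto
      also have "\<dots> = K * (norm (x - y) + h)" using h by (simp add: field_simps)
      finally show ?thesis .
    qed
    have near_min: "norm z \<le> h * R"
      if z: "?g (x - z) + ((norm z)^2 / (2 * h) - p \<bullet> z) < lax h p ?g x + h^2" for x z
    proof -
      have "(norm z)^2 / (2 * h) \<le> u x - u (x - z) + h * (C + M) + p \<bullet> z + h^2"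
        using z u_g[of "x - z"] u(3)[of x] by (simp add: abs_le_iff)
      also have "u x - u (x - z) \<le> K * (norm z + h)" using near[of x "x - z"] by simp
      also have "p \<bullet> z \<le> norm p * norm z" by (rule norm_cauchy_schwarz)
      also have "h^2 \<le> h * 1" unfolding power2_eq_square using h by (intro mult_left_mono) auto
      finally have "(norm z)^2 / (2 * h) \<le> (K + norm p) * norm z + h * (K + C + M + 1)"
        by (simp add: algebra_simps)
      then have "(norm z)^2 \<le> ((K + norm p) * norm z + h * (K + C + M + 1)) * (2 * h)"
        using h by (simp add: pos_divide_le_eq)
      then have "(norm z)^2 / h^2 \<le> ((K + norm p) * norm z + h * (K + C + M + 1)) * (2 * h) / h^2"
        using h by (intro divide_right_mono) auto
      also have "\<dots> = 2 * (K + norm p) * (norm z / h) + 2 * (K + C + M + 1)"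
        using h by (simp add: field_simps power2_eq_square)
      finally have "(norm z / h)^2 \<le> 2 * (K + norm p) * (norm z / h) + 2 * (K + C + M + 1)"
        by (simp add: power_divide)
      then have "norm z / h \<le> R"
        unfolding R_def using K C M by (intro quadratic_growth_bound) auto
      then show ?thesis using h by (simp add: field_simps)
    qed
    have loc: "u x' - u x \<le> norm (x' - x) * L" if "norm (x' - x) \<le> h" for x x'
    proof -
      have "lax h p ?g x' - lax h p ?g x \<le> norm (x' - x) * ((h + 2 * (h * R)) / (2 * h) + norm p)"
        using near_min h2(1) that by (intro lax_lipschitz[OF h(1) bdd, where \<eta>="h^2"]) auto
      also have "(h + 2 * (h * R)) / (2 * h) = (1 + 2 * R) / 2" using h by (simp add: field_simps)
      finally show ?thesis by (simp add: L_def flip: u(3))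
    qed
    have lip: "u x - u y \<le> L * norm (x - y)" for x y
    proof (rule field_le_epsilon)
      fix e :: real assume "e > 0"
      define k where "k = min h (e / (L + 1))"
      have k: "k > 0" "k \<le> h" "k \<le> e / (L + 1)" using h L \<open>e > 0\<close> by (auto simp: k_def)
      have "u x' - u y' \<le> k * L" if "norm (x' - y') \<le> k" for x' y'
        using loc[of x' y'] that k mult_right_mono[OF that L] by linarith
      then have "u x - u y \<le> k * L * (norm (x - y) / k + 1)"
        using k L by (intro chaining) auto
      also have "\<dots> = L * norm (x - y) + L * k" using k by (simp add: field_simps)
      also have "L * k \<le> (L + 1) * (e / (L + 1))" using k L by (intro mult_mono) auto
      also have "\<dots> = e" using L by simp
      finally show "u x - u y \<le> L * norm (x - y) + e" by simp
    qed
    have lip': "\<bar>u x - u y\<bar> \<le> L * norm (x - y)" for x y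
      using lip[of x y] lip[of y x] by (simp add: abs_le_iff norm_minus_commute)
    have scale: "(norm (h *\<^sub>R q))^2 / (2 * h) - p \<bullet> (h *\<^sub>R q) = h * ((norm q)^2 / 2 - p \<bullet> q)" for q
      using h by (simp add: power_mult_distrib field_simps power2_eq_square)
    have sub: "u x \<le> ?g (x - h *\<^sub>R q) + h * ((norm q)^2 / 2 - p \<bullet> q)" for x q
      using le[of x "h *\<^sub>R q"] unfolding scale .
    have sup: "\<exists>q. norm q \<le> R \<and> ?g (x - h *\<^sub>R q) + h * ((norm q)^2 / 2 - p \<bullet> q) \<le> u x + h^2" for x
    proof -
      obtain z where z: "?g (x - z) + ((norm z)^2 / (2 * h) - p \<bullet> z) < lax h p ?g x + h^2"
        using lax_near_minimizer[OF h(1) bdd h2(1)] by blast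
      define q where "q = (1 / h) *\<^sub>R z"
      have zq: "z = h *\<^sub>R q" using h by (simp add: q_def)
      have "norm q \<le> R" using near_min[OF z] h by (simp add: q_def field_simps)
      moreover have "?g (x - h *\<^sub>R q) + h * ((norm q)^2 / 2 - p \<bullet> q) \<le> u x + h^2"
        using z unfolding zq scale by (simp flip: u(3))
      ultimately show ?thesis by blast
    qed
    show "\<exists>u. discounted_solution V p C L R h u"
      unfolding discounted_solution_def using u(1,2) uC lip' sub sup by blast
  qed
qed

lemma C1_mean_value:
  assumes "C1_with_gradient \<phi> D\<phi>"
  obtains t where "0 \<le> t" "t \<le> 1" "\<phi> (x - z) = \<phi> x - z \<bullet> D\<phi> (x - t *\<^sub>R z)"
proof -
  have "((\<lambda>t. \<phi> (x - t *\<^sub>R z)) has_real_derivative - (z \<bullet> D\<phi> (x - t *\<^sub>R z))) (at t)" for t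
  proof -
    have "(\<phi> has_derivative (\<lambda>h. h \<bullet> D\<phi> (x - t *\<^sub>R z))) (at (x - t *\<^sub>R z))"
      using assms unfolding C1_with_gradient_def gderiv_def by blast
    moreover have "((\<lambda>t. x - t *\<^sub>R z) has_derivative (\<lambda>h. - (h *\<^sub>R z))) (at t)"
      by (auto intro!: derivative_eq_intros)
    ultimately have "((\<lambda>t. \<phi> (x - t *\<^sub>R z)) has_derivative (\<lambda>h. (- (h *\<^sub>R z)) \<bullet> D\<phi> (x - t *\<^sub>R z))) (at t)"
      by (rule has_derivative_compose[rotated])
    then show ?thesis
      unfolding has_field_derivative_def by (rule has_derivative_eq_rhs) (simp add: fun_eq_iff)
  qed
  then obtain t where "0 < t" "t < 1" "\<phi> (x - 1 *\<^sub>R z) - \<phi> (x - 0 *\<^sub>R z) = (1 - 0) * - (z \<bullet> D\<phi> (x - t *\<^sub>R z))"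
    using MVT2[of 0 1 "\<lambda>t. \<phi> (x - t *\<^sub>R z)" "\<lambda>t. - (z \<bullet> D\<phi> (x - t *\<^sub>R z))"] by auto
  then show thesis using that[of t] by simp
qed

text \<open>
  Stability of maxima under uniform convergence. The added \<open>(norm (y - x0))^2\<close> makes the maximum at \<open>x0\<close> strict, so
  the maximum points of the approximating functions converge to \<open>x0\<close>; its gradient vanishes there.
\<close>

lemma perturbed_maxima:
  fixes v :: "real ^ 'n \<Rightarrow> real"
  assumes max: "\<forall>\<^sub>F y in nhds x0. v y - \<phi> y \<le> v x0 - \<phi> x0"
    and \<phi>: "C1_with_gradient \<phi> D\<phi>"
    and w: "\<And>n. continuous_on UNIV (w n)" "uniform_limit UNIV w v sequentially"
  obtains x r \<psi> D\<psi> where "r > 0" "x \<longlonglongrightarrow> x0" "C1_with_gradient \<psi> D\<psi>" "D\<psi> x0 = D\<phi> x0"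
    "\<And>n y. norm (y - x0) \<le> r \<Longrightarrow> w n y - \<psi> y \<le> w n (x n) - \<psi> (x n)"
proof -
  obtain d where d: "d > 0" "\<And>y. dist y x0 < d \<Longrightarrow> v y - \<phi> y \<le> v x0 - \<phi> x0"
    using max unfolding eventually_nhds_metric by blast
  define r where "r = d / 2"
  have r: "r > 0" using d by (simp add: r_def)
  define \<psi> where "\<psi> = (\<lambda>y. \<phi> y + 2 / 2 * (norm (y - x0))^2)"
  define D\<psi> where "D\<psi> = (\<lambda>y. D\<phi> y + 2 *\<^sub>R (y - x0))"
  have \<psi>: "C1_with_gradient \<psi> D\<psi>" unfolding \<psi>_def D\<psi>_def by (rule C1_add[OF \<phi> C1_quadratic])
  have "\<exists>x\<in>cball x0 r. \<forall>y\<in>cball x0 r. w n y - \<psi> y \<le> w n x - \<psi> x" for n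
    using r continuous_on_subset[OF C1_imp_continuous[OF \<psi>]] continuous_on_subset[OF w(1)]
    by (intro continuous_attains_sup continuous_intros) auto
  then obtain x where x: "\<And>n. x n \<in> cball x0 r"
      "\<And>n y. y \<in> cball x0 r \<Longrightarrow> w n y - \<psi> y \<le> w n (x n) - \<psi> (x n)"
    by metis
  have "x \<longlonglongrightarrow> x0"
  proof (rule metric_LIMSEQ_I)
    fix e :: real assume "e > 0"
    then have "\<forall>\<^sub>F n in sequentially. \<forall>y\<in>UNIV. dist (w n y) (v y) < e^2 / 2"
      by (intro uniform_limitD[OF w(2)]) simp
    then obtain N where N: "\<And>n y. n \<ge> N \<Longrightarrow> \<bar>w n y - v y\<bar> < e^2 / 2"
      unfolding eventually_sequentially dist_real_def by auto
    have "dist (x n) x0 < e" if "n \<ge> N" for n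
    proof -
      have "dist (x n) x0 < d" using x(1)[of n] d by (simp add: r_def dist_commute)
      then have "v (x n) - \<phi> (x n) \<le> v x0 - \<phi> x0" by (rule d)
      moreover have "w n x0 - \<phi> x0 \<le> w n (x n) - \<phi> (x n) - (norm (x n - x0))^2"
        using x(2)[of x0 n] r by (simp add: \<psi>_def)
      ultimately have "(norm (x n - x0))^2 < e^2" using N[OF that, of "x n"] N[OF that, of x0] by linarith
      then show ?thesis using \<open>e > 0\<close> by (simp add: dist_norm power_less_imp_less_base)
    qed
    then show "\<exists>N. \<forall>n\<ge>N. dist (x n) x0 < e" by blast
  qed
  moreover have "D\<psi> x0 = D\<phi> x0" by (simp add: D\<psi>_def)
  moreover have "w n y - \<psi> y \<le> w n (x n) - \<psi> (x n)" if "norm (y - x0) \<le> r" for n y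
    by (rule x(2)) (use that in \<open>simp add: dist_norm norm_minus_commute\<close>)
  ultimately show thesis using that r \<psi> by blast
qed

text \<open>
  At a maximum of \<open>w n - \<psi>\<close>, inserting \<open>q = p + D\<phi> x0\<close> into the inequality of the time step and dividing by
  \<open>h\<close> gives the subsolution property. At a minimum the optimal \<open>q\<close> depends on \<open>n\<close>; since
  \<open>q \<bullet> y - \<bar>q\<bar>^2 / 2 \<le> \<bar>y\<bar>^2 / 2\<close> it need not converge. The discount contributes \<open>h * U\<close>, whose limit \<open>l\<close>
  becomes the constant \<open>- l\<close>.
\<close>

lemma viscosity_limit:
  fixes V :: "real ^ 'n \<Rightarrow> real" and p :: "real ^ 'n"
  assumes V: "continuous_on UNIV V"
    and h: "\<And>n. 0 < h n" "h \<longlonglongrightarrow> 0"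
    and U': "\<And>n. discounted_solution V p C L R (h n) (U n)"
    and l: "(\<lambda>n. h n * U n 0) \<longlonglongrightarrow> l"
    and v: "uniform_limit UNIV (\<lambda>n x. U n x - U n 0) v sequentially"
  shows "viscosity_solution (\<lambda>x q. 1/2 * (norm (p + q))^2 + V x) (- l) v"
proof -
  have U: "\<And>n. continuous_on UNIV (U n)" "\<And>n x y. \<bar>U n x - U n y\<bar> \<le> L * norm (x - y)"
    and sub: "\<And>n x q. U n x \<le> (1 - (h n)^2) * U n (x - h n *\<^sub>R q) - h n * V (x - h n *\<^sub>R q) + h n * ((norm q)^2 / 2 - p \<bullet> q)"
    and sup: "\<And>n x. \<exists>q. norm q \<le> R \<and> (1 - (h n)^2) * U n (x - h n *\<^sub>R q) - h n * V (x - h n *\<^sub>R q)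
        + h n * ((norm q)^2 / 2 - p \<bullet> q) \<le> U n x + (h n)^2"
    using U' unfolding discounted_solution_def by blast+
  define w where "w n x = U n x - U n 0" for n x
  have wv: "uniform_limit UNIV w v sequentially" using v unfolding w_def .
  have w: "continuous_on UNIV (w n)" for n
    unfolding w_def using U(1) by (intro continuous_intros)
  have vc: "continuous_on UNIV v"
    using uniform_limit_theorem[OF _ wv] w by simp
  have hU: "(\<lambda>n. h n * U n (y n)) \<longlonglongrightarrow> l" if y: "y \<longlonglongrightarrow> x0" for y x0
  proof -
    have "(\<lambda>n. h n * w n (y n)) \<longlonglongrightarrow> 0"
    proof (rule Lim_null_comparison)
      have "norm (h n * w n (y n)) \<le> h n * (L * norm (y n))" for n
        using mult_left_mono[OF U(2)[of n "y n" 0], of "h n"] h(1)[of n] by (simp add: abs_mult w_def)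
      then show "\<forall>\<^sub>F n in sequentially. norm (h n * w n (y n)) \<le> h n * (L * norm (y n))"
        by (intro always_eventually) blast
      have "(\<lambda>n. h n * (L * norm (y n))) \<longlonglongrightarrow> 0 * (L * norm x0)"
        by (intro tendsto_intros h y)
      then show "(\<lambda>n. h n * (L * norm (y n))) \<longlonglongrightarrow> 0" by simp
    qed
    from tendsto_add[OF l this] show ?thesis by (simp add: w_def algebra_simps)
  qed
  have Vlim: "(\<lambda>n. V (y n)) \<longlonglongrightarrow> V x0" if "y \<longlonglongrightarrow> x0" for y x0
    using continuous_on_tendsto_compose[OF V that] by simp
  have Dlim: "(\<lambda>n. D\<psi> (y n)) \<longlonglongrightarrow> D\<psi> x0" if "y \<longlonglongrightarrow> x0" "C1_with_gradient \<psi> D\<psi>" for y x0 \<psi> and D\<psi> :: "real ^ 'n \<Rightarrow> real ^ 'n"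
  proof -
    have "continuous_on UNIV D\<psi>" using that(2) unfolding C1_with_gradient_def by blast
    from continuous_on_tendsto_compose[OF this that(1)] show ?thesis by simp
  qed
  have shift: "(\<lambda>n. x n - s n *\<^sub>R (h n *\<^sub>R q n)) \<longlonglongrightarrow> x0"
    if x: "x \<longlonglongrightarrow> x0" and q: "\<And>n. norm (q n) \<le> R'" and s: "\<And>n. 0 \<le> s n \<and> s n \<le> 1"
    for x x0 s q and R' :: real
  proof -
    have "(\<lambda>n. s n *\<^sub>R (h n *\<^sub>R q n)) \<longlonglongrightarrow> 0"
    proof (rule Lim_null_comparison)
      show "\<forall>\<^sub>F n in sequentially. norm (s n *\<^sub>R (h n *\<^sub>R q n)) \<le> h n * R'"
      proof (intro always_eventually allI)
        fix n
        have "norm (s n *\<^sub>R (h n *\<^sub>R q n)) = s n * (h n * norm (q n))"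
          using s[of n] h(1)[of n] by (simp add: abs_mult)
        also have "\<dots> \<le> 1 * (h n * R')"
          using s[of n] q[of n] h(1)[of n] by (intro mult_mono) auto
        finally show "norm (s n *\<^sub>R (h n *\<^sub>R q n)) \<le> h n * R'" by simp
      qed
      show "(\<lambda>n. h n * R') \<longlonglongrightarrow> 0" using tendsto_mult_right[OF h(2), of R'] by simp
    qed
    from tendsto_diff[OF x this] show ?thesis by simp
  qed
  have "viscosity_subsolution (\<lambda>x q. 1/2 * (norm (p + q))^2 + V x) (- l) v"
    unfolding viscosity_subsolution_def
  proof (intro conjI vc allI impI)
    fix \<phi> D\<phi> x0
    assume \<phi>: "C1_with_gradient \<phi> D\<phi>" and max: "\<forall>\<^sub>F y in nhds x0. v y - \<phi> y \<le> v x0 - \<phi> x0"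
    obtain x r \<psi> D\<psi> where r: "r > 0" and x: "x \<longlonglongrightarrow> x0" and \<psi>: "C1_with_gradient \<psi> D\<psi>" "D\<psi> x0 = D\<phi> x0"
      and m: "\<And>n y. norm (y - x0) \<le> r \<Longrightarrow> w n y - \<psi> y \<le> w n (x n) - \<psi> (x n)"
      by (rule perturbed_maxima[OF max \<phi> w wv]) blast
    define q where "q = p + D\<phi> x0"
    have "\<exists>t. 0 \<le> t \<and> t \<le> 1 \<and> \<psi> (x n - h n *\<^sub>R q) = \<psi> (x n) - (h n *\<^sub>R q) \<bullet> D\<psi> (x n - t *\<^sub>R (h n *\<^sub>R q))" for n
      by (rule C1_mean_value[OF \<psi>(1)]) blast
    then obtain t where t: "\<And>n. 0 \<le> t n \<and> t n \<le> 1"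
      "\<And>n. \<psi> (x n - h n *\<^sub>R q) = \<psi> (x n) - (h n *\<^sub>R q) \<bullet> D\<psi> (x n - t n *\<^sub>R (h n *\<^sub>R q))"
      by metis
    define y where "y n = x n - h n *\<^sub>R q" for n
    define \<xi> where "\<xi> n = x n - t n *\<^sub>R (h n *\<^sub>R q)" for n
    have y: "y \<longlonglongrightarrow> x0" using shift[OF x, of "\<lambda>_. q" "norm q" "\<lambda>_. 1"] by (simp add: y_def[abs_def])
    have \<xi>: "\<xi> \<longlonglongrightarrow> x0" using shift[OF x, of "\<lambda>_. q" "norm q" t] t(1) by (simp add: \<xi>_def[abs_def])
    have "\<forall>\<^sub>F n in sequentially. dist (y n) x0 < r" using tendstoD[OF y r] .
    then have "\<forall>\<^sub>F n in sequentially. q \<bullet> D\<psi> (\<xi> n) \<le> - (h n * U n (y n)) - V (y n) + ((norm q)^2 / 2 - p \<bullet> q)"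
    proof eventually_elim
      case (elim n)
      then have "w n (y n) - \<psi> (y n) \<le> w n (x n) - \<psi> (x n)" using m[of "y n" n] by (simp add: dist_norm)
      moreover have "\<psi> (y n) = \<psi> (x n) - h n * (q \<bullet> D\<psi> (\<xi> n))" using t(2)[of n] by (simp add: y_def \<xi>_def)
      ultimately have "h n * (q \<bullet> D\<psi> (\<xi> n)) \<le> U n (x n) - U n (y n)" by (simp add: w_def)
      also have "\<dots> \<le> h n * (- (h n * U n (y n)) - V (y n) + ((norm q)^2 / 2 - p \<bullet> q))"
        using sub[of n "x n" q] by (simp add: y_def algebra_simps power2_eq_square)
      finally show ?case using h(1)[of n] by simp
    qed
    moreover have "(\<lambda>n. q \<bullet> D\<psi> (\<xi> n)) \<longlonglongrightarrow> q \<bullet> D\<psi> x0"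
      by (intro tendsto_inner tendsto_const Dlim[OF \<xi> \<psi>(1)])
    moreover have "(\<lambda>n. - (h n * U n (y n)) - V (y n) + ((norm q)^2 / 2 - p \<bullet> q))
        \<longlonglongrightarrow> - l - V x0 + ((norm q)^2 / 2 - p \<bullet> q)"
      by (intro tendsto_add tendsto_diff tendsto_minus tendsto_const hU[OF y] Vlim[OF y])
    ultimately have "q \<bullet> D\<psi> x0 \<le> - l - V x0 + ((norm q)^2 / 2 - p \<bullet> q)"
      using tendsto_le[OF trivial_limit_sequentially] by blast
    moreover have "q \<bullet> D\<psi> x0 + p \<bullet> q = (norm q)^2"
      by (simp add: \<psi>(2) q_def power2_norm_eq_inner inner_add_left inner_add_right inner_commute)
    ultimately show "1/2 * (norm (p + D\<phi> x0))^2 + V x0 \<le> - l" unfolding q_def by simp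
  qed
  moreover have "viscosity_supersolution (\<lambda>x q. 1/2 * (norm (p + q))^2 + V x) (- l) v"
    unfolding viscosity_supersolution_def
  proof (intro conjI vc allI impI)
    fix \<phi> D\<phi> x0
    assume \<phi>: "C1_with_gradient \<phi> D\<phi>" and min: "\<forall>\<^sub>F y in nhds x0. v y - \<phi> y \<ge> v x0 - \<phi> x0"
    have max: "\<forall>\<^sub>F y in nhds x0. - v y - - \<phi> y \<le> - v x0 - - \<phi> x0"
      using min by eventually_elim simp
    have wv': "uniform_limit UNIV (\<lambda>n x. - w n x) (\<lambda>x. - v x) sequentially"
      by (intro uniform_limit_intros wv)
    obtain x r \<psi> D\<psi> where r: "r > 0" and x: "x \<longlonglongrightarrow> x0" and \<psi>: "C1_with_gradient \<psi> D\<psi>" "D\<psi> x0 = - D\<phi> x0"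
      and m: "\<And>n y. norm (y - x0) \<le> r \<Longrightarrow> - w n y - \<psi> y \<le> - w n (x n) - \<psi> (x n)"
      by (rule perturbed_maxima[OF max C1_minus[OF \<phi>] continuous_on_minus[OF w] wv']) blast
    have "\<forall>n. \<exists>q. norm q \<le> R \<and> (1 - (h n)^2) * U n (x n - h n *\<^sub>R q) - h n * V (x n - h n *\<^sub>R q)
        + h n * ((norm q)^2 / 2 - p \<bullet> q) \<le> U n (x n) + (h n)^2"
      using sup by blast
    from choice[OF this] obtain q where q: "\<And>n. norm (q n) \<le> R"
      "\<And>n. (1 - (h n)^2) * U n (x n - h n *\<^sub>R q n) - h n * V (x n - h n *\<^sub>R q n)
        + h n * ((norm (q n))^2 / 2 - p \<bullet> q n) \<le> U n (x n) + (h n)^2"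
      by blast
    have "\<exists>t. 0 \<le> t \<and> t \<le> 1 \<and> \<psi> (x n - h n *\<^sub>R q n) = \<psi> (x n) - (h n *\<^sub>R q n) \<bullet> D\<psi> (x n - t *\<^sub>R (h n *\<^sub>R q n))" for n
      by (rule C1_mean_value[OF \<psi>(1)]) blast
    then obtain t where t: "\<And>n. 0 \<le> t n \<and> t n \<le> 1"
      "\<And>n. \<psi> (x n - h n *\<^sub>R q n) = \<psi> (x n) - (h n *\<^sub>R q n) \<bullet> D\<psi> (x n - t n *\<^sub>R (h n *\<^sub>R q n))"
      by metis
    define y where "y n = x n - h n *\<^sub>R q n" for n
    define \<xi> where "\<xi> n = x n - t n *\<^sub>R (h n *\<^sub>R q n)" for n
    have y: "y \<longlonglongrightarrow> x0" using shift[OF x q(1), of "\<lambda>_. 1"] by (simp add: y_def[abs_def])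
    have \<xi>: "\<xi> \<longlonglongrightarrow> x0" using shift[OF x q(1), of t] t(1) by (simp add: \<xi>_def[abs_def])
    have "\<forall>\<^sub>F n in sequentially. dist (y n) x0 < r" using tendstoD[OF y r] .
    then have "\<forall>\<^sub>F n in sequentially. - (h n * U n (y n)) - V (y n) - h n \<le> (norm (p - D\<psi> (\<xi> n)))^2 / 2"
    proof eventually_elim
      case (elim n)
      then have "- w n (y n) - \<psi> (y n) \<le> - w n (x n) - \<psi> (x n)" using m[of "y n" n] by (simp add: dist_norm)
      moreover have "\<psi> (y n) = \<psi> (x n) - h n * (q n \<bullet> D\<psi> (\<xi> n))" using t(2)[of n] by (simp add: y_def \<xi>_def)
      ultimately have "U n (x n) - U n (y n) \<le> - (h n * (q n \<bullet> D\<psi> (\<xi> n)))" by (simp add: w_def)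
      moreover have "h n * (- (h n * U n (y n)) - V (y n) + ((norm (q n))^2 / 2 - p \<bullet> q n) - h n) \<le> U n (x n) - U n (y n)"
        using q(2)[of n] by (simp add: y_def algebra_simps power2_eq_square)
      ultimately have "h n * (- (h n * U n (y n)) - V (y n) + ((norm (q n))^2 / 2 - p \<bullet> q n) - h n) \<le> h n * - (q n \<bullet> D\<psi> (\<xi> n))"
        by linarith
      then have 1: "- (h n * U n (y n)) - V (y n) + ((norm (q n))^2 / 2 - p \<bullet> q n) - h n \<le> - (q n \<bullet> D\<psi> (\<xi> n))"
        using h(1)[of n] by (simp only: mult_le_cancel_left_pos)
      have "0 \<le> (norm (p - D\<psi> (\<xi> n) - q n))^2" by simp
      also have "\<dots> = (norm (p - D\<psi> (\<xi> n)))^2 + (norm (q n))^2 - 2 * (p \<bullet> q n) + 2 * (q n \<bullet> D\<psi> (\<xi> n))"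
        unfolding power2_norm_eq_inner by (simp add: inner_diff_left inner_diff_right inner_commute)
      finally show ?case using 1 by simp
    qed
    moreover have "(\<lambda>n. (norm (p - D\<psi> (\<xi> n)))^2 / 2) \<longlonglongrightarrow> (norm (p - D\<psi> x0))^2 / 2"
      by (intro tendsto_intros Dlim[OF \<xi> \<psi>(1)]) auto
    moreover have "(\<lambda>n. - (h n * U n (y n)) - V (y n) - h n) \<longlonglongrightarrow> - l - V x0 - 0"
      by (intro tendsto_diff tendsto_minus hU[OF y] Vlim[OF y] h(2))
    ultimately have "- l - V x0 - 0 \<le> (norm (p - D\<psi> x0))^2 / 2"
      using tendsto_le[OF trivial_limit_sequentially] by blast
    then show "- l \<le> 1/2 * (norm (p + D\<phi> x0))^2 + V x0" by (simp add: \<psi>(2))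
  qed
  ultimately show ?thesis unfolding viscosity_solution_def by blast
qed

text \<open>
  The functions \<open>U n - U n 0\<close> are equi-Lipschitz and periodic, so a subsequence converges uniformly; the
  bounded numbers \<open>h n * U n 0\<close> converge along a further subsequence.
\<close>

lemma cell_solution_exists:
  fixes V :: "real ^ 'n \<Rightarrow> real" and p :: "real ^ 'n"
  assumes V: "continuous_on UNIV V" "int_periodic V"
  shows "\<exists>c v. cell_solution V p c v"
proof -
  obtain C R L where est: "\<And>h. 0 < h \<Longrightarrow> h < 1 \<Longrightarrow> \<exists>u. discounted_solution V p C L R h u"
    by (rule discounted_estimates[OF V]) blast
  define h where "h n = 1 / (real n + 2)" for n
  have h: "0 < h n" "h n < 1" for n by (auto simp: h_def)
  have h0: "h \<longlonglongrightarrow> 0" unfolding h_def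
    using LIMSEQ_ignore_initial_segment[OF lim_1_over_n[where 'a=real], of 2] by (simp add: add.commute)
  have "\<forall>n. \<exists>u. discounted_solution V p C L R (h n) u" using est h by blast
  from choice[OF this] obtain U where U': "\<And>n. discounted_solution V p C L R (h n) (U n)" by blast
  then have U: "\<And>n. int_periodic (U n)" "\<And>n x. \<bar>h n * U n x\<bar> \<le> C" "\<And>n x y. \<bar>U n x - U n y\<bar> \<le> L * norm (x - y)"
    unfolding discounted_solution_def by blast+
  define w where "w n x = U n x - U n 0" for n x
  let ?S = "cbox 0 (1 :: real ^ 'n)"
  obtain b where b: "\<And>x. x \<in> ?S \<Longrightarrow> norm x \<le> b"
    using bounded_cbox[of 0 "1 :: real ^ 'n"] unfolding bounded_iff by blast
  have wlip: "\<bar>w n x - w n y\<bar> \<le> (\<bar>L\<bar> + 1) * norm (x - y)" for n x y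
  proof -
    have "\<bar>w n x - w n y\<bar> \<le> L * norm (x - y)" using U(3)[of n x y] by (simp add: w_def)
    also have "\<dots> \<le> (\<bar>L\<bar> + 1) * norm (x - y)" by (intro mult_right_mono) auto
    finally show ?thesis .
  qed
  obtain g k where g: "continuous_on ?S g" "strict_mono (k :: nat \<Rightarrow> nat)"
    "\<And>e. 0 < e \<Longrightarrow> \<exists>N. \<forall>n x. n \<ge> N \<and> x \<in> ?S \<longrightarrow> norm (w (k n) x - g x) < e"
  proof (rule Arzela_Ascoli[of ?S w "(\<bar>L\<bar> + 1) * b"])
    show "norm (w n x) \<le> (\<bar>L\<bar> + 1) * b" if "x \<in> ?S" for n x
    proof -
      have "norm (w n x) \<le> (\<bar>L\<bar> + 1) * norm x" using wlip[of n x 0] by (simp add: w_def)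
      also have "\<dots> \<le> (\<bar>L\<bar> + 1) * b" using b[OF that] by (intro mult_left_mono) auto
      finally show ?thesis .
    qed
    show "\<exists>d>0. \<forall>n y. y \<in> ?S \<and> norm (x - y) < d \<longrightarrow> norm (w n x - w n y) < e" if "0 < e" for x e
    proof (intro exI[of _ "e / (\<bar>L\<bar> + 1)"] conjI allI impI)
      show "0 < e / (\<bar>L\<bar> + 1)" using that by simp
      fix n y assume "y \<in> ?S \<and> norm (x - y) < e / (\<bar>L\<bar> + 1)"
      then have "(\<bar>L\<bar> + 1) * norm (x - y) < e" by (simp add: pos_less_divide_eq mult.commute)
      with wlip[of n x y] show "norm (w n x - w n y) < e" by simp
    qed
  qed auto
  have "bounded (range (\<lambda>n. h (k n) * U (k n) 0))"
    using U(2) unfolding bounded_iff by auto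
  then obtain l r where r: "strict_mono (r :: nat \<Rightarrow> nat)" "((\<lambda>n. h (k n) * U (k n) 0) \<circ> r) \<longlonglongrightarrow> l"
    using bounded_imp_convergent_subsequence by blast
  define \<kappa> where "\<kappa> n = k (r n)" for n
  have \<kappa>: "strict_mono \<kappa>" using strict_mono_o[OF g(2) r(1)] by (simp add: \<kappa>_def[abs_def] o_def)
  have h\<kappa>: "(\<lambda>n. h (\<kappa> n)) \<longlonglongrightarrow> 0" using LIMSEQ_subseq_LIMSEQ[OF h0 \<kappa>] by (simp add: o_def)
  have l: "(\<lambda>n. h (\<kappa> n) * U (\<kappa> n) 0) \<longlonglongrightarrow> l" using r(2) by (simp add: \<kappa>_def o_def)
  define z where "z x = (SOME z. (\<forall>i. z $ i \<in> \<int>) \<and> x + z \<in> ?S)" for x :: "real ^ 'n"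
  have z: "(\<forall>i. z x $ i \<in> \<int>) \<and> x + z x \<in> ?S" for x
    unfolding z_def by (rule someI_ex) (metis integer_translate_into_cube)
  define v where "v x = g (x + z x)" for x
  have wper: "w n (x + z') = w n x" if "\<forall>i. z' $ i \<in> \<int>" for n x z'
    using int_periodicD[OF U(1) that] by (simp add: w_def)
  have lim: "uniform_limit UNIV (\<lambda>n. w (\<kappa> n)) v sequentially"
  proof (rule uniform_limitI)
    fix e :: real assume "e > 0"
    then obtain N where N: "\<And>n x. n \<ge> N \<Longrightarrow> x \<in> ?S \<Longrightarrow> norm (w (k n) x - g x) < e" using g(3) by blast
    have "dist (w (\<kappa> n) x) (v x) < e" if "n \<ge> N" for n x
    proof -
      have "r n \<ge> N" using that seq_suble[OF r(1), of n] by linarith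
      then have "norm (w (\<kappa> n) (x + z x) - g (x + z x)) < e" using N z by (simp add: \<kappa>_def)
      then show ?thesis using wper z by (simp add: v_def dist_norm)
    qed
    then show "\<forall>\<^sub>F n in sequentially. \<forall>x\<in>UNIV. dist (w (\<kappa> n) x) (v x) < e"
      unfolding eventually_sequentially by blast
  qed
  have ptw: "(\<lambda>n. w (\<kappa> n) x) \<longlonglongrightarrow> v x" for x using tendsto_uniform_limitI[OF lim] by simp
  have "v (x + z') = v x" if "\<forall>i. z' $ i \<in> \<int>" for x z'
    using LIMSEQ_unique[OF ptw[of "x + z'"]] ptw[of x] wper[OF that] by simp
  then have "int_periodic v" unfolding int_periodic_def by blast
  moreover have "viscosity_solution (\<lambda>x q. 1/2 * (norm (p + q))^2 + V x) (- l) v"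
    by (rule viscosity_limit[where h="\<lambda>n. h (\<kappa> n)" and U="\<lambda>n. U (\<kappa> n)",
          OF V(1) h(1) h\<kappa> U' l lim[unfolded w_def]])
  ultimately show ?thesis unfolding cell_solution_def by blast
qed

lemma effective_Hamiltonian_cell_solution:
  fixes V :: "real ^ 'n \<Rightarrow> real"
  assumes V: "continuous_on UNIV V" "int_periodic V"
  obtains v where "cell_solution V p (effective_Hamiltonian V p) v"
proof -
  have "\<exists>!c. \<exists>v. cell_solution V p c v"
    using cell_solution_exists[OF V] cell_constant_le_doubling[OF V] by (metis order_antisym)
  from theI'[OF this] show thesis using that unfolding effective_Hamiltonian_def by blast
qed

section \<open>Expansion along a ray of large momenta\<close>

definition C1_bounded :: "('a::real_inner \<Rightarrow> real) \<Rightarrow> ('a \<Rightarrow> 'a) \<Rightarrow> bool" where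
  "C1_bounded f Df \<longleftrightarrow> C1_with_gradient f Df \<and> (\<exists>B. \<forall>x. \<bar>f x\<bar> \<le> B) \<and> (\<exists>B. \<forall>x. norm (Df x) \<le> B)"

lemma C1_boundedD: "C1_bounded f Df \<Longrightarrow> C1_with_gradient f Df"
  by (simp add: C1_bounded_def)

lemma C1_bounded_gradient:
  assumes "C1_bounded f Df" obtains B where "\<And>x. norm (Df x) \<le> B"
  using assms unfolding C1_bounded_def by blast

lemma C1_bounded_add:
  assumes "C1_bounded f Df" "C1_bounded g Dg"
  shows "C1_bounded (\<lambda>x. f x + g x) (\<lambda>x. Df x + Dg x)"
proof -
  obtain B1 B2 B3 B4 where B: "\<And>x. \<bar>f x\<bar> \<le> B1" "\<And>x. norm (Df x) \<le> B2" "\<And>x. \<bar>g x\<bar> \<le> B3" "\<And>x. norm (Dg x) \<le> B4"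
    using assms unfolding C1_bounded_def by blast
  have "\<bar>f x + g x\<bar> \<le> B1 + B3" for x
    using B(1)[of x] B(3)[of x] by linarith
  moreover have "norm (Df x + Dg x) \<le> B2 + B4" for x
    using B(2)[of x] B(4)[of x] by (rule norm_triangle_mono)
  ultimately show ?thesis
    using C1_add assms unfolding C1_bounded_def by blast
qed

lemma C1_bounded_mult:
  assumes "C1_bounded f Df" "C1_bounded g Dg"
  shows "C1_bounded (\<lambda>x. f x * g x) (\<lambda>x. f x *\<^sub>R Dg x + g x *\<^sub>R Df x)"
proof -
  obtain B1 B2 B3 B4 where B: "\<And>x. \<bar>f x\<bar> \<le> B1" "\<And>x. norm (Df x) \<le> B2" "\<And>x. \<bar>g x\<bar> \<le> B3" "\<And>x. norm (Dg x) \<le> B4"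
    using assms unfolding C1_bounded_def by blast
  have B0: "B1 \<ge> 0" "B3 \<ge> 0" using B(1)[of undefined] B(3)[of undefined] by linarith+
  have "\<bar>f x * g x\<bar> \<le> B1 * B3" for x
    unfolding abs_mult using B(1)[of x] B(3)[of x] B0 by (intro mult_mono) auto
  moreover have "norm (f x *\<^sub>R Dg x + g x *\<^sub>R Df x) \<le> B1 * B4 + B3 * B2" for x
    using B(1)[of x] B(2)[of x] B(3)[of x] B(4)[of x] B0
    by (intro norm_triangle_mono) (auto simp: intro!: mult_mono)
  moreover have "C1_with_gradient (\<lambda>x. f x * g x) (\<lambda>x. f x *\<^sub>R Dg x + g x *\<^sub>R Df x)"
    using assms C1_imp_continuous[of f Df] C1_imp_continuous[of g Dg]
    unfolding C1_bounded_def C1_with_gradient_def by (auto intro!: GDERIV_mult continuous_intros)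
  ultimately show ?thesis unfolding C1_bounded_def by blast
qed

lemma C1_bounded_const: "C1_bounded (\<lambda>x. c) (\<lambda>x. 0)"
  unfolding C1_bounded_def C1_with_gradient_def by (auto intro: GDERIV_const)

lemma C1_bounded_cmult: "C1_bounded f Df \<Longrightarrow> C1_bounded (\<lambda>x. c * f x) (\<lambda>x. c *\<^sub>R Df x)"
  using C1_bounded_mult[OF C1_bounded_const, of f Df c] by simp

lemma C1_bounded_sum:
  "finite J \<Longrightarrow> (\<And>j. j \<in> J \<Longrightarrow> C1_bounded (f j) (Df j)) \<Longrightarrow>
    C1_bounded (\<lambda>x. \<Sum>j\<in>J. f j x) (\<lambda>x. \<Sum>j\<in>J. Df j x)"
  by (induction J rule: finite_induct) (auto intro: C1_bounded_const C1_bounded_add)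

lemma C1_bounded_sin: "C1_bounded (\<lambda>x. sin (w \<bullet> x + t)) (\<lambda>x. cos (w \<bullet> x + t) *\<^sub>R w)"
  unfolding C1_bounded_def
proof (intro conjI)
  have "((\<lambda>x. sin (w \<bullet> x + t)) has_derivative (\<lambda>h. h \<bullet> (cos (w \<bullet> x + t) *\<^sub>R w))) (at x)" for x
    by (auto intro!: derivative_eq_intros simp: fun_eq_iff inner_commute)
  then show "C1_with_gradient (\<lambda>x. sin (w \<bullet> x + t)) (\<lambda>x. cos (w \<bullet> x + t) *\<^sub>R w)"
    unfolding C1_with_gradient_def gderiv_def
    by (auto intro!: continuous_intros)
  show "\<exists>B. \<forall>x. \<bar>sin (w \<bullet> x + t)\<bar> \<le> B" using abs_sin_le_one by blast
  have "norm (cos (w \<bullet> x + t) *\<^sub>R w) \<le> norm w" for x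
    using mult_right_mono[OF abs_cos_le_one, of "norm w"] by simp
  then show "\<exists>B. \<forall>x. norm (cos (w \<bullet> x + t) *\<^sub>R w) \<le> B" by blast
qed

lemma C1_bounded_cos: "C1_bounded (\<lambda>x. cos (w \<bullet> x + t)) (\<lambda>x. (- sin (w \<bullet> x + t)) *\<^sub>R w)"
  using C1_bounded_sin[of w "t + pi / 2"] by (simp add: sin_add cos_add add.assoc[symmetric])

lemma C1_bounded_cong:
  "C1_bounded f Df \<Longrightarrow> (\<And>x. f x = g x) \<Longrightarrow> (\<And>x. Df x = Dg x) \<Longrightarrow> C1_bounded g Dg"
  by (metis ext)

text \<open>
  Energy of the corrector \<open>f0 + f1 / s\<close> at the momentum \<open>s Q\<close>. A part \<open>F0\<close> of order one is allowed
  because it is orthogonal to \<open>Q\<close>; it contributes its kinetic energy.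
\<close>

lemma energy_first_order:
  fixes Q F0 F1 :: "'a::real_inner"
  assumes "s \<ge> 1" "norm F0 \<le> B" "norm F1 \<le> B" "Q \<bullet> F0 = 0"
  shows "\<bar>1/2 * (norm (s *\<^sub>R Q + (F0 + (1/s) *\<^sub>R F1)))^2 + v
    - (1/2 * s^2 * (norm Q)^2 + (v + Q \<bullet> F1 + 1/2 * (norm F0)^2))\<bar> \<le> 2 * B^2 / s"
proof -
  have B: "B \<ge> 0" using assms(2) norm_ge_zero order_trans by blast
  have "1/2 * (norm (s *\<^sub>R Q + (F0 + (1/s) *\<^sub>R F1)))^2 + v
    - (1/2 * s^2 * (norm Q)^2 + (v + Q \<bullet> F1 + 1/2 * (norm F0)^2)) = (1/s) * (F0 \<bullet> F1) + 1/2 * (1/s)^2 * (norm F1)^2"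
    using assms(1,4) unfolding power2_norm_eq_inner
    by (simp add: inner_add_left inner_add_right inner_commute power2_eq_square field_simps)
  also have "\<bar>\<dots>\<bar> \<le> (1/s) * B^2 + (1/s) * B^2"
  proof -
    have "\<bar>F0 \<bullet> F1\<bar> \<le> B * B"
      using Cauchy_Schwarz_ineq2[of F0 F1] mult_mono[OF assms(2,3) B norm_ge_zero] by linarith
    then have 1: "\<bar>(1/s) * (F0 \<bullet> F1)\<bar> \<le> (1/s) * B^2"
      using assms(1) by (simp add: abs_mult power2_eq_square divide_right_mono)
    have "(1/s)^2 \<le> 1/s" using assms(1) by (simp add: power2_eq_square field_simps)
    moreover have "(norm F1)^2 \<le> B^2" using assms(3) by (intro power_mono) auto
    ultimately have "(1/s)^2 * (norm F1)^2 \<le> (1/s) * B^2" using assms(1) by (intro mult_mono) auto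
    then have "\<bar>1/2 * (1/s)^2 * (norm F1)^2\<bar> \<le> (1/s) * B^2"
      using zero_le_mult_iff[of "(1/s)^2" "(norm F1)^2"] zero_le_power2[of "1/s"] zero_le_power2[of "norm F1"]
      by linarith
    with 1 show ?thesis by linarith
  qed
  finally show ?thesis by simp
qed

text \<open>
  Energy of the corrector \<open>f1 / s + f2 / s^3\<close> at the momentum \<open>s Q\<close>: the orders 1 and \<open>s^-2\<close> are
  governed by linear equations for \<open>f1\<close> and \<open>f2\<close> along \<open>Q\<close>.
\<close>

lemma energy_second_order:
  fixes Q F1 F2 :: "'a::real_inner"
  assumes "s \<ge> 1" "norm F1 \<le> B" "norm F2 \<le> B"
  shows "\<bar>1/2 * (norm (s *\<^sub>R Q + ((1/s) *\<^sub>R F1 + (1/s^3) *\<^sub>R F2)))^2 + v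
    - (1/2 * s^2 * (norm Q)^2 + (v + Q \<bullet> F1) + (Q \<bullet> F2 + 1/2 * (norm F1)^2) / s^2)\<bar> \<le> 2 * B^2 / s^4"
proof -
  have B: "B \<ge> 0" using assms(2) norm_ge_zero order_trans by blast
  have "1/2 * (norm (s *\<^sub>R Q + ((1/s) *\<^sub>R F1 + (1/s^3) *\<^sub>R F2)))^2 + v
    - (1/2 * s^2 * (norm Q)^2 + (v + Q \<bullet> F1) + (Q \<bullet> F2 + 1/2 * (norm F1)^2) / s^2)
    = (1/s^4) * (F1 \<bullet> F2) + 1/2 * (1/s^4 * (1/s^2)) * (norm F2)^2"
    using assms(1) unfolding power2_norm_eq_inner
    by (simp add: inner_add_left inner_add_right inner_commute field_simps power_numeral_reduce)
  also have "\<bar>\<dots>\<bar> \<le> (1/s^4) * B^2 + (1/s^4) * B^2"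
  proof -
    have "\<bar>F1 \<bullet> F2\<bar> \<le> B * B"
      using Cauchy_Schwarz_ineq2[of F1 F2] mult_mono[OF assms(2,3) B norm_ge_zero] by linarith
    then have 1: "\<bar>(1/s^4) * (F1 \<bullet> F2)\<bar> \<le> (1/s^4) * B^2"
      using assms(1) by (simp add: abs_mult power2_eq_square divide_right_mono)
    have "1/s^2 \<le> 1" using assms(1) by simp
    then have "1/s^4 * (1/s^2) \<le> 1/s^4 * 1" using assms(1) by (intro mult_left_mono) auto
    moreover have "(norm F2)^2 \<le> B^2" using assms(3) by (intro power_mono) auto
    ultimately have 2: "(1/s^4 * (1/s^2)) * (norm F2)^2 \<le> (1/s^4) * B^2" using assms(1) by (intro mult_mono) auto
    have "0 \<le> (1/s^4 * (1/s^2)) * (norm F2)^2" using assms(1) by simp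
    with 2 have "\<bar>1/2 * (1/s^4 * (1/s^2)) * (norm F2)^2\<bar> \<le> (1/s^4) * B^2" by linarith
    with 1 show ?thesis by linarith
  qed
  finally show ?thesis by simp
qed

lemma inner_integer:
  fixes k z :: "real ^ 'n"
  assumes "\<And>i. k $ i \<in> \<int>" "\<And>i. z $ i \<in> \<int>"
  shows "k \<bullet> z \<in> \<int>"
  unfolding inner_vec_def using assms by (auto intro!: Ints_sum Ints_mult)

lemma trig_shift_integer:
  assumes "m \<in> \<int>"
  shows "sin (t + 2 * pi * m) = sin t" "cos (t + 2 * pi * m) = cos t"
proof -
  obtain n where "m = of_int n" using assms Ints_cases by blast
  then show "sin (t + 2 * pi * m) = sin t" "cos (t + 2 * pi * m) = cos t"
    by (simp_all add: sin_add cos_add)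
qed

lemma int_periodic_trig:
  fixes K :: "real ^ 'n"
  assumes "\<And>i. K $ i \<in> \<int>"
  shows "int_periodic (\<lambda>x. cos (2 * pi * (K \<bullet> x) + t))" "int_periodic (\<lambda>x. sin (2 * pi * (K \<bullet> x) + t))"
proof -
  have "2 * pi * (K \<bullet> (x + z)) + t = (2 * pi * (K \<bullet> x) + t) + 2 * pi * (K \<bullet> z)" for x z
    by (simp add: inner_add_right algebra_simps)
  then show "int_periodic (\<lambda>x. cos (2 * pi * (K \<bullet> x) + t))" "int_periodic (\<lambda>x. sin (2 * pi * (K \<bullet> x) + t))"
    unfolding int_periodic_def using trig_shift_integer[OF inner_integer[OF assms]] by metis+
qed

text \<open>
  Along \<open>Q\<close> the corrector equations are solved mode by mode, dividing by the products \<open>K \<bullet> Q\<close> of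
  the frequencies with \<open>Q\<close>. The convention \<open>x / 0 = 0\<close> drops a mode with \<open>K \<bullet> Q = 0\<close> from the corrector. Such resonant modes
  cannot be removed; \<open>res1\<close> and \<open>res2\<close> collect what remains of them, together with the mean value, at the orders
  1 and \<open>s^-2\<close>.
\<close>

locale trig_potential =
  fixes J :: "nat set" and a :: real and A \<theta> :: "nat \<Rightarrow> real" and K :: "nat \<Rightarrow> real ^ 'n"
  assumes finJ: "finite J" and Kint: "\<And>j i. j \<in> J \<Longrightarrow> K j $ i \<in> \<int>"
begin

definition phase :: "nat \<Rightarrow> real ^ 'n \<Rightarrow> real" where
  "phase j x = 2 * pi * (K j \<bullet> x) + \<theta> j"

definition pot :: "real ^ 'n \<Rightarrow> real" where
  "pot x = a + (\<Sum>j\<in>J. A j * cos (phase j x))"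

definition res1 :: "real ^ 'n \<Rightarrow> real ^ 'n \<Rightarrow> real" where
  "res1 Q x = a + (\<Sum>j\<in>J. if K j \<bullet> Q = 0 then A j * cos (phase j x) else 0)"

definition cf :: "real ^ 'n \<Rightarrow> nat \<Rightarrow> real" where
  "cf Q j = A j / (K j \<bullet> Q)"

definition res2 :: "real ^ 'n \<Rightarrow> real ^ 'n \<Rightarrow> real" where
  "res2 Q x = (\<Sum>i\<in>J. \<Sum>j\<in>J. cf Q i * cf Q j * (K i \<bullet> K j) / 4 *
     ((if (K i + K j) \<bullet> Q = 0 then cos (phase i x + phase j x) else 0) +
      (if (K i - K j) \<bullet> Q = 0 then cos (phase i x - phase j x) else 0)))"

definition w1 where "w1 Q x = (\<Sum>j\<in>J. - cf Q j / (2 * pi) * sin (phase j x))"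
definition Dw1 where "Dw1 Q x = (\<Sum>j\<in>J. (- cf Q j * cos (phase j x)) *\<^sub>R K j)"

definition w2 where "w2 Q x = (\<Sum>i\<in>J. \<Sum>j\<in>J. - (cf Q i * cf Q j * (K i \<bullet> K j) / 4) *
     (sin (phase i x + phase j x) / (2 * pi * ((K i + K j) \<bullet> Q)) +
      sin (phase i x - phase j x) / (2 * pi * ((K i - K j) \<bullet> Q))))"
definition Dw2 where "Dw2 Q x = (\<Sum>i\<in>J. \<Sum>j\<in>J. (- (cf Q i * cf Q j * (K i \<bullet> K j) / 4)) *\<^sub>R
     ((cos (phase i x + phase j x) / ((K i + K j) \<bullet> Q)) *\<^sub>R (K i + K j) +
      (cos (phase i x - phase j x) / ((K i - K j) \<bullet> Q)) *\<^sub>R (K i - K j)))"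

text \<open>
  When a function \<open>\<psi>\<close> with gradient parallel to \<open>K0\<close>, orthogonal to \<open>Q\<close>, is added to \<open>w1\<close>, the cross
  term \<open>Dw1 \<bullet> D\<psi>\<close> appears at order \<open>s^-2\<close>. As \<open>\<psi>\<close> is constant along \<open>Q\<close>, this term is removed by \<open>chi\<close> times a function
  of \<open>K0 \<bullet> x\<close>.
\<close>

definition chi where "chi Q K0 x = (\<Sum>j\<in>J. cf Q j * (K j \<bullet> K0) / (2 * pi * (K j \<bullet> Q)) * sin (phase j x))"
definition Dchi where "Dchi Q K0 x = (\<Sum>j\<in>J. (cf Q j * (K j \<bullet> K0) / (K j \<bullet> Q) * cos (phase j x)) *\<^sub>R K j)"

lemma C1_sin_phase: "C1_bounded (\<lambda>x. sin (phase j x)) (\<lambda>x. cos (phase j x) *\<^sub>R ((2 * pi) *\<^sub>R K j))"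
  using C1_bounded_sin[of "(2 * pi) *\<^sub>R K j" "\<theta> j"] by (simp add: phase_def)

lemma C1_sin_phase_pair:
  "C1_bounded (\<lambda>x. sin (phase i x + phase j x)) (\<lambda>x. cos (phase i x + phase j x) *\<^sub>R ((2 * pi) *\<^sub>R (K i + K j)))"
  "C1_bounded (\<lambda>x. sin (phase i x - phase j x)) (\<lambda>x. cos (phase i x - phase j x) *\<^sub>R ((2 * pi) *\<^sub>R (K i - K j)))"
  using C1_bounded_sin[of "(2 * pi) *\<^sub>R (K i + K j)" "\<theta> i + \<theta> j"]
    C1_bounded_sin[of "(2 * pi) *\<^sub>R (K i - K j)" "\<theta> i - \<theta> j"]
  by (auto elim!: C1_bounded_cong simp: phase_def inner_add_left inner_diff_left algebra_simps)

lemma C1_w1: "C1_bounded (w1 Q) (Dw1 Q)"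
proof -
  have "C1_bounded (\<lambda>x. - cf Q j / (2 * pi) * sin (phase j x))
      (\<lambda>x. (- cf Q j / (2 * pi)) *\<^sub>R (cos (phase j x) *\<^sub>R ((2 * pi) *\<^sub>R K j)))" for j
    by (intro C1_bounded_cmult C1_sin_phase)
  from C1_bounded_sum[OF finJ this] show ?thesis
    by (rule C1_bounded_cong) (simp_all add: w1_def Dw1_def)
qed

lemma C1_chi: "C1_bounded (chi Q K0) (Dchi Q K0)"
proof -
  have "C1_bounded (\<lambda>x. cf Q j * (K j \<bullet> K0) / (2 * pi * (K j \<bullet> Q)) * sin (phase j x))
      (\<lambda>x. (cf Q j * (K j \<bullet> K0) / (2 * pi * (K j \<bullet> Q))) *\<^sub>R (cos (phase j x) *\<^sub>R ((2 * pi) *\<^sub>R K j)))" for j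
    by (intro C1_bounded_cmult C1_sin_phase)
  from C1_bounded_sum[OF finJ this] show ?thesis
    by (rule C1_bounded_cong) (simp_all add: chi_def Dchi_def mult.assoc)
qed

lemma C1_w2: "C1_bounded (w2 Q) (Dw2 Q)"
proof -
  have 1: "C1_bounded (\<lambda>x. - (cf Q i * cf Q j * (K i \<bullet> K j) / 4) *
     (1 / (2 * pi * ((K i + K j) \<bullet> Q)) * sin (phase i x + phase j x) +
      1 / (2 * pi * ((K i - K j) \<bullet> Q)) * sin (phase i x - phase j x)))
     (\<lambda>x. (- (cf Q i * cf Q j * (K i \<bullet> K j) / 4)) *\<^sub>R
     ((1 / (2 * pi * ((K i + K j) \<bullet> Q))) *\<^sub>R (cos (phase i x + phase j x) *\<^sub>R ((2 * pi) *\<^sub>R (K i + K j))) +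
      (1 / (2 * pi * ((K i - K j) \<bullet> Q))) *\<^sub>R (cos (phase i x - phase j x) *\<^sub>R ((2 * pi) *\<^sub>R (K i - K j)))))" for i j
    by (intro C1_bounded_cmult C1_bounded_add C1_sin_phase_pair)
  have eq: "(1 / (2 * pi * d)) *\<^sub>R (c *\<^sub>R ((2 * pi) *\<^sub>R k)) = (c / d) *\<^sub>R k" for c d and k :: "real ^ 'n"
    by simp
  show ?thesis
    by (rule C1_bounded_cong[OF C1_bounded_sum[OF finJ C1_bounded_sum[OF finJ 1]]])
       (simp_all add: w2_def Dw2_def eq)
qed

lemma cos_phase_integer:
  assumes "j \<in> J" "\<forall>i. z $ i \<in> \<int>"
  shows "cos (phase j (x + z)) = cos (phase j x)" "sin (phase j (x + z)) = sin (phase j x)"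
  using int_periodic_trig[of "K j" "\<theta> j"] Kint[OF assms(1)] assms(2)
  unfolding int_periodic_def phase_def by blast+

lemma pot_periodic: "int_periodic pot"
  unfolding int_periodic_def pot_def by (auto intro!: sum.cong simp: cos_phase_integer)

lemma pot_continuous: "continuous_on UNIV pot"
  unfolding pot_def phase_def by (intro continuous_intros)

lemma w1_periodic: "int_periodic (w1 Q)"
  unfolding int_periodic_def w1_def by (auto intro!: sum.cong simp: cos_phase_integer)

lemma chi_integer: "\<forall>i. z $ i \<in> \<int> \<Longrightarrow> chi Q K0 (x + z) = chi Q K0 x"
  unfolding chi_def by (auto intro!: sum.cong simp: cos_phase_integer)

lemma w2_periodic: "int_periodic (w2 Q)"
  unfolding int_periodic_def w2_def by (auto intro!: sum.cong simp: cos_phase_integer sin_add sin_diff)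

lemma Q_Dw1: "pot x + Q \<bullet> Dw1 Q x = res1 Q x"
proof -
  have "A j * cos (phase j x) + Q \<bullet> ((- cf Q j * cos (phase j x)) *\<^sub>R K j) =
      (if K j \<bullet> Q = 0 then A j * cos (phase j x) else 0)" for j
    by (simp add: cf_def inner_commute)
  then show ?thesis
    unfolding pot_def Dw1_def res1_def inner_sum_right by (simp only: add.assoc flip: sum.distrib)
qed

text \<open>
  The square of \<open>Dw1\<close> is a sum of products of cosines, which split into the modes \<open>K i + K j\<close> and
  \<open>K i - K j\<close>. The diagonal terms \<open>i = j\<close> of the second kind have frequency 0 and form the mean value.
\<close>

lemma Q_Dw2: "Q \<bullet> Dw2 Q x + 1/2 * (norm (Dw1 Q x))^2 = res2 Q x"
proof -
  have "(norm (Dw1 Q x))^2 = (\<Sum>i\<in>J. \<Sum>j\<in>J. cf Q i * cf Q j * (K i \<bullet> K j) * (cos (phase i x) * cos (phase j x)))"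
    unfolding power2_norm_eq_inner Dw1_def inner_sum_left inner_sum_right
    by (subst sum.swap) (auto intro!: sum.cong)
  then have half2: "1/2 * (norm (Dw1 Q x))^2 = (\<Sum>i\<in>J. \<Sum>j\<in>J. cf Q i * cf Q j * (K i \<bullet> K j) / 2 * (cos (phase i x) * cos (phase j x)))"
    by (simp add: sum_distrib_left algebra_simps)
  have QD: "Q \<bullet> Dw2 Q x = (\<Sum>i\<in>J. \<Sum>j\<in>J. - (cf Q i * cf Q j * (K i \<bullet> K j) / 4) *
     (cos (phase i x + phase j x) / ((K i + K j) \<bullet> Q) * ((K i + K j) \<bullet> Q) +
      cos (phase i x - phase j x) / ((K i - K j) \<bullet> Q) * ((K i - K j) \<bullet> Q)))"
  proof -
    have dist: "Q \<bullet> (c *\<^sub>R (d *\<^sub>R u + e *\<^sub>R u')) = c * (d * (u \<bullet> Q) + e * (u' \<bullet> Q))" for c d e u u'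
      by (simp add: inner_add_right inner_commute)
    show ?thesis unfolding Dw2_def inner_sum_right dist ..
  qed
  have pt: "- (cf Q i * cf Q j * (K i \<bullet> K j) / 4) *
     (cos (phase i x + phase j x) / ((K i + K j) \<bullet> Q) * ((K i + K j) \<bullet> Q) +
      cos (phase i x - phase j x) / ((K i - K j) \<bullet> Q) * ((K i - K j) \<bullet> Q)) +
     cf Q i * cf Q j * (K i \<bullet> K j) / 2 * (cos (phase i x) * cos (phase j x)) =
     cf Q i * cf Q j * (K i \<bullet> K j) / 4 *
     ((if (K i + K j) \<bullet> Q = 0 then cos (phase i x + phase j x) else 0) +
      (if (K i - K j) \<bullet> Q = 0 then cos (phase i x - phase j x) else 0))" for i j
  proof -
    have half: "cos (phase i x) * cos (phase j x) = (cos (phase i x + phase j x) + cos (phase i x - phase j x)) / 2"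
      by (simp add: cos_add cos_diff)
    have div: "c / d * d = c - (if d = 0 then c else 0)" for c d :: real by simp
    show ?thesis unfolding half div by (simp add: field_simps)
  qed
  show ?thesis unfolding res2_def half2 QD sum.distrib[symmetric] pt ..
qed

lemma Q_Dchi:
  assumes "\<And>j. j \<in> J \<Longrightarrow> K j \<bullet> Q \<noteq> 0"
  shows "Q \<bullet> Dchi Q K0 x = - (Dw1 Q x \<bullet> K0)"
  unfolding Dchi_def Dw1_def inner_sum_right inner_sum_left sum_negf[symmetric]
  using assms by (auto intro!: sum.cong simp: inner_commute)

lemma res1_nonresonant: "(\<And>j. j \<in> J \<Longrightarrow> K j \<bullet> Q \<noteq> 0) \<Longrightarrow> res1 Q x = a"
  unfolding res1_def by (auto intro!: sum.neutral)

lemma effective_upper_1: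
  assumes "\<And>x. res1 Q x \<le> \<mu>"
  shows "\<exists>B. \<forall>s\<ge>1. effective_Hamiltonian pot (s *\<^sub>R Q) \<le> 1/2 * s^2 * (norm Q)^2 + \<mu> + B / s"
proof -
  obtain B where B: "\<And>x. norm (Dw1 Q x) \<le> B" using C1_bounded_gradient[OF C1_w1] by blast
  have "effective_Hamiltonian pot (s *\<^sub>R Q) \<le> 1/2 * s^2 * (norm Q)^2 + \<mu> + 2 * B^2 / s" if s: "s \<ge> 1" for s
  proof -
    obtain v where v: "cell_solution pot (s *\<^sub>R Q) (effective_Hamiltonian pot (s *\<^sub>R Q)) v"
      by (rule effective_Hamiltonian_cell_solution[OF pot_continuous pot_periodic])
    show ?thesis
    proof (rule cell_constant_le[OF v])
      show "C1_with_gradient (\<lambda>x. 1/s * w1 Q x) (\<lambda>x. (1/s) *\<^sub>R Dw1 Q x)"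
        by (intro C1_boundedD C1_bounded_cmult C1_w1)
      show "int_periodic (\<lambda>x. 1/s * w1 Q x)" using w1_periodic unfolding int_periodic_def by metis
      fix x
      have "norm (0 :: real ^ 'n) \<le> B" using order_trans[OF norm_ge_zero B[of x]] by simp
      from energy_first_order[OF s this B[of x], of Q "pot x"]
      show "1/2 * (norm (s *\<^sub>R Q + (1/s) *\<^sub>R Dw1 Q x))^2 + pot x \<le> 1/2 * s^2 * (norm Q)^2 + \<mu> + 2 * B^2 / s"
        using assms[of x] Q_Dw1[of x Q] by (simp add: abs_le_iff)
    qed
  qed
  then show ?thesis by blast
qed

lemma effective_upper_2:
  assumes Q: "\<And>j. j \<in> J \<Longrightarrow> K j \<bullet> Q \<noteq> 0" and "\<And>x. res2 Q x \<le> \<mu>"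
  shows "\<exists>B. \<forall>s\<ge>1. effective_Hamiltonian pot (s *\<^sub>R Q) \<le> 1/2 * s^2 * (norm Q)^2 + a + \<mu> / s^2 + B / s^4"
proof -
  have r1: "res1 Q x = a" for x using res1_nonresonant Q by blast
  obtain B1 B2 where B12: "\<And>x. norm (Dw1 Q x) \<le> B1" "\<And>x. norm (Dw2 Q x) \<le> B2"
    using C1_bounded_gradient[OF C1_w1] C1_bounded_gradient[OF C1_w2] by metis
  define B where "B = max B1 B2"
  have B: "norm (Dw1 Q x) \<le> B" "norm (Dw2 Q x) \<le> B" for x
    using B12[of x] by (auto simp: B_def)
  have "effective_Hamiltonian pot (s *\<^sub>R Q) \<le> 1/2 * s^2 * (norm Q)^2 + a + \<mu> / s^2 + 2 * B^2 / s^4" if s: "s \<ge> 1" for s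
  proof -
    obtain v where v: "cell_solution pot (s *\<^sub>R Q) (effective_Hamiltonian pot (s *\<^sub>R Q)) v"
      by (rule effective_Hamiltonian_cell_solution[OF pot_continuous pot_periodic])
    show ?thesis
    proof (rule cell_constant_le[OF v])
      show "C1_with_gradient (\<lambda>x. 1/s * w1 Q x + 1/s^3 * w2 Q x) (\<lambda>x. (1/s) *\<^sub>R Dw1 Q x + (1/s^3) *\<^sub>R Dw2 Q x)"
        by (intro C1_boundedD C1_bounded_add C1_bounded_cmult C1_w1 C1_w2)
      show "int_periodic (\<lambda>x. 1/s * w1 Q x + 1/s^3 * w2 Q x)"
        using w1_periodic w2_periodic unfolding int_periodic_def by metis
      fix x
      have "res2 Q x / s^2 \<le> \<mu> / s^2" using assms(2) by (intro divide_right_mono) auto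
      then show "1/2 * (norm (s *\<^sub>R Q + ((1/s) *\<^sub>R Dw1 Q x + (1/s^3) *\<^sub>R Dw2 Q x)))^2 + pot x
          \<le> 1/2 * s^2 * (norm Q)^2 + a + \<mu> / s^2 + 2 * B^2 / s^4"
        using energy_second_order[OF s B(1)[of x] B(2)[of x], of Q "pot x"] unfolding Q_Dw1 Q_Dw2 r1
        by linarith
    qed
  qed
  then show ?thesis by blast
qed

text \<open>
  The gradient of \<open>cos (half K0 s0 x)\<close> vanishes only where \<open>K0 \<bullet> x - s0\<close> is an integer. A
  smooth function of \<open>K0 \<bullet> x\<close> with period 1 has both a maximum and a minimum in each period, hence a further critical point; but
  \<open>cos (half K0 s0 x)\<close> is periodic only up to its sign, which \<open>cell_constant_ge\<close> permits.
\<close>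

definition half :: "real ^ 'n \<Rightarrow> real \<Rightarrow> real ^ 'n \<Rightarrow> real" where "half K0 s0 x = pi * (K0 \<bullet> x - s0)"

lemma C1_sin_half: "C1_bounded (\<lambda>x. sin (half K0 s0 x)) (\<lambda>x. cos (half K0 s0 x) *\<^sub>R (pi *\<^sub>R K0))"
  using C1_bounded_sin[of "pi *\<^sub>R K0" "- pi * s0"] by (simp add: half_def right_diff_distrib)

lemma C1_cos_half: "C1_bounded (\<lambda>x. cos (half K0 s0 x)) (\<lambda>x. (- sin (half K0 s0 x)) *\<^sub>R (pi *\<^sub>R K0))"
  using C1_bounded_cos[of "pi *\<^sub>R K0" "- pi * s0"] by (simp add: half_def right_diff_distrib)

lemma half_integer:
  assumes "\<And>i. K0 $ i \<in> \<int>" "\<forall>i. z $ i \<in> \<int>"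
  obtains \<sigma> :: real where "\<bar>\<sigma>\<bar> = 1" "\<And>x. cos (half K0 s0 (x + z)) = \<sigma> * cos (half K0 s0 x)"
    "\<And>x. sin (half K0 s0 (x + z)) = \<sigma> * sin (half K0 s0 x)"
proof -
  obtain n where n: "K0 \<bullet> z = of_int n" using inner_integer[of K0 z] assms Ints_cases by metis
  have h: "half K0 s0 (x + z) = half K0 s0 x + pi * of_int n" for x
    by (simp add: half_def inner_add_right n algebra_simps)
  have sn: "sin (pi * of_int n) = 0" by (metis mult.commute sin_npi_int)
  have "\<bar>cos (pi * real_of_int n)\<bar> = 1"
    using sn sin_cos_squared_add[of "pi * real_of_int n"] by (simp add: power2_eq_1_iff abs_if split: if_splits)
  then show thesis
    by (rule that) (simp_all add: h sin_add cos_add sn mult.commute)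
qed

text \<open>
  Adding \<open>L / pi * cos (half K0 s0 x)\<close> to the corrector raises the energy away from the points where
  \<open>K0 \<bullet> x - s0\<close> is an integer. With \<open>s0\<close> at a maximum of the resonant part, the lower bound \<open>\<mu>\<close> can therefore be
  brought up to this maximum.
\<close>

lemma effective_lower_1:
  assumes K0: "\<And>i. K0 $ i \<in> \<int>" "K0 \<bullet> Q = 0"
    and \<mu>: "\<And>x. \<mu> \<le> res1 Q x + 1/2 * L^2 * (norm K0)^2 * (sin (half K0 s0 x))^2"
  shows "\<exists>B. \<forall>s\<ge>1. 1/2 * s^2 * (norm Q)^2 + \<mu> - B / s \<le> effective_Hamiltonian pot (s *\<^sub>R Q)"
proof -
  define G where "G x = L / pi * cos (half K0 s0 x)" for x
  define DG where "DG x = (- L * sin (half K0 s0 x)) *\<^sub>R K0" for x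
  have C1_G: "C1_bounded G DG"
    using C1_bounded_cmult[OF C1_cos_half, of "L / pi" K0 s0]
    by (rule C1_bounded_cong) (simp_all add: G_def DG_def)
  obtain B1 B2 where B12: "\<And>x. norm (Dw1 Q x) \<le> B1" "\<And>x. norm (DG x) \<le> B2"
    using C1_bounded_gradient[OF C1_w1] C1_bounded_gradient[OF C1_G] by metis
  define B where "B = max B1 B2"
  have B: "norm (Dw1 Q x) \<le> B" "norm (DG x) \<le> B" "norm (- DG x) \<le> B" for x
    using B12[of x] by (auto simp: B_def)
  have QG: "Q \<bullet> DG x = 0" "Q \<bullet> (- DG x) = 0" for x using K0(2) by (simp_all add: DG_def inner_commute)
  have nG: "(norm (DG x))^2 = L^2 * (norm K0)^2 * (sin (half K0 s0 x))^2" for x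
    by (simp add: DG_def power_mult_distrib abs_mult)
  have "1/2 * s^2 * (norm Q)^2 + \<mu> - 2 * B^2 / s \<le> effective_Hamiltonian pot (s *\<^sub>R Q)" if s: "s \<ge> 1" for s
  proof -
    obtain v where v: "cell_solution pot (s *\<^sub>R Q) (effective_Hamiltonian pot (s *\<^sub>R Q)) v"
      by (rule effective_Hamiltonian_cell_solution[OF pot_continuous pot_periodic])
    show ?thesis
    proof (rule cell_constant_ge[OF v])
      show "C1_with_gradient (\<lambda>x. 1/s * w1 Q x) (\<lambda>x. (1/s) *\<^sub>R Dw1 Q x)"
        by (intro C1_boundedD C1_bounded_cmult C1_w1)
      show "int_periodic (\<lambda>x. 1/s * w1 Q x)" using w1_periodic unfolding int_periodic_def by metis
      show "C1_with_gradient G DG" using C1_G by (rule C1_boundedD)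
      show "int_periodic (\<lambda>x. \<bar>G x\<bar>)"
        unfolding int_periodic_def
      proof (intro allI impI)
        fix x z :: "real ^ 'n" assume "\<forall>i. z $ i \<in> \<int>"
        then obtain \<sigma> :: real where "\<bar>\<sigma>\<bar> = 1" "\<And>x. cos (half K0 s0 (x + z)) = \<sigma> * cos (half K0 s0 x)"
          using half_integer[OF K0(1)] by metis
        then show "\<bar>G (x + z)\<bar> = \<bar>G x\<bar>" by (simp add: G_def abs_mult)
      qed
      fix x
      show "1/2 * s^2 * (norm Q)^2 + \<mu> - 2 * B^2 / s \<le> 1/2 * (norm (s *\<^sub>R Q + ((1/s) *\<^sub>R Dw1 Q x + DG x)))^2 + pot x"
        using energy_first_order[OF s B(2)[of x] B(1)[of x] QG(1), of "pot x"] \<mu>[of x] unfolding Q_Dw1 nG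
        by (simp add: abs_le_iff add.commute)
      show "1/2 * s^2 * (norm Q)^2 + \<mu> - 2 * B^2 / s \<le> 1/2 * (norm (s *\<^sub>R Q + ((1/s) *\<^sub>R Dw1 Q x - DG x)))^2 + pot x"
        using energy_first_order[OF s B(3)[of x] B(1)[of x] QG(2), of "pot x"] \<mu>[of x] unfolding Q_Dw1 norm_minus_cancel nG
        by (simp add: abs_le_iff)
    qed
  qed
  then show ?thesis by blast
qed

text \<open>
  The same device one order further, where \<open>cos (half K0 s0 x)\<close> enters with the factor \<open>1 / s\<close> and its interaction with
  \<open>w1\<close> has to be removed by \<open>chi\<close>.
\<close>

lemma effective_lower_2:
  assumes Q: "\<And>j. j \<in> J \<Longrightarrow> K j \<bullet> Q \<noteq> 0" and K0: "\<And>i. K0 $ i \<in> \<int>" "K0 \<bullet> Q = 0"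
    and \<mu>: "\<And>x. \<mu> \<le> res2 Q x + 1/2 * L^2 * (norm K0)^2 * (sin (half K0 s0 x))^2"
  shows "\<exists>B. \<forall>s\<ge>1. 1/2 * s^2 * (norm Q)^2 + a + \<mu> / s^2 - B / s^4 \<le> effective_Hamiltonian pot (s *\<^sub>R Q)"
proof -
  define G1 where "G1 x = L / pi * cos (half K0 s0 x)" for x
  define DG1 where "DG1 x = (- L * sin (half K0 s0 x)) *\<^sub>R K0" for x
  define G2 where "G2 x = - L * (chi Q K0 x * sin (half K0 s0 x))" for x
  define DG2 where "DG2 x = (- L) *\<^sub>R (chi Q K0 x *\<^sub>R (cos (half K0 s0 x) *\<^sub>R (pi *\<^sub>R K0)) + sin (half K0 s0 x) *\<^sub>R Dchi Q K0 x)" for x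
  have C1_G1: "C1_bounded G1 DG1"
    using C1_bounded_cmult[OF C1_cos_half, of "L / pi" K0 s0]
    by (rule C1_bounded_cong) (simp_all add: G1_def DG1_def)
  have C1_G2: "C1_bounded G2 DG2"
    unfolding G2_def DG2_def by (intro C1_bounded_cmult C1_bounded_mult C1_chi C1_sin_half)
  have r1: "res1 Q x = a" for x using res1_nonresonant Q by blast
  obtain B1 B2 B3 B4 where B14: "\<And>x. norm (Dw1 Q x) \<le> B1" "\<And>x. norm (Dw2 Q x) \<le> B2" "\<And>x. norm (DG1 x) \<le> B3" "\<And>x. norm (DG2 x) \<le> B4"
    using C1_bounded_gradient[OF C1_w1] C1_bounded_gradient[OF C1_w2] C1_bounded_gradient[OF C1_G1] C1_bounded_gradient[OF C1_G2] by metis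
  define B where "B = max (B1 + B3) (B2 + B4)"
  have B: "norm (Dw1 Q x + DG1 x) \<le> B" "norm (Dw2 Q x + DG2 x) \<le> B"
      "norm (Dw1 Q x - DG1 x) \<le> B" "norm (Dw2 Q x - DG2 x) \<le> B" for x
    using norm_triangle_mono[OF B14(1,3), of x x] norm_triangle_mono[OF B14(2,4), of x x]
      norm_triangle_ineq4[of "Dw1 Q x" "DG1 x"] norm_triangle_ineq4[of "Dw2 Q x" "DG2 x"] B14[of x]
    unfolding B_def by linarith+
  have QG1: "Q \<bullet> DG1 x = 0" for x using K0(2) by (simp add: DG1_def inner_commute)
  have QG2: "Q \<bullet> DG2 x = - (Dw1 Q x \<bullet> DG1 x)" for x
    using K0(2) Q_Dchi[OF Q, of K0 x] by (simp add: DG1_def DG2_def inner_add_right inner_commute[of Q K0])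
  have nG: "(norm (DG1 x))^2 = L^2 * (norm K0)^2 * (sin (half K0 s0 x))^2" for x
    by (simp add: DG1_def power_mult_distrib abs_mult)
  have plus: "Q \<bullet> (Dw1 Q x + DG1 x) = Q \<bullet> Dw1 Q x"
      "Q \<bullet> (Dw2 Q x + DG2 x) + 1/2 * (norm (Dw1 Q x + DG1 x))^2 = res2 Q x + 1/2 * (norm (DG1 x))^2" for x
    using QG1[of x] QG2[of x] Q_Dw2[of Q x] unfolding power2_norm_eq_inner
    by (simp_all add: inner_add_left inner_add_right inner_commute add_divide_distrib)
  have minus: "Q \<bullet> (Dw1 Q x - DG1 x) = Q \<bullet> Dw1 Q x"
      "Q \<bullet> (Dw2 Q x - DG2 x) + 1/2 * (norm (Dw1 Q x - DG1 x))^2 = res2 Q x + 1/2 * (norm (DG1 x))^2" for x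
    using QG1[of x] QG2[of x] Q_Dw2[of Q x] unfolding power2_norm_eq_inner
    by (simp_all add: inner_diff_left inner_diff_right inner_commute add_divide_distrib diff_divide_distrib)
  have "1/2 * s^2 * (norm Q)^2 + a + \<mu> / s^2 - 2 * B^2 / s^4 \<le> effective_Hamiltonian pot (s *\<^sub>R Q)" if s: "s \<ge> 1" for s
  proof -
    obtain v where v: "cell_solution pot (s *\<^sub>R Q) (effective_Hamiltonian pot (s *\<^sub>R Q)) v"
      by (rule effective_Hamiltonian_cell_solution[OF pot_continuous pot_periodic])
    show ?thesis
    proof (rule cell_constant_ge[OF v])
      show "C1_with_gradient (\<lambda>x. 1/s * w1 Q x + 1/s^3 * w2 Q x) (\<lambda>x. (1/s) *\<^sub>R Dw1 Q x + (1/s^3) *\<^sub>R Dw2 Q x)"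
        by (intro C1_boundedD C1_bounded_add C1_bounded_cmult C1_w1 C1_w2)
      show "int_periodic (\<lambda>x. 1/s * w1 Q x + 1/s^3 * w2 Q x)"
        using w1_periodic w2_periodic unfolding int_periodic_def by metis
      show "C1_with_gradient (\<lambda>x. 1/s * G1 x + 1/s^3 * G2 x) (\<lambda>x. (1/s) *\<^sub>R DG1 x + (1/s^3) *\<^sub>R DG2 x)"
        by (intro C1_boundedD C1_bounded_add C1_bounded_cmult C1_G1 C1_G2)
      show "int_periodic (\<lambda>x. \<bar>1/s * G1 x + 1/s^3 * G2 x\<bar>)"
        unfolding int_periodic_def
      proof (intro allI impI)
        fix x z :: "real ^ 'n" assume z: "\<forall>i. z $ i \<in> \<int>"
        then obtain \<sigma> :: real where \<sigma>: "\<bar>\<sigma>\<bar> = 1" "\<And>x. cos (half K0 s0 (x + z)) = \<sigma> * cos (half K0 s0 x)"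
            "\<And>x. sin (half K0 s0 (x + z)) = \<sigma> * sin (half K0 s0 x)"
          using half_integer[OF K0(1)] by metis
        have "1/s * G1 (x + z) + 1/s^3 * G2 (x + z) = \<sigma> * (1/s * G1 x + 1/s^3 * G2 x)"
          unfolding G1_def G2_def \<sigma>(2,3) chi_integer[OF z] by (simp add: algebra_simps)
        then show "\<bar>1/s * G1 (x + z) + 1/s^3 * G2 (x + z)\<bar> = \<bar>1/s * G1 x + 1/s^3 * G2 x\<bar>"
          using \<sigma>(1) by (simp add: abs_mult)
      qed
      fix x
      have \<mu>': "\<mu> / s^2 \<le> (res2 Q x + 1/2 * (norm (DG1 x))^2) / s^2"
        using \<mu>[of x] unfolding nG by (intro divide_right_mono) auto
      have e1: "(1/s) *\<^sub>R Dw1 Q x + (1/s^3) *\<^sub>R Dw2 Q x + ((1/s) *\<^sub>R DG1 x + (1/s^3) *\<^sub>R DG2 x) =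
          (1/s) *\<^sub>R (Dw1 Q x + DG1 x) + (1/s^3) *\<^sub>R (Dw2 Q x + DG2 x)"
        by (simp add: scaleR_add_right)
      show "1/2 * s^2 * (norm Q)^2 + a + \<mu> / s^2 - 2 * B^2 / s^4 \<le>
          1/2 * (norm (s *\<^sub>R Q + ((1/s) *\<^sub>R Dw1 Q x + (1/s^3) *\<^sub>R Dw2 Q x + ((1/s) *\<^sub>R DG1 x + (1/s^3) *\<^sub>R DG2 x))))^2 + pot x"
        using energy_second_order[OF s B(1)[of x] B(2)[of x], of Q "pot x"] \<mu>' unfolding e1 plus Q_Dw1 r1
        by linarith
      have e2: "(1/s) *\<^sub>R Dw1 Q x + (1/s^3) *\<^sub>R Dw2 Q x - ((1/s) *\<^sub>R DG1 x + (1/s^3) *\<^sub>R DG2 x) =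
          (1/s) *\<^sub>R (Dw1 Q x - DG1 x) + (1/s^3) *\<^sub>R (Dw2 Q x - DG2 x)"
        by (simp add: scaleR_diff_right)
      show "1/2 * s^2 * (norm Q)^2 + a + \<mu> / s^2 - 2 * B^2 / s^4 \<le>
          1/2 * (norm (s *\<^sub>R Q + ((1/s) *\<^sub>R Dw1 Q x + (1/s^3) *\<^sub>R Dw2 Q x - ((1/s) *\<^sub>R DG1 x + (1/s^3) *\<^sub>R DG2 x))))^2 + pot x"
        using energy_second_order[OF s B(3)[of x] B(4)[of x], of Q "pot x"] \<mu>' unfolding e2 minus Q_Dw1 r1
        by linarith
    qed
  qed
  then show ?thesis by blast
qed

end

abbreviation trig_Hbar where
  "trig_Hbar J a A \<theta> K \<equiv> effective_Hamiltonian (trig_potential.pot J a A \<theta> K)"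

section \<open>Resonances between two modes\<close>

lemma cos_has_integral_period:
  fixes n :: int
  assumes "b = 0 \<or> n \<noteq> 0"
  shows "((\<lambda>t. b * cos (2 * pi * of_int n * t + \<gamma>)) has_integral 0) {0..1}"
proof (cases "b = 0")
  case False
  then have n: "real_of_int n \<noteq> 0" using assms by simp
  have "((\<lambda>t. b * cos (2 * pi * of_int n * t + \<gamma>)) has_integral
      (b * sin (2 * pi * of_int n * 1 + \<gamma>) / (2 * pi * of_int n) - b * sin (2 * pi * of_int n * 0 + \<gamma>) / (2 * pi * of_int n))) {0..1}"
    using n by (intro fundamental_theorem_of_calculus)
      (auto intro!: derivative_eq_intros simp: has_real_derivative_iff_has_vector_derivative[symmetric])
  moreover have "sin (2 * pi * of_int n * 1 + \<gamma>) = sin \<gamma>"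
    using trig_shift_integer(1)[of "of_int n" \<gamma>] by (simp add: add.commute)
  ultimately show ?thesis by simp
qed simp

text \<open>
  Testing against the nonnegative weight \<open>1 + \<sigma> cos (2 pi n0 s + \<gamma>0)\<close> with \<open>\<sigma> = sgn b0\<close> leaves only
  \<open>\<bar>b0\<bar> / 2\<close> after integration over a period, which a nonpositive function cannot produce.
\<close>

lemma trig_sum_positive_somewhere:
  fixes n0 n1 n2 :: int
  assumes b0: "b0 \<noteq> 0" "n0 \<noteq> 0"
    and b1: "b1 = 0 \<or> n1 \<noteq> 0 \<and> n1 \<noteq> n0 \<and> n1 \<noteq> - n0"
    and b2: "b2 = 0 \<or> n2 \<noteq> 0 \<and> n2 \<noteq> n0 \<and> n2 \<noteq> - n0"
  shows "\<exists>s. 0 < b0 * cos (2 * pi * of_int n0 * s + \<gamma>0) + b1 * cos (2 * pi * of_int n1 * s + \<gamma>1)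
    + b2 * cos (2 * pi * of_int n2 * s + \<gamma>2)"
proof (rule ccontr)
  define \<rho> where "\<rho> s = b0 * cos (2 * pi * of_int n0 * s + \<gamma>0) + b1 * cos (2 * pi * of_int n1 * s + \<gamma>1)
    + b2 * cos (2 * pi * of_int n2 * s + \<gamma>2)" for s
  assume "\<not> ?thesis"
  then have neg: "\<rho> s \<le> 0" for s unfolding \<rho>_def by (simp add: not_less)
  define \<sigma> where "\<sigma> = sgn b0"
  have \<sigma>: "\<bar>\<sigma>\<bar> = 1" "\<sigma> * b0 = \<bar>b0\<bar>" using b0 by (auto simp: \<sigma>_def abs_sgn_eq sgn_if)
  define f where "f t = \<rho> t * (1 + \<sigma> * cos (2 * pi * of_int n0 * t + \<gamma>0))" for t
  have fneg: "f t \<le> 0" for t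
  proof -
    have "\<bar>\<sigma> * cos (2 * pi * of_int n0 * t + \<gamma>0)\<bar> \<le> 1" using \<sigma>(1) by (simp add: abs_mult)
    then have "0 \<le> 1 + \<sigma> * cos (2 * pi * of_int n0 * t + \<gamma>0)" by linarith
    then show ?thesis unfolding f_def using neg[of t] by (simp add: mult_nonpos_nonneg)
  qed
  let ?c = "\<lambda>b n \<gamma> t. b * cos (2 * pi * of_int n * t + \<gamma>)"
  have prod: "cos (2 * pi * of_int n * t + \<gamma>) * cos (2 * pi * of_int n' * t + \<gamma>') =
      (cos (2 * pi * of_int (n + n') * t + (\<gamma> + \<gamma>')) + cos (2 * pi * of_int (n - n') * t + (\<gamma> - \<gamma>'))) / 2"
    for n n' :: int and \<gamma> \<gamma>' t
  proof -
    have "2 * pi * of_int (n + n') * t + (\<gamma> + \<gamma>') = (2 * pi * of_int n * t + \<gamma>) + (2 * pi * of_int n' * t + \<gamma>')"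
      "2 * pi * of_int (n - n') * t + (\<gamma> - \<gamma>') = (2 * pi * of_int n * t + \<gamma>) - (2 * pi * of_int n' * t + \<gamma>')"
      by (simp_all add: algebra_simps)
    then show ?thesis by (simp only: cos_add cos_diff) simp
  qed
  have f_eq: "f t = \<bar>b0\<bar> / 2 + (?c b0 n0 \<gamma>0 t + ?c b1 n1 \<gamma>1 t + ?c b2 n2 \<gamma>2 t
      + ?c (\<sigma> * b0 / 2) (n0 + n0) (\<gamma>0 + \<gamma>0) t
      + ?c (\<sigma> * b1 / 2) (n1 + n0) (\<gamma>1 + \<gamma>0) t + ?c (\<sigma> * b1 / 2) (n1 - n0) (\<gamma>1 - \<gamma>0) t
      + ?c (\<sigma> * b2 / 2) (n2 + n0) (\<gamma>2 + \<gamma>0) t + ?c (\<sigma> * b2 / 2) (n2 - n0) (\<gamma>2 - \<gamma>0) t)" for t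
  proof -
    have "f t = \<rho> t + \<sigma> * b0 * (cos (2 * pi * of_int n0 * t + \<gamma>0) * cos (2 * pi * of_int n0 * t + \<gamma>0))
      + \<sigma> * b1 * (cos (2 * pi * of_int n1 * t + \<gamma>1) * cos (2 * pi * of_int n0 * t + \<gamma>0))
      + \<sigma> * b2 * (cos (2 * pi * of_int n2 * t + \<gamma>2) * cos (2 * pi * of_int n0 * t + \<gamma>0))"
      unfolding f_def \<rho>_def by (simp add: algebra_simps)
    also have "\<dots> = \<rho> t + \<bar>b0\<bar> / 2 + \<sigma> * b0 / 2 * cos (2 * pi * of_int (n0 + n0) * t + (\<gamma>0 + \<gamma>0))
      + \<sigma> * b1 / 2 * (cos (2 * pi * of_int (n1 + n0) * t + (\<gamma>1 + \<gamma>0)) + cos (2 * pi * of_int (n1 - n0) * t + (\<gamma>1 - \<gamma>0)))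
      + \<sigma> * b2 / 2 * (cos (2 * pi * of_int (n2 + n0) * t + (\<gamma>2 + \<gamma>0)) + cos (2 * pi * of_int (n2 - n0) * t + (\<gamma>2 - \<gamma>0)))"
      unfolding prod \<sigma>(2) by (simp add: add_divide_distrib distrib_left)
    finally show ?thesis unfolding \<rho>_def by (simp add: algebra_simps)
  qed
  have "(f has_integral (\<bar>b0\<bar> / 2 + (0 + 0 + 0 + 0 + 0 + 0 + 0 + 0))) {0..1}"
    unfolding f_eq[abs_def]
  proof (intro has_integral_add cos_has_integral_period)
    show "((\<lambda>t. \<bar>b0\<bar> / 2) has_integral \<bar>b0\<bar> / 2) {0..1 :: real}"
      using has_integral_const_real[of "\<bar>b0\<bar> / 2" 0 1] by simp
  qed (use assms in auto)
  then have "\<bar>b0\<bar> / 2 + (0 + 0 + 0 + 0 + 0 + 0 + 0 + 0) \<le> 0"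
    by (rule has_integral_le[OF _ has_integral_0]) (rule fneg)
  then show False using b0 by simp
qed

text \<open>
  Near \<open>s0\<close> the function \<open>\<rho>\<close> itself exceeds \<open>\<delta>\<close>; away from the integer translates of \<open>s0\<close> the sine is bounded
  away from 0 and a large amplitude compensates for \<open>\<rho>\<close>.
\<close>

lemma kinetic_amplitude_exists:
  fixes \<rho> :: "real \<Rightarrow> real"
  assumes cont: "continuous_on UNIV \<rho>" and per: "\<And>s n. \<rho> (s + of_int n) = \<rho> s"
    and \<delta>: "\<delta> < \<rho> s0" and b: "b > 0"
  obtains L where "\<And>s. \<delta> \<le> \<rho> s + L^2 * b * (sin (pi * (s - s0)))^2"
proof -
  have "isCont \<rho> s0" using cont by (simp add: continuous_on_eq_continuous_at)
  moreover have "\<rho> s0 - \<delta> > 0" using \<delta> by simp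
  ultimately obtain d where d: "d > 0" "\<And>s. \<bar>s - s0\<bar> < d \<Longrightarrow> \<bar>\<rho> s - \<rho> s0\<bar> < \<rho> s0 - \<delta>"
    unfolding continuous_at_eps_delta dist_real_def by blast
  let ?K = "{s0 - 1/2..s0 + 1/2} - {s0 - d<..<s0 + d}"
  have K: "compact ?K" by (intro compact_diff) auto
  obtain M where M: "\<And>s. s \<in> {s0 - 1/2..s0 + 1/2} \<Longrightarrow> - M \<le> \<rho> s" "M \<ge> \<bar>\<delta>\<bar>"
  proof -
    have "compact (\<rho> ` {s0 - 1/2..s0 + 1/2})"
      using cont by (intro compact_continuous_image continuous_on_subset[OF cont]) auto
    then have "bounded (\<rho> ` {s0 - 1/2..s0 + 1/2})" by (rule compact_imp_bounded)
    then obtain M where "\<And>s. s \<in> {s0 - 1/2..s0 + 1/2} \<Longrightarrow> \<bar>\<rho> s\<bar> \<le> M"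
      unfolding bounded_iff real_norm_def by blast
    then have "- (M + \<bar>\<delta>\<bar> + \<bar>M\<bar>) \<le> \<rho> s" if "s \<in> {s0 - 1/2..s0 + 1/2}" for s
      using that by (smt (verit))
    moreover have "M + \<bar>\<delta>\<bar> + \<bar>M\<bar> \<ge> \<bar>\<delta>\<bar>" using abs_ge_minus_self[of M] by linarith
    ultimately show thesis by (rule that)
  qed
  define D where "D = min d (1/2)"
  define c where "c = (sin (pi * D))^2"
  have D: "0 < D" "D \<le> 1/2" "D \<le> d" using d by (auto simp: D_def)
  have "0 < sin (pi * D)"
  proof (rule sin_gt_zero)
    show "0 < pi * D" using D by simp
    have "pi * D \<le> pi * (1/2)" using D by (intro mult_left_mono) auto
    also have "\<dots> < pi" using pi_gt_zero by linarith
    finally show "pi * D < pi" .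
  qed
  then have c: "c > 0" by (simp add: c_def)
  define L where "L = sqrt ((M + \<bar>\<delta>\<bar>) / (b * c))"
  have L: "L^2 = (M + \<bar>\<delta>\<bar>) / (b * c)" unfolding L_def using b c M(2) by simp
  have near: "\<delta> \<le> \<rho> s + L^2 * b * (sin (pi * (s - s0)))^2" if s: "\<bar>s - s0\<bar> \<le> 1/2" for s
  proof (cases "\<bar>s - s0\<bar> < D")
    case True
    then have "\<delta> < \<rho> s" using d(2)[of s] D by linarith
    moreover have "0 \<le> L^2 * b * (sin (pi * (s - s0)))^2" using b by simp
    ultimately show ?thesis by linarith
  next
    case False
    have "sin (pi * D) \<le> sin (pi * \<bar>s - s0\<bar>)"
    proof (rule sin_monotone_2pi_le)
      have "0 \<le> pi * D" using D by simp
      then show "- (pi / 2) \<le> pi * D" using pi_gt_zero by linarith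
      show "pi * D \<le> pi * \<bar>s - s0\<bar>" using False by (intro mult_left_mono) auto
      show "pi * \<bar>s - s0\<bar> \<le> pi / 2" using mult_left_mono[OF s, of pi] by simp
    qed
    then have "c \<le> (sin (pi * \<bar>s - s0\<bar>))^2"
      unfolding c_def using \<open>0 < sin (pi * D)\<close> by (intro power_mono) auto
    also have "(sin (pi * \<bar>s - s0\<bar>))^2 = (sin (pi * (s - s0)))^2"
    proof (cases "s - s0 \<ge> 0")
      case False
      then have "pi * \<bar>s - s0\<bar> = - (pi * (s - s0))" by (simp add: algebra_simps)
      then show ?thesis by (simp only: sin_minus power2_minus)
    qed simp
    finally have "L^2 * b * c \<le> L^2 * b * (sin (pi * (s - s0)))^2"
      using b by (intro mult_left_mono) auto
    moreover have "L^2 * b * c = M + \<bar>\<delta>\<bar>" unfolding L using b c by simp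
    moreover have "- M \<le> \<rho> s" using s by (intro M(1)) (unfold atLeastAtMost_iff, linarith)
    ultimately show ?thesis by linarith
  qed
  have "\<delta> \<le> \<rho> s + L^2 * b * (sin (pi * (s - s0)))^2" for s
  proof -
    define n where "n = round (s - s0)"
    have "\<bar>s - of_int n - s0\<bar> \<le> 1/2"
      using of_int_round_abs_le[of "s - s0"] by (simp add: n_def abs_minus_commute algebra_simps)
    from near[OF this] have "\<delta> \<le> \<rho> (s - of_int n) + L^2 * b * (sin (pi * (s - s0) - pi * of_int n))^2"
      by (simp add: algebra_simps)
    moreover have "\<rho> (s - of_int n) = \<rho> s" using per[of "s - of_int n" n] by simp
    moreover have "(sin (pi * (s - s0) - pi * of_int n))^2 = (sin (pi * (s - s0)))^2"
    proof -
      have sn: "sin (pi * of_int n) = 0" by (metis mult.commute sin_npi_int)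
      then have "(cos (pi * real_of_int n))^2 = 1" using sin_cos_squared_add[of "pi * real_of_int n"] by simp
      then show ?thesis by (simp add: sin_diff sn power_mult_distrib)
    qed
    ultimately show ?thesis by simp
  qed
  then show thesis by (rule that)
qed

definition det2 :: "real ^ 2 \<Rightarrow> real ^ 2 \<Rightarrow> real" where
  "det2 u w = u $ 1 * w $ 2 - u $ 2 * w $ 1"

lemma inner_vec2: "(u :: real ^ 2) \<bullet> w = u $ 1 * w $ 1 + u $ 2 * w $ 2"
  by (simp add: inner_vec_def sum_2)

lemma vec2_eq_iff: "(u :: real ^ 2) = w \<longleftrightarrow> u $ 1 = w $ 1 \<and> u $ 2 = w $ 2"
  by (simp add: vec_eq_iff forall_2)

lemma det2_zero_imp_parallel:
  assumes "det2 u w = 0" shows "parallel u w"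
proof -
  consider "w $ 1 \<noteq> 0 \<or> u $ 1 \<noteq> 0" | "w $ 2 \<noteq> 0 \<or> u $ 2 \<noteq> 0" | "u = 0" "w = 0"
    by (auto simp: vec2_eq_iff)
  then show ?thesis
  proof cases
    case 1
    then show ?thesis unfolding parallel_def using assms
      by (intro exI[of _ "w $ 1"] exI[of _ "- (u $ 1)"]) (auto simp: vec2_eq_iff det2_def)
  next
    case 2
    then show ?thesis unfolding parallel_def using assms
      by (intro exI[of _ "w $ 2"] exI[of _ "- (u $ 2)"]) (auto simp: vec2_eq_iff det2_def algebra_simps)
  next
    case 3
    then show ?thesis unfolding parallel_def by (intro exI[of _ 1]) auto
  qed
qed

lemma orthogonal_imp_det2_zero:
  assumes "u \<bullet> Q = 0" "w \<bullet> Q = 0" "Q \<noteq> 0"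
  shows "det2 u w = 0"
proof -
  have "det2 u w * Q $ 1 = 0" "det2 u w * Q $ 2 = 0"
    using assms(1,2) unfolding det2_def inner_vec2 by algebra+
  then show ?thesis using assms(3) by (auto simp: vec2_eq_iff)
qed

lemma det2_zero_imp_scale:
  assumes "det2 u w = 0" "u \<noteq> 0"
  obtains r where "w = r *\<^sub>R u"
proof -
  have nz: "u \<bullet> u \<noteq> 0" using assms by simp
  have "w = ((w \<bullet> u) / (u \<bullet> u)) *\<^sub>R u"
  proof -
    have "(u \<bullet> u) * w $ 1 = (w \<bullet> u) * u $ 1" "(u \<bullet> u) * w $ 2 = (w \<bullet> u) * u $ 2"
      using assms(1) unfolding det2_def inner_vec2 by algebra+
    then show ?thesis using nz by (simp add: vec2_eq_iff field_simps)
  qed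
  then show thesis by (rule that)
qed

definition rot2 :: "real ^ 2 \<Rightarrow> real ^ 2" where
  "rot2 u = vector [- (u $ 2), u $ 1]"

lemma inner_rot2: "w \<bullet> rot2 u = det2 u w"
  by (simp add: inner_vec2 rot2_def det2_def)

lemma rot2_nonzero: "u \<noteq> 0 \<Longrightarrow> rot2 u \<noteq> 0"
  by (auto simp: vec2_eq_iff rot2_def)

text \<open>
  All integer vectors on a line through 0 are multiples of one of them. With this vector as \<open>K0\<close>, every resonant mode is a function
  of \<open>K0 \<bullet> x\<close> of period 1, as is \<open>(sin (half K0 s0 x))^2\<close>.
\<close>

lemma primitive_vector:
  fixes u :: "real ^ 2"
  assumes u: "\<And>i. u $ i \<in> \<int>" "u \<noteq> 0"
  obtains K0 where "\<And>i. K0 $ i \<in> \<int>" "K0 \<noteq> 0"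
    "\<And>w. (\<And>i. w $ i \<in> \<int>) \<Longrightarrow> det2 u w = 0 \<Longrightarrow> \<exists>n::int. w = of_int n *\<^sub>R K0"
proof -
  obtain u1 u2 :: int where u12: "u $ 1 = of_int u1" "u $ 2 = of_int u2" using u(1) by (metis Ints_cases)
  define g where "g = gcd u1 u2"
  have g: "g \<noteq> 0" using u(2) u12 by (auto simp: g_def vec2_eq_iff)
  obtain a b where ab: "u1 = a * g" "u2 = b * g" "coprime a b"
    using gcd_coprime_exists[of u1 u2] g unfolding g_def by blast
  obtain x y where xy: "x * a + y * b = 1"
    using bezout_int[of a b] ab(3) by (auto simp: coprime_iff_gcd_eq_1)
  let ?K = "vector [of_int a, of_int b] :: real ^ 2"
  show thesis
  proof (rule that[of ?K])
    show "?K $ i \<in> \<int>" for i using exhaust_2[of i] by auto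
    show "?K \<noteq> 0" using xy by (auto simp: vec2_eq_iff)
    fix w :: "real ^ 2" assume w: "\<And>i. w $ i \<in> \<int>" "det2 u w = 0"
    obtain w1 w2 :: int where w12: "w $ 1 = of_int w1" "w $ 2 = of_int w2" using w(1) by (metis Ints_cases)
    have "real_of_int (u1 * w2 - u2 * w1) = 0" using w(2) by (simp add: det2_def u12 w12)
    then have "u1 * w2 = u2 * w1" by linarith
    then have e: "a * w2 = b * w1" using g ab by simp
    have "w1 = (x * w1 + y * w2) * a" "w2 = (x * w1 + y * w2) * b" using e xy by algebra+
    then have "w = of_int (x * w1 + y * w2) *\<^sub>R ?K"
      by (simp add: vec2_eq_iff w12 flip: of_int_mult of_int_add)
    then show "\<exists>n::int. w = of_int n *\<^sub>R ?K" by blast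
  qed
qed

lemma relation_imp_antisymmetric:
  fixes m :: "nat \<Rightarrow> real" and K :: "nat \<Rightarrow> real ^ 2"
  assumes "m i *\<^sub>R K i + m j *\<^sub>R K j + m l *\<^sub>R K l = 0" "K i \<bullet> Q = q" "K j \<bullet> Q = q" "m l > 0"
  shows "K l \<bullet> Q = - ((m i + m j) * q / m l)"
proof -
  have "(m i *\<^sub>R K i + m j *\<^sub>R K j + m l *\<^sub>R K l) \<bullet> Q = 0" using assms(1) by simp
  then have "m l * (K l \<bullet> Q) = - ((m i + m j) * q)"
    unfolding inner_add_left inner_scaleR_left assms(2,3) by (simp add: algebra_simps)
  then show ?thesis using assms(4) by (simp add: field_simps)
qed

text \<open>
  The relation with positive coefficients fixes the signs of the frequencies. It implies that \<open>K l \<bullet> Q\<close>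
  has the sign opposite to \<open>q\<close>, so besides \<open>K i - K j\<close> only \<open>K i + K l\<close> and \<open>K j + K l\<close> can be
  resonant, and then both are multiples of \<open>K i - K j\<close> by factors of modulus less than 1. Therefore they cannot cancel the mode
  \<open>K i - K j\<close>, and the resonant part is positive somewhere.
\<close>

lemma resonant_lower:
  fixes K :: "nat \<Rightarrow> real ^ 2"
  assumes tp: "trig_potential {i, j, l} K" and dist: "i \<noteq> j" "i \<noteq> l" "j \<noteq> l"
    and A: "A i \<noteq> 0" "A j \<noteq> 0"
    and m: "m i > 0" "m j > 0" "m l > 0" "m i *\<^sub>R K i + m j *\<^sub>R K j + m l *\<^sub>R K l = 0"
    and Q: "K i \<bullet> Q = q" "K j \<bullet> Q = q" "q \<noteq> 0" and g: "K i \<bullet> K j \<noteq> 0"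
    and ne: "K i \<noteq> K j"
  shows "\<exists>\<delta>>0. \<exists>B. \<forall>s\<ge>1. 1/2 * s^2 * (norm Q)^2 + a
      + ((\<Sum>t\<in>{i, j, l}. (A t / (K t \<bullet> Q))^2 * (norm (K t))^2 / 4) + \<delta>) / s^2 - B / s^4
    \<le> trig_Hbar {i, j, l} a A \<theta> K (s *\<^sub>R Q)"
proof -
  interpret trig_potential "{i, j, l}" a A \<theta> K by (rule tp)
  define a2 where "a2 = (\<Sum>t\<in>{i, j, l}. (A t / (K t \<bullet> Q))^2 * (norm (K t))^2 / 4)"
  have ql: "K l \<bullet> Q = - ((m i + m j) * q / m l)" by (rule relation_imp_antisymmetric[where K=K and m=m, OF m(4) Q(1,2) m(3)])
  define z where "z = (m i + m j) / m l"
  have pos: "z > 0" using m by (simp add: z_def)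
  have ql': "K l \<bullet> Q = - z * q" using ql by (simp add: z_def)
  have ql0: "K l \<bullet> Q \<noteq> 0" unfolding ql' using pos Q(3) by simp
  have qlq: "q \<noteq> K l \<bullet> Q" "K l \<bullet> Q \<noteq> q" 
  proof -
    have "(1 + z) * q \<noteq> 0" using pos Q(3) by simp
    then show "q \<noteq> K l \<bullet> Q" unfolding ql' by (simp add: algebra_simps)
    then show "K l \<bullet> Q \<noteq> q" by simp
  qed
  define \<kappa> where "\<kappa> = K i - K j"
  have \<kappa>int: "\<kappa> $ t \<in> \<int>" for t unfolding \<kappa>_def using Kint by (simp add: Ints_diff)
  have \<kappa>0: "\<kappa> \<noteq> 0" using ne by (simp add: \<kappa>_def)
  have \<kappa>Q: "\<kappa> \<bullet> Q = 0" using Q by (simp add: \<kappa>_def inner_diff_left)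
  obtain K0 where K0: "\<And>i. K0 $ i \<in> \<int>" "K0 \<noteq> 0"
    "\<And>w. (\<And>i. w $ i \<in> \<int>) \<Longrightarrow> det2 \<kappa> w = 0 \<Longrightarrow> \<exists>n::int. w = of_int n *\<^sub>R K0"
    by (rule primitive_vector[OF \<kappa>int \<kappa>0]) blast
  obtain n0 :: int where n0: "K i - K j = of_int n0 *\<^sub>R K0"
    using K0(3)[OF \<kappa>int] unfolding \<kappa>_def by (auto simp: det2_def)
  have n0z: "n0 \<noteq> 0" using ne n0 by auto
  have K0Q: "K0 \<bullet> Q = 0" using \<kappa>Q n0z unfolding \<kappa>_def n0 by simp
  \<comment> \<open>\<open>R\<close> says that the modes \<open>K i + K l\<close> and \<open>K j + K l\<close> are resonant.\<close>
  define R where "R \<longleftrightarrow> q + K l \<bullet> Q = 0"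
  have "\<exists>n1 n2 :: int. R \<longrightarrow> K i + K l = of_int n1 *\<^sub>R K0 \<and> K j + K l = of_int n2 *\<^sub>R K0 \<and>
      n1 \<noteq> 0 \<and> n1 \<noteq> n0 \<and> n1 \<noteq> - n0 \<and> n2 \<noteq> 0 \<and> n2 \<noteq> n0 \<and> n2 \<noteq> - n0"
  proof (cases R)
    case True
    then have "(1 - z) * q = 0" unfolding R_def ql' by (simp add: algebra_simps)
    then have "z = 1" using Q(3) by simp
    then have ml: "m l = m i + m j" using m(3) by (simp add: z_def field_simps)
    \<comment> \<open>\<open>K i + K l\<close> and \<open>K j + K l\<close> are \<open>r\<close> and \<open>r - 1\<close> times \<open>K i - K j\<close>.\<close>
    define r where "r = m j / (m i + m j)"
    have r: "0 < r" "r < 1" using m by (auto simp: r_def)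
    have comp: "m l * (K i $ t + K l $ t) = m j * (K i $ t - K j $ t)" for t
    proof -
      have "(m i *\<^sub>R K i + m j *\<^sub>R K j + m l *\<^sub>R K l) $ t = 0" using m(4) by simp
      then show ?thesis unfolding ml by (simp add: algebra_simps)
    qed
    have "K i + K l = (m j / m l) *\<^sub>R (K i - K j)"
      unfolding vec_eq_iff using comp m(3) by (simp add: field_simps)
    then have 1: "K i + K l = r *\<^sub>R (K i - K j)" unfolding r_def ml .
    have 2: "K j + K l = (r - 1) *\<^sub>R (K i - K j)"
      using 1 by (simp add: algebra_simps)
    have d1: "det2 \<kappa> (K i + K l) = 0" "det2 \<kappa> (K j + K l) = 0"
      unfolding 1 2 \<kappa>_def by (simp_all add: det2_def)
    have "\<And>t. (K i + K l) $ t \<in> \<int>" "\<And>t. (K j + K l) $ t \<in> \<int>" using Kint by (simp_all add: Ints_add)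
    then obtain n1 n2 :: int where n12: "K i + K l = of_int n1 *\<^sub>R K0" "K j + K l = of_int n2 *\<^sub>R K0"
      using K0(3) d1 by metis
    have "of_int n1 *\<^sub>R K0 = (r * of_int n0) *\<^sub>R K0" using 1 n12(1) n0 by simp
    then have e1: "real_of_int n1 = r * of_int n0" using K0(2) by simp
    have "of_int n2 *\<^sub>R K0 = ((r - 1) * of_int n0) *\<^sub>R K0" using 2 n12(2) n0 by simp
    then have e2: "real_of_int n2 = (r - 1) * of_int n0" using K0(2) by simp
    have nz: "real_of_int n0 \<noteq> 0" using n0z by simp
    have "real_of_int n1 \<noteq> 0" "real_of_int n1 \<noteq> real_of_int n0" "real_of_int n1 \<noteq> - real_of_int n0"
      "real_of_int n2 \<noteq> 0" "real_of_int n2 \<noteq> real_of_int n0" "real_of_int n2 \<noteq> - real_of_int n0"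
    proof -
      have "r * real_of_int n0 \<noteq> 0" "(r - 1) * real_of_int n0 \<noteq> 0" "(r + 1) * real_of_int n0 \<noteq> 0" "(r - 2) * real_of_int n0 \<noteq> 0"
        using r nz by auto
      then show "real_of_int n1 \<noteq> 0" "real_of_int n1 \<noteq> real_of_int n0" "real_of_int n1 \<noteq> - real_of_int n0"
        "real_of_int n2 \<noteq> 0" "real_of_int n2 \<noteq> real_of_int n0" "real_of_int n2 \<noteq> - real_of_int n0"
        unfolding e1 e2 by (auto simp: algebra_simps)
    qed
    then have "n1 \<noteq> 0 \<and> n1 \<noteq> n0 \<and> n1 \<noteq> - n0 \<and> n2 \<noteq> 0 \<and> n2 \<noteq> n0 \<and> n2 \<noteq> - n0" by auto
    then show ?thesis using n12 by blast
  qed blast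
  then obtain n1 n2 :: int where n12': "R \<longrightarrow> K i + K l = of_int n1 *\<^sub>R K0 \<and> K j + K l = of_int n2 *\<^sub>R K0 \<and>
      n1 \<noteq> 0 \<and> n1 \<noteq> n0 \<and> n1 \<noteq> - n0 \<and> n2 \<noteq> 0 \<and> n2 \<noteq> n0 \<and> n2 \<noteq> - n0"
    by (elim exE)
  have n12: "R \<Longrightarrow> K i + K l = of_int n1 *\<^sub>R K0" "R \<Longrightarrow> K j + K l = of_int n2 *\<^sub>R K0"
      "R \<Longrightarrow> n1 \<noteq> 0 \<and> n1 \<noteq> n0 \<and> n1 \<noteq> - n0" "R \<Longrightarrow> n2 \<noteq> 0 \<and> n2 \<noteq> n0 \<and> n2 \<noteq> - n0"
    using n12' by simp_all
  define b0 where "b0 = cf Q i * cf Q j * (K i \<bullet> K j) / 2"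
  define b1 where "b1 = (if R then cf Q i * cf Q l * (K i \<bullet> K l) / 2 else 0)"
  define b2 where "b2 = (if R then cf Q j * cf Q l * (K j \<bullet> K l) / 2 else 0)"
  define \<rho> where "\<rho> s = b0 * cos (2 * pi * of_int n0 * s + (\<theta> i - \<theta> j)) + b1 * cos (2 * pi * of_int n1 * s + (\<theta> i + \<theta> l))
    + b2 * cos (2 * pi * of_int n2 * s + (\<theta> j + \<theta> l))" for s
  have b0: "b0 \<noteq> 0" using A g Q by (simp add: b0_def cf_def)
  have "\<exists>s. 0 < \<rho> s" unfolding \<rho>_def
  proof (rule trig_sum_positive_somewhere[OF b0 n0z])
    show "b1 = 0 \<or> n1 \<noteq> 0 \<and> n1 \<noteq> n0 \<and> n1 \<noteq> - n0" using n12(3) by (auto simp: b1_def)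
    show "b2 = 0 \<or> n2 \<noteq> 0 \<and> n2 \<noteq> n0 \<and> n2 \<noteq> - n0" using n12(4) by (auto simp: b2_def)
  qed
  then obtain s0 where s0: "0 < \<rho> s0" by blast
  define \<delta> where "\<delta> = \<rho> s0 / 2"
  have \<delta>: "0 < \<delta>" "\<delta> < \<rho> s0" using s0 by (auto simp: \<delta>_def)
  have res2: "res2 Q x = a2 + \<rho> (K0 \<bullet> x)" for x
  proof -
    have p0: "phase i x - phase j x = 2 * pi * of_int n0 * (K0 \<bullet> x) + (\<theta> i - \<theta> j)"
    proof -
      have "phase i x - phase j x = 2 * pi * ((K i - K j) \<bullet> x) + (\<theta> i - \<theta> j)"
        by (simp add: phase_def inner_diff_left algebra_simps)
      then show ?thesis unfolding n0 by simp
    qed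
    have p1: "phase i x + phase l x = 2 * pi * of_int n1 * (K0 \<bullet> x) + (\<theta> i + \<theta> l)" if R
    proof -
      have "phase i x + phase l x = 2 * pi * ((K i + K l) \<bullet> x) + (\<theta> i + \<theta> l)"
        by (simp add: phase_def inner_add_left algebra_simps)
      then show ?thesis unfolding n12(1)[OF that] by simp
    qed
    have p2: "phase j x + phase l x = 2 * pi * of_int n2 * (K0 \<bullet> x) + (\<theta> j + \<theta> l)" if R
    proof -
      have "phase j x + phase l x = 2 * pi * ((K j + K l) \<bullet> x) + (\<theta> j + \<theta> l)"
        by (simp add: phase_def inner_add_left algebra_simps)
      then show ?thesis unfolding n12(2)[OF that] by simp
    qed
    have diag: "cf Q t * cf Q t * (K t \<bullet> K t) / 4 = (A t / (K t \<bullet> Q))^2 * (norm (K t))^2 / 4" for t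
      by (simp add: cf_def power2_eq_square power2_norm_eq_inner[symmetric])
    have "res2 Q x = (\<Sum>t\<in>{i, j, l}. cf Q t * cf Q t * (K t \<bullet> K t) / 4)
      + b0 * cos (phase i x - phase j x)
      + (if R then cf Q i * cf Q l * (K i \<bullet> K l) / 2 * cos (phase i x + phase l x) else 0)
      + (if R then cf Q j * cf Q l * (K j \<bullet> K l) / 2 * cos (phase j x + phase l x) else 0)"
    proof -
      define f where "f t u = cf Q t * cf Q u * (K t \<bullet> K u) / 4 *
        ((if (K t + K u) \<bullet> Q = 0 then cos (phase t x + phase u x) else 0) +
         (if (K t - K u) \<bullet> Q = 0 then cos (phase t x - phase u x) else 0))" for t u
      have sum3: "(\<Sum>t\<in>{i, j, l}. h t) = h i + h j + h l" for h :: "nat \<Rightarrow> real"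
        using dist by simp
      have diag: "f t t = cf Q t * cf Q t * (K t \<bullet> K t) / 4" if "K t \<bullet> Q \<noteq> 0" for t
      proof -
        have "(K t + K t) \<bullet> Q \<noteq> 0" using that by (simp only: inner_add_left)
        then show ?thesis by (simp add: f_def)
      qed
      have sym: "f t u = f u t" for t u
      proof -
        have "cos (phase t x - phase u x) = cos (phase u x - phase t x)"
          by (metis cos_minus minus_diff_eq)
        moreover have "(K t - K u) \<bullet> Q = 0 \<longleftrightarrow> (K u - K t) \<bullet> Q = 0" by (auto simp: inner_diff_left)
        ultimately show ?thesis
          unfolding f_def inner_commute[of "K t"] add.commute[of "K t"] add.commute[of "phase t x"]
          by (simp add: inner_commute)
      qed
      have fij: "f i j = b0 / 2 * cos (phase i x - phase j x)"
        using Q by (simp add: f_def b0_def inner_add_left inner_diff_left)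
      have fil: "f t l = (if R then cf Q t * cf Q l * (K t \<bullet> K l) / 4 * cos (phase t x + phase l x) else 0)"
        if "K t \<bullet> Q = q" for t
        using qlq that by (simp add: f_def R_def inner_add_left inner_diff_left)
      have "res2 Q x = (\<Sum>t\<in>{i, j, l}. \<Sum>u\<in>{i, j, l}. f t u)"
        unfolding res2_def f_def ..
      also have "\<dots> = f i i + f j j + f l l + 2 * f i j + 2 * f i l + 2 * f j l"
        unfolding sum3 using sym[of j i] sym[of l i] sym[of l j] by simp
      also have "f i i + f j j + f l l = (\<Sum>t\<in>{i, j, l}. cf Q t * cf Q t * (K t \<bullet> K t) / 4)"
        using Q ql0 unfolding sum3 by (simp add: diag)
      finally show ?thesis unfolding fij fil[OF Q(1)] fil[OF Q(2)] by (auto simp: algebra_simps)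
    qed
    also have "\<dots> = a2 + \<rho> (K0 \<bullet> x)"
      unfolding diag a2_def[symmetric] \<rho>_def p0 using p1 p2 by (simp add: b1_def b2_def)
    finally show ?thesis .
  qed
  have nK0: "1/2 * (norm K0)^2 > 0" using K0(2) by simp
  obtain L where L: "\<And>s. \<delta> \<le> \<rho> s + L^2 * (1/2 * (norm K0)^2) * (sin (pi * (s - s0)))^2"
  proof (rule kinetic_amplitude_exists[of \<rho> \<delta> s0 "1/2 * (norm K0)^2"])
    show "continuous_on UNIV \<rho>" unfolding \<rho>_def by (intro continuous_intros)
    fix s and n :: int
    have "2 * pi * of_int n' * (s + of_int n) + c = (2 * pi * of_int n' * s + c) + 2 * pi * of_int (n' * n)" for n' c
      by (simp add: algebra_simps)
    then have "cos (2 * pi * of_int n' * (s + of_int n) + c) = cos (2 * pi * of_int n' * s + c)" for n' c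
      using trig_shift_integer(2)[OF Ints_of_int] by metis
    then show "\<rho> (s + of_int n) = \<rho> s" unfolding \<rho>_def by simp
  qed (use \<delta> nK0 in auto)
  have "\<exists>B. \<forall>s\<ge>1. 1/2 * s^2 * (norm Q)^2 + a + (a2 + \<delta>) / s^2 - B / s^4 \<le> effective_Hamiltonian pot (s *\<^sub>R Q)"
  proof (rule effective_lower_2[where ?K0.0=K0 and ?s0.0=s0 and L=L])
    show "K t \<bullet> Q \<noteq> 0" if "t \<in> {i, j, l}" for t using that Q ql0 by auto
    show "a2 + \<delta> \<le> res2 Q x + 1/2 * L^2 * (norm K0)^2 * (sin (half K0 s0 x))^2" for x
      using L[of "K0 \<bullet> x"] unfolding res2 half_def by (simp add: algebra_simps)
  qed (use K0(1) K0Q in auto)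
  then show ?thesis using \<delta>(1) unfolding a2_def by blast
qed

lemma nonresonant_upper:
  fixes K :: "nat \<Rightarrow> real ^ 2"
  assumes tp: "trig_potential J K"
    and Q: "\<And>t. t \<in> J \<Longrightarrow> K t \<bullet> Q \<noteq> 0"
    and nonres: "\<And>t u. t \<in> J \<Longrightarrow> u \<in> J \<Longrightarrow> t \<noteq> u \<Longrightarrow> K t \<bullet> K u = 0 \<or> (K t + K u) \<bullet> Q \<noteq> 0 \<and> (K t - K u) \<bullet> Q \<noteq> 0"
  shows "\<exists>B. \<forall>s\<ge>1. trig_Hbar J a A \<theta> K (s *\<^sub>R Q) \<le>
     1/2 * s^2 * (norm Q)^2 + a + (\<Sum>t\<in>J. (A t / (K t \<bullet> Q))^2 * (norm (K t))^2 / 4) / s^2 + B / s^4"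
proof -
  interpret trig_potential J a A \<theta> K by (rule tp)
  have "res2 Q x = (\<Sum>t\<in>J. (A t / (K t \<bullet> Q))^2 * (norm (K t))^2 / 4)" for x
  proof -
    have "cf Q t * cf Q u * (K t \<bullet> K u) / 4 *
     ((if (K t + K u) \<bullet> Q = 0 then cos (phase t x + phase u x) else 0) +
      (if (K t - K u) \<bullet> Q = 0 then cos (phase t x - phase u x) else 0)) =
      (if t = u then (A t / (K t \<bullet> Q))^2 * (norm (K t))^2 / 4 else 0)" if "t \<in> J" "u \<in> J" for t u
    proof (cases "t = u")
      case True
      have "(K u + K u) \<bullet> Q \<noteq> 0" using Q[OF that(2)] by (simp only: inner_add_left)
      then show ?thesis using True
        by (simp add: inner_add_left cf_def power2_eq_square power2_norm_eq_inner[symmetric])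
    next
      case False
      then show ?thesis using nonres[OF that False] by auto
    qed
    then have "res2 Q x = (\<Sum>t\<in>J. \<Sum>u\<in>J. (if t = u then (A t / (K t \<bullet> Q))^2 * (norm (K t))^2 / 4 else 0))"
      unfolding res2_def by (intro sum.cong refl) auto
    then show ?thesis using finJ by simp
  qed
  then show ?thesis using effective_upper_2[OF Q, where \<mu>="\<Sum>t\<in>J. (A t / (K t \<bullet> Q))^2 * (norm (K t))^2 / 4"]
    by simp
qed

lemma compare_second_order:
  fixes \<mu> \<mu>' :: real
  assumes "\<And>s. s \<ge> 1 \<Longrightarrow> c s + a + \<mu> / s^2 - B / s^4 \<le> E s" "\<And>s. s \<ge> 1 \<Longrightarrow> E s \<le> c s + a + \<mu>' / s^2 + B' / s^4"
  shows "\<mu> \<le> \<mu>'"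
proof (rule ccontr)
  assume "\<not> \<mu> \<le> \<mu>'"
  then have d: "\<mu> - \<mu>' > 0" by simp
  define s where "s = 1 + (\<bar>B\<bar> + \<bar>B'\<bar>) / (\<mu> - \<mu>')"
  have s: "s \<ge> 1" using d by (simp add: s_def)
  define u where "u = s^2"
  have u: "u > 0" "s^4 = u * u" using s by (simp_all add: u_def power2_eq_square power4_eq_xxxx)
  have "\<mu> / u - B / (u * u) \<le> \<mu>' / u + B' / (u * u)"
    using assms(1)[OF s] assms(2)[OF s] unfolding u(2) u_def[symmetric] by linarith
  then have "(\<mu> / u - B / (u * u)) * (u * u) \<le> (\<mu>' / u + B' / (u * u)) * (u * u)"
    using u by (intro mult_right_mono) auto
  also have "(\<mu> / u - B / (u * u)) * (u * u) = \<mu> * u - B" using u by (simp add: field_simps)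
  also have "(\<mu>' / u + B' / (u * u)) * (u * u) = \<mu>' * u + B'" using u by (simp add: field_simps)
  finally have "(\<mu> - \<mu>') * s^2 \<le> B + B'" by (simp add: u_def algebra_simps)
  moreover have "s * 1 \<le> s^2" unfolding power2_eq_square using s by (intro mult_left_mono) auto
  then have "(\<mu> - \<mu>') * s \<le> (\<mu> - \<mu>') * s^2" using d by (intro mult_left_mono) auto
  moreover have "(\<mu> - \<mu>') * s = (\<mu> - \<mu>') + (\<bar>B\<bar> + \<bar>B'\<bar>)" using d by (simp add: s_def field_simps)
  ultimately show False using d by linarith
qed

lemma compare_first_order:
  fixes \<mu> \<mu>' :: real
  assumes "\<exists>B. \<forall>s\<ge>1. c s + \<mu> - B / s \<le> E s" "\<exists>B. \<forall>s\<ge>1. E s \<le> c s + \<mu>' + B / s"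
  shows "\<mu> \<le> \<mu>'"
proof (rule ccontr)
  obtain B B' where *: "\<And>s. s \<ge> 1 \<Longrightarrow> c s + \<mu> - B / s \<le> E s" "\<And>s. s \<ge> 1 \<Longrightarrow> E s \<le> c s + \<mu>' + B' / s"
    using assms by blast
  assume "\<not> \<mu> \<le> \<mu>'"
  then have d: "\<mu> - \<mu>' > 0" by simp
  define s where "s = 1 + (\<bar>B\<bar> + \<bar>B'\<bar>) / (\<mu> - \<mu>')"
  have s: "s \<ge> 1" using d by (simp add: s_def)
  have "\<mu> - B / s \<le> \<mu>' + B' / s" using *[OF s] by linarith
  then have "(\<mu> - B / s) * s \<le> (\<mu>' + B' / s) * s" using s by (intro mult_right_mono) auto
  also have "(\<mu> - B / s) * s = \<mu> * s - B" using s by (simp add: field_simps)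
  also have "(\<mu>' + B' / s) * s = \<mu>' * s + B'" using s by (simp add: field_simps)
  finally have "(\<mu> - \<mu>') * s \<le> B + B'" by (simp add: algebra_simps)
  moreover have "(\<mu> - \<mu>') * s = (\<mu> - \<mu>') + (\<bar>B\<bar> + \<bar>B'\<bar>)" using d by (simp add: s_def field_simps)
  ultimately show False using d by linarith
qed

text \<open>
  Along the resonant direction \<open>Q\<close> of the frequency \<open>K i - K j\<close> the first potential gains a positive amount
  \<open>\<delta>\<close> at order \<open>s^-2\<close>. The mean value of order \<open>s^-2\<close> does not change if the \<open>K t\<close> are
  scaled separately, so the second potential must be resonant along \<open>Q\<close> as well. The alternatives list the pairs of modes
  that can be responsible.
\<close>

lemma second_order_alternatives:
  fixes K :: "nat \<Rightarrow> real ^ 2" and \<nu> m :: "nat \<Rightarrow> real"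
  assumes J: "J = {i, j, l}" and tp: "trig_potential J K" "trig_potential J (\<lambda>t. \<nu> t *\<^sub>R K t)"
    and dist: "i \<noteq> j" "i \<noteq> l" "j \<noteq> l"
    and A: "\<And>t. t \<in> J \<Longrightarrow> A t \<noteq> 0" and m: "\<And>t. t \<in> J \<Longrightarrow> m t > 0" and \<nu>: "\<And>t. t \<in> J \<Longrightarrow> \<nu> t > 0"
    and rel: "m i *\<^sub>R K i + m j *\<^sub>R K j + m l *\<^sub>R K l = 0"
    and nonpar: "det2 (K i) (K j) \<noteq> 0"
    and g: "K i \<bullet> K j \<noteq> 0"
    and E: "\<And>p. trig_Hbar J a A \<theta> K p =
        trig_Hbar J a A \<theta>' (\<lambda>t. \<nu> t *\<^sub>R K t) p"
  shows "\<nu> i = \<nu> j \<or> (K i \<bullet> K l \<noteq> 0 \<and> \<nu> i * m l = \<nu> l * (m i + m j)) \<or> (K j \<bullet> K l \<noteq> 0 \<and> \<nu> j * m l = \<nu> l * (m i + m j))"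
proof (rule ccontr)
  assume contra: "\<not> ?thesis"
  have mm: "m i > 0" "m j > 0" "m l > 0" and \<nu>\<nu>: "\<nu> i > 0" "\<nu> j > 0" "\<nu> l > 0" using m \<nu> J by auto
  define Q where "Q = rot2 (K i - K j)"
  define q where "q = K i \<bullet> Q"
  have q: "K i \<bullet> Q = q" "K j \<bullet> Q = q" "q \<noteq> 0"
    using nonpar unfolding q_def Q_def inner_rot2 by (auto simp: det2_def algebra_simps)
  have ne: "K i \<noteq> K j" using nonpar by (auto simp: det2_def)
  have ql: "K l \<bullet> Q = - ((m i + m j) * q / m l)" by (rule relation_imp_antisymmetric[where K=K and m=m, OF rel q(1,2) mm(3)])
  have ql0: "K l \<bullet> Q \<noteq> 0" unfolding ql using mm q(3) by simp
  define a2 where "a2 = (\<Sum>t\<in>J. (A t / (K t \<bullet> Q))^2 * (norm (K t))^2 / 4)"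
  have "\<exists>\<delta>>0. \<exists>B. \<forall>s\<ge>1. 1/2 * s^2 * (norm Q)^2 + a + (a2 + \<delta>) / s^2 - B / s^4
    \<le> trig_Hbar J a A \<theta> K (s *\<^sub>R Q)"
    unfolding a2_def J by (rule resonant_lower[OF tp(1)[unfolded J] dist _ _ mm rel q g ne]) (use A J in auto)
  then obtain \<delta> B where \<delta>: "\<delta> > 0" and lower: "\<And>s. s \<ge> 1 \<Longrightarrow> 1/2 * s^2 * (norm Q)^2 + a + (a2 + \<delta>) / s^2 - B / s^4
    \<le> trig_Hbar J a A \<theta> K (s *\<^sub>R Q)"
    by blast
  have a2': "(\<Sum>t\<in>J. (A t / ((\<nu> t *\<^sub>R K t) \<bullet> Q))^2 * (norm (\<nu> t *\<^sub>R K t))^2 / 4) = a2"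
    unfolding a2_def
  proof (intro sum.cong refl)
    fix t assume "t \<in> J"
    then show "(A t / ((\<nu> t *\<^sub>R K t) \<bullet> Q))^2 * (norm (\<nu> t *\<^sub>R K t))^2 / 4 = (A t / (K t \<bullet> Q))^2 * (norm (K t))^2 / 4"
      using \<nu>[of t] by (simp add: power_mult_distrib power_divide)
  qed
  have il: "K i \<bullet> K l = 0 \<or> \<nu> i * q + \<nu> l * (K l \<bullet> Q) \<noteq> 0 \<and> \<nu> i * q - \<nu> l * (K l \<bullet> Q) \<noteq> 0"
    and jl: "K j \<bullet> K l = 0 \<or> \<nu> j * q + \<nu> l * (K l \<bullet> Q) \<noteq> 0 \<and> \<nu> j * q - \<nu> l * (K l \<bullet> Q) \<noteq> 0"
  proof -
    have e: "\<nu>' * q + \<nu> l * (K l \<bullet> Q) = q / m l * (\<nu>' * m l - \<nu> l * (m i + m j))"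
      "\<nu>' * q - \<nu> l * (K l \<bullet> Q) = q / m l * (\<nu>' * m l + \<nu> l * (m i + m j))" for \<nu>'
      unfolding ql using mm by (simp_all add: field_simps)
    have p: "\<nu> i * m l + \<nu> l * (m i + m j) \<noteq> 0" "\<nu> j * m l + \<nu> l * (m i + m j) \<noteq> 0"
      using mm \<nu>\<nu> by (smt (verit) mult_pos_pos)+
    show "K i \<bullet> K l = 0 \<or> \<nu> i * q + \<nu> l * (K l \<bullet> Q) \<noteq> 0 \<and> \<nu> i * q - \<nu> l * (K l \<bullet> Q) \<noteq> 0"
      "K j \<bullet> K l = 0 \<or> \<nu> j * q + \<nu> l * (K l \<bullet> Q) \<noteq> 0 \<and> \<nu> j * q - \<nu> l * (K l \<bullet> Q) \<noteq> 0"
      unfolding e using contra p q(3) mm by auto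
  qed
  have ij: "\<nu> i * q + \<nu> j * q \<noteq> 0 \<and> \<nu> i * q - \<nu> j * q \<noteq> 0"
    using contra q(3) \<nu>\<nu> by (auto simp: add_nonneg_eq_0_iff simp flip: distrib_right left_diff_distrib)
  have "\<exists>B. \<forall>s\<ge>1. trig_Hbar J a A \<theta>' (\<lambda>t. \<nu> t *\<^sub>R K t) (s *\<^sub>R Q) \<le>
     1/2 * s^2 * (norm Q)^2 + a + (\<Sum>t\<in>J. (A t / ((\<nu> t *\<^sub>R K t) \<bullet> Q))^2 * (norm (\<nu> t *\<^sub>R K t))^2 / 4) / s^2 + B / s^4"
  proof (rule nonresonant_upper[OF tp(2)])
    show "(\<nu> t *\<^sub>R K t) \<bullet> Q \<noteq> 0" if "t \<in> J" for t
      using that \<nu>[OF that] q ql0 unfolding J by auto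
    fix t u assume tu: "t \<in> J" "u \<in> J" "t \<noteq> u"
    have sym: "x + y \<noteq> 0 \<and> x - y \<noteq> 0 \<longleftrightarrow> y + x \<noteq> 0 \<and> y - x \<noteq> (0::real)" for x y by auto
    have "K t \<bullet> K u = 0 \<or> \<nu> t * (K t \<bullet> Q) + \<nu> u * (K u \<bullet> Q) \<noteq> 0 \<and> \<nu> t * (K t \<bullet> Q) - \<nu> u * (K u \<bullet> Q) \<noteq> 0"
      using tu il jl ij unfolding J
      by (auto simp: q(1,2) inner_commute[of "K l"] inner_commute[of "K j" "K i"] add.commute)
    then show "(\<nu> t *\<^sub>R K t) \<bullet> (\<nu> u *\<^sub>R K u) = 0 \<or> (\<nu> t *\<^sub>R K t + \<nu> u *\<^sub>R K u) \<bullet> Q \<noteq> 0 \<and> (\<nu> t *\<^sub>R K t - \<nu> u *\<^sub>R K u) \<bullet> Q \<noteq> 0"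
      by (auto simp: inner_add_left inner_diff_left)
  qed
  then obtain B' where upper: "\<And>s. s \<ge> 1 \<Longrightarrow> trig_Hbar J a A \<theta> K (s *\<^sub>R Q) \<le>
     1/2 * s^2 * (norm Q)^2 + a + a2 / s^2 + B' / s^4"
    unfolding a2' E by blast
  have "a2 + \<delta> \<le> a2" by (rule compare_second_order[OF lower upper])
  then show False using \<delta> by simp
qed

section \<open>The frequencies agree up to a common factor\<close>

text \<open>
  The hypotheses are the alternatives of \<open>second_order_alternatives\<close>, labelled \<open>F\<close>, and those obtained by exchanging the two
  potentials, labelled \<open>B\<close>. As \<open>m1\<close> is minimal, it is too small for the alternatives to \<open>x2 = x3\<close> in
  \<open>B23\<close>. The other four hypotheses then exclude \<open>x1 \<noteq> x2\<close>.
\<close>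

lemma ratios_equal_all_active:
  fixes x1 x2 x3 m1 m2 m3 :: real
  assumes pos: "x1 > 0" "x2 > 0" "x3 > 0" "m1 > 0" "m2 > 0" "m3 > 0" and min: "m1 \<le> m2" "m1 \<le> m3"
    and B23: "x2 = x3 \<or> m1 * x3 = m2 * x3 + m3 * x2 \<or> m1 * x2 = m2 * x3 + m3 * x2"
    and F12: "x1 = x2 \<or> x1 * m3 = x3 * (m1 + m2) \<or> x2 * m3 = x3 * (m1 + m2)"
    and B12: "x1 = x2 \<or> m3 * x2 = m1 * x2 + m2 * x1 \<or> m3 * x1 = m1 * x2 + m2 * x1"
    and F13: "x1 = x3 \<or> x1 * m2 = x2 * (m1 + m3) \<or> x3 * m2 = x2 * (m1 + m3)"
    and B13: "x1 = x3 \<or> m2 * x3 = m1 * x3 + m3 * x1 \<or> m2 * x1 = m1 * x3 + m3 * x1"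
  shows "x1 = x2 \<and> x2 = x3"
proof -
  have "m1 * x3 \<le> m2 * x3" "m1 * x2 \<le> m3 * x2" "0 < m3 * x2" "0 < m2 * x3"
    using pos min by (auto intro: mult_right_mono)
  then have x23: "x2 = x3" using B23 by linarith
  have "x1 = x2"
  proof (rule ccontr)
    assume ne: "x1 \<noteq> x2"
    have c1: "x1 * m3 = x2 * (m1 + m2)"
    proof (rule ccontr)
      assume "x1 * m3 \<noteq> x2 * (m1 + m2)"
      then have "x2 * m3 = x2 * (m1 + m2)" using F12 ne x23 by blast
      then have m: "m3 = m1 + m2" using pos by simp
      have "m2 * (x2 - x1) = 0 \<or> m1 * (x1 - x2) = 0" using B12 ne unfolding m by (auto simp: algebra_simps)
      then show False using ne pos by simp
    qed
    have c2: "x1 * m2 = x2 * (m1 + m3)"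
    proof (rule ccontr)
      assume "x1 * m2 \<noteq> x2 * (m1 + m3)"
      then have "x2 * m2 = x2 * (m1 + m3)" using F13 ne x23 by blast
      then have m: "m2 = m1 + m3" using pos by simp
      have "m3 * (x2 - x1) = 0 \<or> m1 * (x1 - x2) = 0" using B13 ne x23 unfolding m by (auto simp: algebra_simps)
      then show False using ne pos by simp
    qed
    have "(x1 + x2) * (m3 - m2) = 0" using c1 c2 by (simp add: algebra_simps)
    then have m: "m3 = m2" using pos by simp
    have "m1 * x2 = 0" using B12 ne c1 unfolding m by (auto simp: algebra_simps)
    then show False using pos by simp
  qed
  then show ?thesis using x23 by simp
qed

text \<open>
  Modes \<open>a\<close> and \<open>b\<close> are orthogonal and do not interact, which leaves one alternative to the equality
  of the ratios for each other pair and each order of the two potentials.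
\<close>

lemma ratios_equal_one_inactive:
  fixes xa xb xc ma mb mc :: real
  assumes pos: "xa > 0" "xb > 0" "xc > 0" "ma > 0" "mb > 0" "mc > 0"
    and Fac: "xa = xc \<or> xc * mb = xb * (ma + mc)" and Bac: "xa = xc \<or> mb * xa = ma * xc + mc * xa"
    and Fbc: "xb = xc \<or> xc * ma = xa * (mb + mc)" and Bbc: "xb = xc \<or> ma * xb = mb * xc + mc * xb"
  shows "xa = xc \<and> xb = xc"
proof (cases "xa = xc")
  case True
  have "xb = xc"
  proof (rule ccontr)
    assume ne: "xb \<noteq> xc"
    then have "xc * ma = xc * (mb + mc)" using Fbc True by simp
    then have m: "ma = mb + mc" using pos by simp
    have "mb * (xb - xc) = 0" using Bbc ne unfolding m by (simp add: algebra_simps)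
    then show False using ne pos by simp
  qed
  with True show ?thesis by simp
next
  case nea: False
  have F: "xc * mb = xb * (ma + mc)" and B: "mb * xa = ma * xc + mc * xa" using Fac Bac nea by auto
  show ?thesis
  proof (cases "xb = xc")
    case True
    then have m: "mb = ma + mc" using F pos by simp
    have "ma * (xa - xc) = 0" using B unfolding m by (simp add: algebra_simps)
    then show ?thesis using nea pos by simp
  next
    case False
    then have "ma * xb = mb * xc + mc * xb" using Bbc by simp
    then have "mc * xb = 0" using F by (simp add: algebra_simps)
    then show ?thesis using pos by simp
  qed
qed

text \<open>
  Exchanging the potentials replaces \<open>K\<close>, \<open>\<nu>\<close>, \<open>m\<close> by \<open>\<nu> K\<close>, \<open>1 / \<nu>\<close>, \<open>m / \<nu>\<close>.
\<close>

lemma second_order_alternatives_both: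
  fixes K :: "nat \<Rightarrow> real ^ 2" and \<nu> m :: "nat \<Rightarrow> real"
  assumes J: "J = {i, j, l}" and tp: "trig_potential J K" "trig_potential J (\<lambda>t. \<nu> t *\<^sub>R K t)"
    and dist: "i \<noteq> j" "i \<noteq> l" "j \<noteq> l"
    and A: "\<And>t. t \<in> J \<Longrightarrow> A t \<noteq> 0" and m: "\<And>t. t \<in> J \<Longrightarrow> m t > 0" and \<nu>: "\<And>t. \<nu> t > 0"
    and rel: "m i *\<^sub>R K i + m j *\<^sub>R K j + m l *\<^sub>R K l = 0"
    and nonpar: "det2 (K i) (K j) \<noteq> 0"
    and g: "K i \<bullet> K j \<noteq> 0"
    and E: "\<And>p. trig_Hbar J a A \<theta> K p =
        trig_Hbar J a A \<theta>' (\<lambda>t. \<nu> t *\<^sub>R K t) p"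
  shows "\<nu> i = \<nu> j \<or> (K i \<bullet> K l \<noteq> 0 \<and> \<nu> i * m l = \<nu> l * (m i + m j)) \<or> (K j \<bullet> K l \<noteq> 0 \<and> \<nu> j * m l = \<nu> l * (m i + m j))"
    "\<nu> i = \<nu> j \<or> (K i \<bullet> K l \<noteq> 0 \<and> m l * \<nu> j = m i * \<nu> j + m j * \<nu> i) \<or> (K j \<bullet> K l \<noteq> 0 \<and> m l * \<nu> i = m i * \<nu> j + m j * \<nu> i)"
proof -
  show "\<nu> i = \<nu> j \<or> (K i \<bullet> K l \<noteq> 0 \<and> \<nu> i * m l = \<nu> l * (m i + m j)) \<or> (K j \<bullet> K l \<noteq> 0 \<and> \<nu> j * m l = \<nu> l * (m i + m j))"
    using second_order_alternatives[OF J tp dist A m \<nu> rel nonpar g E] .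
  have \<nu>': "\<nu> t \<noteq> 0" for t using \<nu>[of t] by simp
  define K' where "K' = (\<lambda>t. \<nu> t *\<^sub>R K t)"
  have inv: "(\<lambda>t. (1 / \<nu> t) *\<^sub>R K' t) = K" using \<nu>' by (simp add: K'_def)
  have "1 / \<nu> i = 1 / \<nu> j \<or> (K' i \<bullet> K' l \<noteq> 0 \<and> 1 / \<nu> i * (m l / \<nu> l) = 1 / \<nu> l * (m i / \<nu> i + m j / \<nu> j))
      \<or> (K' j \<bullet> K' l \<noteq> 0 \<and> 1 / \<nu> j * (m l / \<nu> l) = 1 / \<nu> l * (m i / \<nu> i + m j / \<nu> j))"
  proof (rule second_order_alternatives[OF J, where K=K' and \<nu>="\<lambda>t. 1 / \<nu> t" and m="\<lambda>t. m t / \<nu> t" and A=A and a=a and \<theta>=\<theta>' and \<theta>'=\<theta>])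
    show "trig_potential J K'" using tp(2) by (simp add: K'_def)
    show "trig_potential J (\<lambda>t. (1 / \<nu> t) *\<^sub>R K' t)" unfolding inv by (rule tp(1))
    show "(m i / \<nu> i) *\<^sub>R K' i + (m j / \<nu> j) *\<^sub>R K' j + (m l / \<nu> l) *\<^sub>R K' l = 0"
      using rel \<nu>' by (simp add: K'_def)
    have "det2 (K' i) (K' j) = \<nu> i * \<nu> j * det2 (K i) (K j)" by (simp add: K'_def det2_def algebra_simps)
    then show "det2 (K' i) (K' j) \<noteq> 0" using nonpar \<nu>' by simp
    show "K' i \<bullet> K' j \<noteq> 0" using g \<nu>' by (simp add: K'_def)
    show "trig_Hbar J a A \<theta>' K' p =
        effective_Hamiltonian (trig_potential.pot J a A \<theta> (\<lambda>t. (1 / \<nu> t) *\<^sub>R K' t)) p" for p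
      unfolding inv using E[of p] by (simp add: K'_def)
  qed (use dist A m \<nu> in auto)
  then show "\<nu> i = \<nu> j \<or> (K i \<bullet> K l \<noteq> 0 \<and> m l * \<nu> j = m i * \<nu> j + m j * \<nu> i) \<or> (K j \<bullet> K l \<noteq> 0 \<and> m l * \<nu> i = m i * \<nu> j + m j * \<nu> i)"
    using \<nu>'[of i] \<nu>'[of j] \<nu>'[of l] by (simp add: K'_def field_simps)
qed

text \<open>
  At most one pair of modes is orthogonal, because two vectors orthogonal to the same nonzero vector of the plane are
  parallel. So \<open>ratios_equal_one_inactive\<close> or \<open>ratios_equal_all_active\<close> applies after relabelling.
\<close>

lemma frequency_ratios_equal:
  fixes K :: "nat \<Rightarrow> real ^ 2" and \<nu> m :: "nat \<Rightarrow> real"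
  defines "J \<equiv> {1, 2, 3 :: nat}"
  assumes tp: "trig_potential J K" "trig_potential J (\<lambda>t. \<nu> t *\<^sub>R K t)"
    and A: "\<And>t. t \<in> J \<Longrightarrow> A t \<noteq> 0" and m: "\<And>t. t \<in> J \<Longrightarrow> m t > 0" and \<nu>: "\<And>t. \<nu> t > 0"
    and rel: "m 1 *\<^sub>R K 1 + m 2 *\<^sub>R K 2 + m 3 *\<^sub>R K 3 = 0"
    and nonpar: "\<And>t u. t \<in> J \<Longrightarrow> u \<in> J \<Longrightarrow> t \<noteq> u \<Longrightarrow> det2 (K t) (K u) \<noteq> 0"
    and E: "\<And>p. trig_Hbar J a A \<theta> K p =
        trig_Hbar J a A \<theta>' (\<lambda>t. \<nu> t *\<^sub>R K t) p"
  shows "\<nu> 1 = \<nu> 2 \<and> \<nu> 2 = \<nu> 3"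
proof -
  have D: "\<nu> i = \<nu> j \<or> (K i \<bullet> K l \<noteq> 0 \<and> \<nu> i * m l = \<nu> l * (m i + m j)) \<or> (K j \<bullet> K l \<noteq> 0 \<and> \<nu> j * m l = \<nu> l * (m i + m j))"
    "\<nu> i = \<nu> j \<or> (K i \<bullet> K l \<noteq> 0 \<and> m l * \<nu> j = m i * \<nu> j + m j * \<nu> i) \<or> (K j \<bullet> K l \<noteq> 0 \<and> m l * \<nu> i = m i * \<nu> j + m j * \<nu> i)"
    if "J = {i, j, l}" "i \<noteq> j" "i \<noteq> l" "j \<noteq> l" "K i \<bullet> K j \<noteq> 0" for i j l
  proof -
    have "m i *\<^sub>R K i + m j *\<^sub>R K j + m l *\<^sub>R K l = (\<Sum>t\<in>{i, j, l}. m t *\<^sub>R K t)"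
      using that by simp
    also have "\<dots> = (\<Sum>t\<in>{1, 2, 3}. m t *\<^sub>R K t)" using that(1) unfolding J_def by simp
    also have "\<dots> = 0" using rel by (simp add: add.assoc)
    finally have rel': "m i *\<^sub>R K i + m j *\<^sub>R K j + m l *\<^sub>R K l = 0" .
    have np: "det2 (K i) (K j) \<noteq> 0" using nonpar that by auto
    note both = second_order_alternatives_both[OF that(1) tp that(2-4) A m \<nu> rel' np that(5) E]
    show "\<nu> i = \<nu> j \<or> (K i \<bullet> K l \<noteq> 0 \<and> \<nu> i * m l = \<nu> l * (m i + m j)) \<or> (K j \<bullet> K l \<noteq> 0 \<and> \<nu> j * m l = \<nu> l * (m i + m j))"
      by (rule both(1))
    show "\<nu> i = \<nu> j \<or> (K i \<bullet> K l \<noteq> 0 \<and> m l * \<nu> j = m i * \<nu> j + m j * \<nu> i) \<or> (K j \<bullet> K l \<noteq> 0 \<and> m l * \<nu> i = m i * \<nu> j + m j * \<nu> i)"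
      by (rule both(2))
  qed
  have one: "K u \<bullet> K w \<noteq> 0" if "J = {t, u, w}" "u \<noteq> w" "t \<noteq> u" "t \<noteq> w" "K t \<bullet> K u = 0" for t u w
  proof
    assume z: "K u \<bullet> K w = 0"
    have "K u \<noteq> 0" using nonpar[of u w] that by (auto simp: det2_def)
    moreover have "K w \<bullet> K u = 0" using z by (simp add: inner_commute)
    ultimately have "det2 (K t) (K w) = 0" using orthogonal_imp_det2_zero that(5) by blast
    then show False using nonpar[of t w] that by auto
  qed
  have inactive: "\<nu> x = \<nu> z \<and> \<nu> y = \<nu> z" if J': "J = {x, y, z}" "x \<noteq> y" "x \<noteq> z" "y \<noteq> z" and act: "K x \<bullet> K y = 0" for x y z
  proof (rule ratios_equal_one_inactive)
    have "K y \<bullet> K z \<noteq> 0" using one[of x y z] J' act by auto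
    moreover have "K x \<bullet> K z \<noteq> 0" using one[of y x z] J' act by (auto simp: insert_commute inner_commute)
    ultimately have a: "K x \<bullet> K z \<noteq> 0" "K y \<bullet> K z \<noteq> 0" by auto
    have J1: "J = {x, z, y}" "J = {y, z, x}" using J' by auto
    show "\<nu> x = \<nu> z \<or> \<nu> z * m y = \<nu> y * (m x + m z)" "\<nu> x = \<nu> z \<or> m y * \<nu> x = m x * \<nu> z + m z * \<nu> x"
      using D[OF J1(1)] J' a act by auto
    show "\<nu> y = \<nu> z \<or> \<nu> z * m x = \<nu> x * (m y + m z)" "\<nu> y = \<nu> z \<or> m x * \<nu> y = m y * \<nu> z + m z * \<nu> y"
      using D[OF J1(2)] J' a act by (auto simp: inner_commute)
  qed (use m \<nu> J' in auto)
  have active: "\<nu> x = \<nu> y \<and> \<nu> y = \<nu> z" if J': "J = {x, y, z}" "x \<noteq> y" "x \<noteq> z" "y \<noteq> z"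
    and min: "m x \<le> m y" "m x \<le> m z" and act: "K x \<bullet> K y \<noteq> 0" "K x \<bullet> K z \<noteq> 0" "K y \<bullet> K z \<noteq> 0" for x y z
  proof -
    have J1: "J = {y, z, x}" "J = {x, z, y}" using J' by auto
    show ?thesis
    proof (rule ratios_equal_all_active[OF _ _ _ _ _ _ min])
      show "\<nu> y = \<nu> z \<or> m x * \<nu> z = m y * \<nu> z + m z * \<nu> y \<or> m x * \<nu> y = m y * \<nu> z + m z * \<nu> y"
        using D(2)[OF J1(1)] J' act by auto
      show "\<nu> x = \<nu> y \<or> \<nu> x * m z = \<nu> z * (m x + m y) \<or> \<nu> y * m z = \<nu> z * (m x + m y)"
        "\<nu> x = \<nu> y \<or> m z * \<nu> y = m x * \<nu> y + m y * \<nu> x \<or> m z * \<nu> x = m x * \<nu> y + m y * \<nu> x"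
        using D[OF J'(1)] J' act by auto
      show "\<nu> x = \<nu> z \<or> \<nu> x * m y = \<nu> y * (m x + m z) \<or> \<nu> z * m y = \<nu> y * (m x + m z)"
        "\<nu> x = \<nu> z \<or> m y * \<nu> z = m x * \<nu> z + m z * \<nu> x \<or> m y * \<nu> x = m x * \<nu> z + m z * \<nu> x"
        using D[OF J1(2)] J' act by auto
    qed (use m \<nu> J' in auto)
  qed
  have P: "J = {1, 2, 3}" "J = {2, 1, 3}" "J = {3, 1, 2}" "J = {1, 3, 2}" "J = {2, 3, 1}" unfolding J_def by auto
  consider "K 1 \<bullet> K 2 = 0" | "K 1 \<bullet> K 3 = 0" | "K 2 \<bullet> K 3 = 0"
    | "K 1 \<bullet> K 2 \<noteq> 0" "K 1 \<bullet> K 3 \<noteq> 0" "K 2 \<bullet> K 3 \<noteq> 0" by blast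
  then show ?thesis
  proof cases
    case 1 then show ?thesis using inactive[OF P(1)] by auto
  next
    case 2 then show ?thesis using inactive[OF P(4)] by auto
  next
    case 3 then show ?thesis using inactive[OF P(5)] by auto
  next
    case 4
    consider "m 1 \<le> m 2" "m 1 \<le> m 3" | "m 2 \<le> m 1" "m 2 \<le> m 3" | "m 3 \<le> m 1" "m 3 \<le> m 2" by linarith
    then show ?thesis
    proof cases
      case 1 then show ?thesis using active[OF P(1)] 4 by auto
    next
      case 2 then show ?thesis using active[OF P(2)] 4 by (auto simp: inner_commute)
    next
      case 3 then show ?thesis using active[OF P(3)] 4 by (auto simp: inner_commute)
    qed
  qed
qed

section \<open>Directions and amplitudes of the modes\<close>

definition first_order_value where
  "first_order_value J a A K Q = a + (\<Sum>t\<in>J. if K t \<bullet> Q = 0 then A t else 0 :: real)"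

lemma first_order_upper:
  fixes K :: "nat \<Rightarrow> real ^ 2"
  assumes tp: "trig_potential J K" and A: "\<And>t. t \<in> J \<Longrightarrow> A t > 0"
  shows "\<exists>B. \<forall>s\<ge>1. trig_Hbar J a A \<theta> K (s *\<^sub>R Q) \<le>
    1/2 * s^2 * (norm Q)^2 + first_order_value J a A K Q + B / s"
proof -
  interpret trig_potential J a A \<theta> K by (rule tp)
  have "A t * cos u \<le> A t" if "t \<in> J" for t u
    using mult_left_mono[OF cos_le_one, of "A t" u] A[OF that] by simp
  then have "res1 Q x \<le> first_order_value J a A K Q" for x
    unfolding res1_def first_order_value_def by (auto intro!: sum_mono)
  then show ?thesis by (rule effective_upper_1)
qed

text \<open>
  At most one mode \<open>j\<close> is resonant. With \<open>L^2 * (norm (K j))^2 = 4 * A j\<close>, the identity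
  \<open>cos (2 t) + 2 * (sin t)^2 = 1\<close> makes the energy constant, equal to the maximum of the resonant part.
\<close>

lemma first_order_lower:
  fixes K :: "nat \<Rightarrow> real ^ 2"
  assumes tp: "trig_potential J K" and A: "\<And>t. t \<in> J \<Longrightarrow> A t > 0" and Q: "Q \<noteq> 0"
    and nonpar: "\<And>t u. t \<in> J \<Longrightarrow> u \<in> J \<Longrightarrow> t \<noteq> u \<Longrightarrow> det2 (K t) (K u) \<noteq> 0" and K: "\<And>t. t \<in> J \<Longrightarrow> K t \<noteq> 0"
  shows "\<exists>B. \<forall>s\<ge>1. 1/2 * s^2 * (norm Q)^2 + first_order_value J a A K Q - B / s \<le>
    trig_Hbar J a A \<theta> K (s *\<^sub>R Q)"
proof -
  interpret trig_potential J a A \<theta> K by (rule tp)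
  show ?thesis
  proof (cases "\<exists>j\<in>J. K j \<bullet> Q = 0")
    case False
    then have nz: "\<And>t. t \<in> J \<Longrightarrow> K t \<bullet> Q \<noteq> 0" by blast
    then have "first_order_value J a A K Q = a" unfolding first_order_value_def by simp
    then show ?thesis using effective_lower_1[of 0 Q a 0 0] res1_nonresonant[of Q] nz by simp
  next
    case True
    then obtain j where j: "j \<in> J" "K j \<bullet> Q = 0" by blast
    have only: "K t \<bullet> Q = 0 \<longleftrightarrow> t = j" if "t \<in> J" for t
      using nonpar[OF that j(1)] orthogonal_imp_det2_zero[of "K t" Q "K j"] j Q by auto
    have val: "first_order_value J a A K Q = a + A j"
    proof -
      have "(\<Sum>t\<in>J. if K t \<bullet> Q = 0 then A t else 0) = (\<Sum>t\<in>J. if t = j then A t else 0)"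
        using only by (intro sum.cong) auto
      then show ?thesis using j finJ by (simp add: first_order_value_def)
    qed
    have r: "res1 Q x = a + A j * cos (phase j x)" for x
    proof -
      have "(\<Sum>t\<in>J. if K t \<bullet> Q = 0 then A t * cos (phase t x) else 0) = (\<Sum>t\<in>J. if t = j then A t * cos (phase t x) else 0)"
        using only by (intro sum.cong) auto
      then show ?thesis using j finJ by (simp add: res1_def)
    qed
    define s0 where "s0 = - \<theta> j / (2 * pi)"
    define L where "L = 2 * sqrt (A j) / norm (K j)"
    have L: "1/2 * L^2 * (norm (K j))^2 = 2 * A j"
      using K[OF j(1)] A[OF j(1)] by (simp add: L_def power_divide power_mult_distrib)
    have ph: "phase j x = 2 * half (K j) s0 x" for x
      by (simp add: phase_def half_def s0_def algebra_simps)
    show ?thesis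
    proof (rule effective_lower_1[of "K j"])
      fix x
      have "A j * cos (2 * half (K j) s0 x) + 2 * A j * (sin (half (K j) s0 x))^2 = A j"
        by (simp add: cos_double_sin algebra_simps)
      then show "first_order_value J a A K Q \<le> res1 Q x + 1/2 * L^2 * (norm (K j))^2 * (sin (half (K j) s0 x))^2"
        unfolding val r L ph by simp
    qed (use j Kint in auto)
  qed
qed

lemma nonresonant_direction_exists:
  fixes F :: "(real ^ 2) set"
  assumes "finite F" "0 \<notin> F"
  obtains Q where "Q \<noteq> 0" "\<And>u. u \<in> F \<Longrightarrow> u \<bullet> Q \<noteq> 0"
proof -
  obtain t where t: "t \<notin> (\<lambda>u. - u $ 1 / u $ 2) ` F"
    using ex_new_if_finite[OF infinite_UNIV_char_0[where 'a=real], of "(\<lambda>u. - u $ 1 / u $ 2) ` F"] assms(1) by blast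
  let ?Q = "vector [1, t] :: real ^ 2"
  have "u \<bullet> ?Q \<noteq> 0" if u: "u \<in> F" for u
  proof
    assume "u \<bullet> ?Q = 0"
    then have e: "u $ 1 + u $ 2 * t = 0" by (simp add: inner_vec2)
    show False
    proof (cases "u $ 2 = 0")
      case True
      then have "u = 0" using e by (simp add: vec2_eq_iff)
      then show False using u assms(2) by blast
    next
      case False
      then have "t = - u $ 1 / u $ 2" using e by (simp add: field_simps)
      then show False using t u by blast
    qed
  qed
  moreover have "?Q \<noteq> 0" by (simp add: vec2_eq_iff)
  ultimately show thesis using that by blast
qed

text \<open>
  A direction orthogonal to none of the frequencies gives \<open>a\<close>. The direction orthogonal to \<open>K j\<close> gives
  \<open>a + A j\<close>, so some \<open>K' i\<close> must be orthogonal to it too.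
\<close>

lemma first_order_match:
  fixes K K' :: "nat \<Rightarrow> real ^ 2"
  assumes tp: "trig_potential J K" "trig_potential J K'"
    and A: "\<And>t. t \<in> J \<Longrightarrow> A t > 0" "\<And>t. t \<in> J \<Longrightarrow> A' t > 0"
    and K0: "\<And>t. t \<in> J \<Longrightarrow> K t \<noteq> 0" "\<And>t. t \<in> J \<Longrightarrow> K' t \<noteq> 0"
    and nonpar: "\<And>t u. t \<in> J \<Longrightarrow> u \<in> J \<Longrightarrow> t \<noteq> u \<Longrightarrow> det2 (K t) (K u) \<noteq> 0"
      "\<And>t u. t \<in> J \<Longrightarrow> u \<in> J \<Longrightarrow> t \<noteq> u \<Longrightarrow> det2 (K' t) (K' u) \<noteq> 0"
    and E: "\<And>p. trig_Hbar J a A \<theta> K p =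
        trig_Hbar J a' A' \<theta>' K' p"
  shows "a = a'" "\<forall>j\<in>J. \<exists>i\<in>J. det2 (K j) (K' i) = 0 \<and> A' i = A j"
proof -
  have finJ: "finite J" using tp(1) unfolding trig_potential_def by blast
  have low1: "\<exists>B. \<forall>s\<ge>1. 1/2 * s^2 * (norm Q)^2 + first_order_value J a A K Q - B / s \<le>
      trig_Hbar J a A \<theta> K (s *\<^sub>R Q)" if "Q \<noteq> 0" for Q
    by (rule first_order_lower[OF tp(1)]) (use A(1) that nonpar(1) K0(1) in auto)
  have low2: "\<exists>B. \<forall>s\<ge>1. 1/2 * s^2 * (norm Q)^2 + first_order_value J a' A' K' Q - B / s \<le>
      trig_Hbar J a' A' \<theta>' K' (s *\<^sub>R Q)" if "Q \<noteq> 0" for Q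
    by (rule first_order_lower[OF tp(2)]) (use A(2) that nonpar(2) K0(2) in auto)
  have up1: "\<exists>B. \<forall>s\<ge>1. trig_Hbar J a A \<theta> K (s *\<^sub>R Q) \<le>
      1/2 * s^2 * (norm Q)^2 + first_order_value J a A K Q + B / s" for Q
    by (rule first_order_upper[OF tp(1)]) (use A(1) in auto)
  have up2: "\<exists>B. \<forall>s\<ge>1. trig_Hbar J a' A' \<theta>' K' (s *\<^sub>R Q) \<le>
      1/2 * s^2 * (norm Q)^2 + first_order_value J a' A' K' Q + B / s" for Q
    by (rule first_order_upper[OF tp(2)]) (use A(2) in auto)
  have val: "first_order_value J a A K Q = first_order_value J a' A' K' Q" if Q: "Q \<noteq> 0" for Q
  proof (rule antisym)
    show "first_order_value J a A K Q \<le> first_order_value J a' A' K' Q"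
      by (rule compare_first_order[OF low1[OF Q] up2[of Q, folded E]])
    show "first_order_value J a' A' K' Q \<le> first_order_value J a A K Q"
      by (rule compare_first_order[OF low2[OF Q] up1[of Q, unfolded E]])
  qed
  obtain Q0 where Q0: "Q0 \<noteq> 0" "\<And>u. u \<in> K ` J \<union> K' ` J \<Longrightarrow> u \<bullet> Q0 \<noteq> 0"
    by (rule nonresonant_direction_exists[of "K ` J \<union> K' ` J"]) (use finJ K0 in auto)
  then have "first_order_value J a A K Q0 = a" "first_order_value J a' A' K' Q0 = a'"
    unfolding first_order_value_def by auto
  with val[OF Q0(1)] show aa: "a = a'" by simp
  show "\<forall>j\<in>J. \<exists>i\<in>J. det2 (K j) (K' i) = 0 \<and> A' i = A j"
  proof
    fix j assume j: "j \<in> J"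
    define Q where "Q = rot2 (K j)"
    have Q: "Q \<noteq> 0" using K0(1)[OF j] by (simp add: Q_def rot2_nonzero)
    have "K t \<bullet> Q = 0 \<longleftrightarrow> t = j" if "t \<in> J" for t
      using nonpar(1)[OF j that] unfolding Q_def inner_rot2 by (auto simp: det2_def)
    then have "(\<Sum>t\<in>J. if K t \<bullet> Q = 0 then A t else 0) = (\<Sum>t\<in>J. if t = j then A t else 0)"
      by (intro sum.cong) auto
    then have s: "(\<Sum>t\<in>J. if K' t \<bullet> Q = 0 then A' t else 0) = A j"
      using val[OF Q] j finJ aa by (simp add: first_order_value_def)
    have "\<exists>i\<in>J. K' i \<bullet> Q = 0"
    proof (rule ccontr)
      assume "\<not> ?thesis"
      then have "(\<Sum>t\<in>J. if K' t \<bullet> Q = 0 then A' t else 0) = 0" by simp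
      then show False using s A(1)[OF j] by simp
    qed
    then obtain i where i: "i \<in> J" "K' i \<bullet> Q = 0" by blast
    have "K' t \<bullet> Q = 0 \<longleftrightarrow> t = i" if "t \<in> J" for t
      using nonpar(2)[OF that i(1)] orthogonal_imp_det2_zero[of "K' t" Q "K' i"] i Q by auto
    then have "(\<Sum>t\<in>J. if K' t \<bullet> Q = 0 then A' t else 0) = (\<Sum>t\<in>J. if t = i then A' t else 0)"
      by (intro sum.cong) auto
    then have "A' i = A j" using s i finJ by simp
    moreover have "det2 (K j) (K' i) = 0" using i(2) by (simp add: Q_def inner_rot2)
    ultimately show "\<exists>i\<in>J. det2 (K j) (K' i) = 0 \<and> A' i = A j" using i by blast
  qed
qed

section \<open>Phases of the modes\<close>

lemma det2_relation: "det2 v w *\<^sub>R u + det2 w u *\<^sub>R v + det2 u v *\<^sub>R w = 0"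
  by (simp add: vec2_eq_iff det2_def algebra_simps)

lemma primitive_relation:
  fixes u v w :: "real ^ 2"
  assumes int: "\<And>i. u $ i \<in> \<int>" "\<And>i. v $ i \<in> \<int>" "\<And>i. w $ i \<in> \<int>"
    and np: "det2 u v \<noteq> 0" "det2 v w \<noteq> 0" "det2 w u \<noteq> 0"
  obtains x y z x' y' z' :: int where "of_int x *\<^sub>R u + of_int y *\<^sub>R v + of_int z *\<^sub>R w = 0"
    "x \<noteq> 0" "y \<noteq> 0" "z \<noteq> 0" "x' * x + y' * y + z' * z = 1"
proof -
  have "det2 v w \<in> \<int>" "det2 w u \<in> \<int>" "det2 u v \<in> \<int>" unfolding det2_def using int by auto
  then obtain d1 d2 d3 :: int where d: "det2 v w = of_int d1" "det2 w u = of_int d2" "det2 u v = of_int d3"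
    by (metis Ints_cases)
  define g where "g = gcd (gcd d1 d2) d3"
  have d0: "d1 \<noteq> 0" "d2 \<noteq> 0" "d3 \<noteq> 0" using np d by auto
  have g: "g \<noteq> 0" using d0 by (simp add: g_def)
  obtain x y z where xyz: "d1 = g * x" "d2 = g * y" "d3 = g * z"
    unfolding g_def by (meson dvdE gcd_dvd1 gcd_dvd2 dvd_trans)
  obtain p q where pq: "p * d1 + q * d2 = gcd d1 d2" using bezout_int by blast
  obtain r s where rs: "r * gcd d1 d2 + s * d3 = g" using bezout_int unfolding g_def by blast
  have "g * (r * p * x + r * q * y + s * z) = g * 1"
    using rs unfolding pq[symmetric] unfolding xyz(1) xyz(2) xyz(3) by (simp add: algebra_simps)
  then have b: "r * p * x + r * q * y + s * z = 1" using g by simp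
  have "of_int g *\<^sub>R (of_int x *\<^sub>R u + of_int y *\<^sub>R v + of_int z *\<^sub>R w) = 0"
    using det2_relation[of v w u] unfolding d xyz by (simp add: scaleR_add_right)
  then have "of_int x *\<^sub>R u + of_int y *\<^sub>R v + of_int z *\<^sub>R w = 0" using g by simp
  then show thesis using that[of x y z "r * p" "r * q" s] b d0 xyz by auto
qed

text \<open>
  A translation by \<open>X\<close> adds \<open>2 pi u \<bullet> X\<close>, \<open>2 pi v \<bullet> X\<close>, \<open>2 pi w \<bullet> X\<close> to the phases, and these triples fill
  the plane on which the combination with coefficients \<open>x\<close>, \<open>y\<close>, \<open>z\<close> vanishes. As the relation is primitive, integer multiples of
  \<open>2 pi\<close> move any combination in \<open>2 pi \<int>\<close> to 0.
\<close>

lemma phases_realizable: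
  fixes u v w :: "real ^ 2" and x y z x' y' z' N :: int
  assumes rel: "of_int x *\<^sub>R u + of_int y *\<^sub>R v + of_int z *\<^sub>R w = 0" "z \<noteq> 0"
    and bezout: "x' * x + y' * y + z' * z = 1" and np: "det2 u v \<noteq> 0"
    and sum: "of_int x * \<alpha> + of_int y * \<beta> + of_int z * \<gamma> = 2 * pi * of_int N"
  shows "\<exists>X n1 n2 n3. 2 * pi * (u \<bullet> X) = \<alpha> + 2 * pi * of_int n1 \<and> 2 * pi * (v \<bullet> X) = \<beta> + 2 * pi * of_int n2
    \<and> 2 * pi * (w \<bullet> X) = \<gamma> + 2 * pi * of_int n3"
proof -
  define \<alpha>' where "\<alpha>' = \<alpha> + 2 * pi * of_int (- N * x')"
  define \<beta>' where "\<beta>' = \<beta> + 2 * pi * of_int (- N * y')"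
  define \<gamma>' where "\<gamma>' = \<gamma> + 2 * pi * of_int (- N * z')"
  have b: "real_of_int x' * of_int x + of_int y' * of_int y + of_int z' * of_int z = 1"
    using bezout by (metis of_int_add of_int_mult of_int_1)
  have s0: "of_int x * \<alpha>' + of_int y * \<beta>' + of_int z * \<gamma>' = 0"
  proof -
    have "of_int x * \<alpha>' + of_int y * \<beta>' + of_int z * \<gamma>' = (of_int x * \<alpha> + of_int y * \<beta> + of_int z * \<gamma>)
      - 2 * pi * of_int N * (real_of_int x' * of_int x + of_int y' * of_int y + of_int z' * of_int z)"
      unfolding \<alpha>'_def \<beta>'_def \<gamma>'_def by (simp add: algebra_simps)
    then show ?thesis unfolding b sum by simp
  qed
  define X :: "real ^ 2" where "X = (1 / (2 * pi * det2 u v)) *\<^sub>R vector [\<alpha>' * v $ 2 - \<beta>' * u $ 2, \<beta>' * u $ 1 - \<alpha>' * v $ 1]"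
  have uX: "2 * pi * (u \<bullet> X) = \<alpha>'"
  proof -
    have "2 * pi * (u \<bullet> X) = (u $ 1 * (\<alpha>' * v $ 2 - \<beta>' * u $ 2) + u $ 2 * (\<beta>' * u $ 1 - \<alpha>' * v $ 1)) / det2 u v"
      unfolding X_def inner_scaleR_right by (simp add: inner_vec2)
    also have "u $ 1 * (\<alpha>' * v $ 2 - \<beta>' * u $ 2) + u $ 2 * (\<beta>' * u $ 1 - \<alpha>' * v $ 1) = \<alpha>' * det2 u v"
      by (simp add: det2_def algebra_simps)
    finally show ?thesis using np by simp
  qed
  have vX: "2 * pi * (v \<bullet> X) = \<beta>'"
  proof -
    have "2 * pi * (v \<bullet> X) = (v $ 1 * (\<alpha>' * v $ 2 - \<beta>' * u $ 2) + v $ 2 * (\<beta>' * u $ 1 - \<alpha>' * v $ 1)) / det2 u v"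
      unfolding X_def inner_scaleR_right by (simp add: inner_vec2)
    also have "v $ 1 * (\<alpha>' * v $ 2 - \<beta>' * u $ 2) + v $ 2 * (\<beta>' * u $ 1 - \<alpha>' * v $ 1) = \<beta>' * det2 u v"
      by (simp add: det2_def algebra_simps)
    finally show ?thesis using np by simp
  qed
  have wX: "2 * pi * (w \<bullet> X) = \<gamma>'"
  proof -
    have "(of_int x *\<^sub>R u + of_int y *\<^sub>R v + of_int z *\<^sub>R w) \<bullet> X = 0" using rel(1) by simp
    then have "2 * pi * (of_int x * (u \<bullet> X) + of_int y * (v \<bullet> X) + of_int z * (w \<bullet> X)) = 0"
      by (simp only: inner_add_left inner_scaleR_left)
    then have "of_int x * (2 * pi * (u \<bullet> X)) + of_int y * (2 * pi * (v \<bullet> X)) + of_int z * (2 * pi * (w \<bullet> X)) = 0"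
      by (simp add: algebra_simps)
    then have "of_int z * (2 * pi * (w \<bullet> X)) = of_int z * \<gamma>'" using s0 unfolding uX vX by linarith
    then show ?thesis using rel(2) by simp
  qed
  show ?thesis using uX vX wX unfolding \<alpha>'_def \<beta>'_def \<gamma>'_def by blast
qed

text \<open>
  The representative modulo \<open>2 pi\<close> of least modulus.
\<close>

definition reduced :: "real \<Rightarrow> real" where
  "reduced t = t - 2 * pi * of_int (round (t / (2 * pi)))"

lemma abs_reduced_le: "\<bar>reduced t\<bar> \<le> \<bar>t + 2 * pi * of_int n\<bar>"
proof -
  have e: "t + 2 * pi * of_int n = 2 * pi * (t / (2 * pi) - of_int (- n))" for n
    by (simp add: field_simps)
  have "\<bar>t / (2 * pi) - of_int (round (t / (2 * pi)))\<bar> \<le> \<bar>t / (2 * pi) - of_int (- n)\<bar>"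
    by (rule round_diff_minimal)
  then have "2 * pi * \<bar>t / (2 * pi) - of_int (round (t / (2 * pi)))\<bar> \<le> 2 * pi * \<bar>t / (2 * pi) - of_int (- n)\<bar>"
    by (intro mult_left_mono) auto
  then show ?thesis
    using e[of "- round (t / (2 * pi))"] e[of n] by (simp add: reduced_def abs_mult)
qed

lemma abs_reduced_le_pi: "\<bar>reduced t\<bar> \<le> pi"
proof -
  have "\<bar>of_int (round (t / (2 * pi))) - t / (2 * pi)\<bar> \<le> 1/2" by (rule of_int_round_abs_le)
  then have "2 * pi * \<bar>of_int (round (t / (2 * pi))) - t / (2 * pi)\<bar> \<le> 2 * pi * (1/2)"
    by (intro mult_left_mono) auto
  moreover have "2 * pi * \<bar>of_int (round (t / (2 * pi))) - t / (2 * pi)\<bar> = \<bar>reduced t\<bar>"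
  proof -
    have "- reduced t = 2 * pi * (of_int (round (t / (2 * pi))) - t / (2 * pi))"
      by (simp add: reduced_def field_simps)
    then have "\<bar>- reduced t\<bar> = 2 * pi * \<bar>of_int (round (t / (2 * pi))) - t / (2 * pi)\<bar>"
      by (simp only: abs_mult) simp
    then show ?thesis by simp
  qed
  ultimately show ?thesis by simp
qed

lemma cos_reduced: "cos (reduced t) = cos t"
  using trig_shift_integer(2)[of "- of_int (round (t / (2 * pi)))" t] by (simp add: reduced_def)

lemma cos_scaled_le:
  assumes "\<bar>r\<bar> < 1" "\<bar>t\<bar> \<le> pi"
  shows "cos t \<le> cos (r * t)" "t \<noteq> 0 \<Longrightarrow> cos t < cos (r * t)"
proof -
  show lt: "cos t < cos (r * t)" if "t \<noteq> 0"
  proof -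
    have "\<bar>r * t\<bar> < \<bar>t\<bar>" using assms that by (simp add: abs_mult)
    then have "cos \<bar>t\<bar> < cos \<bar>r * t\<bar>" using assms by (intro cos_monotone_0_pi) auto
    then show ?thesis by simp
  qed
  then show "cos t \<le> cos (r * t)" by (cases "t = 0") (auto simp: less_imp_le)
qed

text \<open>
  Let \<open>\<phi> j\<close>, of modulus at most \<open>pi\<close>, be the phases of the second potential at a maximum point and \<open>P\<close> their combination, so
  \<open>\<bar>P\<bar>\<close> is at least the second of the compared moduli. The phases \<open>r * \<phi> j\<close> with \<open>r = reduced T / P\<close>, of modulus less than 1, are attained by
  the first potential, and there every cosine is at least as large, one of them strictly.
\<close>

lemma maximum_decreases_with_phase:
  fixes K :: "nat \<Rightarrow> real ^ 2" and x y z x' y' z' :: int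
  assumes tp: "trig_potential {1, 2, 3} K"
    and A: "\<And>t. t \<in> {1, 2, 3} \<Longrightarrow> A t > 0"
    and rel: "of_int x *\<^sub>R K 1 + of_int y *\<^sub>R K 2 + of_int z *\<^sub>R K 3 = 0" "z \<noteq> 0"
    and bezout: "x' * x + y' * y + z' * z = 1" and np: "det2 (K 1) (K 2) \<noteq> 0"
    and less: "\<bar>reduced (of_int x * \<theta> 1 + of_int y * \<theta> 2 + of_int z * \<theta> 3)\<bar>
      < \<bar>reduced (of_int x * \<theta>' 1 + of_int y * \<theta>' 2 + of_int z * \<theta>' 3)\<bar>"
  shows "\<exists>X. \<forall>Y. trig_potential.pot {1, 2, 3} a A \<theta>' K Y < trig_potential.pot {1, 2, 3} a A \<theta> K X"
proof -
  interpret p: trig_potential "{1, 2, 3}" a A \<theta> K by (rule tp)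
  interpret p': trig_potential "{1, 2, 3}" a A \<theta>' K by (rule tp)
  obtain X' where X': "\<And>Y. p'.pot Y \<le> p'.pot X'"
    by (rule int_periodic_attains_max[OF p'.pot_periodic p'.pot_continuous]) blast
  define \<phi> where "\<phi> j = reduced (p'.phase j X')" for j
  have \<phi>: "\<bar>\<phi> j\<bar> \<le> pi" "cos (\<phi> j) = cos (p'.phase j X')" for j
    by (simp_all add: \<phi>_def abs_reduced_le_pi cos_reduced)
  define T where "T = of_int x * \<theta> 1 + of_int y * \<theta> 2 + of_int z * \<theta> 3"
  define T' where "T' = of_int x * \<theta>' 1 + of_int y * \<theta>' 2 + of_int z * \<theta>' 3"
  define P where "P = of_int x * \<phi> 1 + of_int y * \<phi> 2 + of_int z * \<phi> 3"
  have phT': "of_int x * p'.phase 1 X' + of_int y * p'.phase 2 X' + of_int z * p'.phase 3 X' = T'"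
  proof -
    have "(of_int x *\<^sub>R K 1 + of_int y *\<^sub>R K 2 + of_int z *\<^sub>R K 3) \<bullet> X' = 0" using rel(1) by simp
    then have "of_int x * (K 1 \<bullet> X') + of_int y * (K 2 \<bullet> X') + of_int z * (K 3 \<bullet> X') = 0"
      by (simp only: inner_add_left inner_scaleR_left)
    then have "2 * pi * (of_int x * (K 1 \<bullet> X') + of_int y * (K 2 \<bullet> X') + of_int z * (K 3 \<bullet> X')) = 0" by simp
    then show ?thesis unfolding T'_def p'.phase_def by (simp add: algebra_simps)
  qed
  define M where "M = - (x * round (p'.phase 1 X' / (2 * pi)) + y * round (p'.phase 2 X' / (2 * pi)) + z * round (p'.phase 3 X' / (2 * pi)))"
  have "P = T' + 2 * pi * of_int M"
    unfolding P_def \<phi>_def reduced_def M_def phT'[symmetric] by (simp add: algebra_simps)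
  then have "\<bar>reduced T'\<bar> \<le> \<bar>P\<bar>" using abs_reduced_le by metis
  then have TP: "\<bar>reduced T\<bar> < \<bar>P\<bar>" using less unfolding T_def T'_def by linarith
  then have P0: "P \<noteq> 0" by auto
  define r where "r = reduced T / P"
  have r: "\<bar>r\<bar> < 1" "r * P = reduced T" using TP P0 by (simp_all add: r_def abs_divide)
  define N where "N = - round (T / (2 * pi))"
  have "of_int x * (r * \<phi> 1 - \<theta> 1) + of_int y * (r * \<phi> 2 - \<theta> 2) + of_int z * (r * \<phi> 3 - \<theta> 3) = r * P - T"
    unfolding P_def T_def by (simp add: algebra_simps)
  also have "\<dots> = 2 * pi * of_int N" unfolding r(2) by (simp add: reduced_def N_def)
  finally obtain X n1 n2 n3 where X: "2 * pi * (K 1 \<bullet> X) = (r * \<phi> 1 - \<theta> 1) + 2 * pi * of_int n1"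
    "2 * pi * (K 2 \<bullet> X) = (r * \<phi> 2 - \<theta> 2) + 2 * pi * of_int n2"
    "2 * pi * (K 3 \<bullet> X) = (r * \<phi> 3 - \<theta> 3) + 2 * pi * of_int n3"
    using phases_realizable[OF rel bezout np] by blast
  have cX: "cos (p.phase j X) = cos (r * \<phi> j)" if "j \<in> {1, 2, 3}" for j
  proof -
    have "p.phase 1 X = r * \<phi> 1 + 2 * pi * of_int n1" "p.phase 2 X = r * \<phi> 2 + 2 * pi * of_int n2"
      "p.phase 3 X = r * \<phi> 3 + 2 * pi * of_int n3"
      unfolding p.phase_def X by simp_all
    then have "cos (p.phase 1 X) = cos (r * \<phi> 1)" "cos (p.phase 2 X) = cos (r * \<phi> 2)" "cos (p.phase 3 X) = cos (r * \<phi> 3)"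
      by (simp_all only: trig_shift_integer(2)[OF Ints_of_int])
    then show ?thesis using that by blast
  qed
  have "(\<Sum>j\<in>{1, 2, 3}. A j * cos (p'.phase j X')) < (\<Sum>j\<in>{1, 2, 3}. A j * cos (p.phase j X))"
  proof (rule sum_strict_mono_ex1)
    show "\<forall>j\<in>{1, 2, 3}. A j * cos (p'.phase j X') \<le> A j * cos (p.phase j X)"
    proof
      fix j :: nat assume j: "j \<in> {1, 2, 3}"
      show "A j * cos (p'.phase j X') \<le> A j * cos (p.phase j X)"
        unfolding cX[OF j] \<phi>(2)[symmetric] using cos_scaled_le(1)[OF r(1) \<phi>(1)] A[OF j]
        by (intro mult_left_mono) auto
    qed
    have "\<phi> 1 \<noteq> 0 \<or> \<phi> 2 \<noteq> 0 \<or> \<phi> 3 \<noteq> 0" using P0 unfolding P_def by auto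
    then obtain j where j: "j \<in> {1, 2, 3}" "\<phi> j \<noteq> 0" by auto
    have "A j * cos (p'.phase j X') < A j * cos (p.phase j X)"
      unfolding cX[OF j(1)] \<phi>(2)[symmetric] using cos_scaled_le(2)[OF r(1) \<phi>(1) j(2)] A[OF j(1)] by simp
    then show "\<exists>j\<in>{1, 2, 3}. A j * cos (p'.phase j X') < A j * cos (p.phase j X)" using j by blast
  qed simp
  then have "p'.pot X' < p.pot X" unfolding p.pot_def p'.pot_def by simp
  then have "\<forall>Y. p'.pot Y < p.pot X" using X' order_le_less_trans by blast
  then show ?thesis by blast
qed

text \<open>
  The zero corrector gives the upper bound and \<open>cell_constant_zero_ge\<close> the lower one: the value at 0 is the maximum of
  the potential.
\<close>

lemma effective_Hamiltonian_zero_bound: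
  fixes V :: "real ^ 'n \<Rightarrow> real"
  assumes V: "continuous_on UNIV V" "int_periodic V"
  shows "effective_Hamiltonian V 0 \<le> C \<longleftrightarrow> (\<forall>x. V x \<le> C)"
proof -
  obtain v where v: "cell_solution V 0 (effective_Hamiltonian V 0) v"
    by (rule effective_Hamiltonian_cell_solution[OF V])
  show ?thesis
  proof
    show "\<forall>x. V x \<le> C" if "effective_Hamiltonian V 0 \<le> C"
      using cell_constant_zero_ge[OF v V(1)] that order_trans by blast
    assume C: "\<forall>x. V x \<le> C"
    show "effective_Hamiltonian V 0 \<le> C"
      by (rule cell_constant_le[OF v, of "\<lambda>x. 0" "\<lambda>x. 0"])
        (use C C1_boundedD[OF C1_bounded_const[of 0]] in \<open>auto simp: int_periodic_def\<close>)
  qed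
qed

lemma complex_mode_eq_cos:
  "z * exp (\<i> * complex_of_real t) + cnj z * exp (- \<i> * complex_of_real t) =
    complex_of_real (2 * cmod z * cos (t + Arg z))"
proof -
  have e: "exp (- \<i> * complex_of_real t) = cnj (exp (\<i> * complex_of_real t))"
    by (simp add: exp_cnj)
  have sum: "z * exp (\<i> * complex_of_real t) + cnj z * exp (- \<i> * complex_of_real t) =
      complex_of_real (2 * Re (z * exp (\<i> * complex_of_real t)))"
    unfolding e using complex_add_cnj[of "z * exp (\<i> * complex_of_real t)"] by simp
  have "z * exp (\<i> * complex_of_real t) = rcis (cmod z) (Arg z) * rcis 1 t"
    by (simp only: rcis_cmod_Arg) (simp add: cis_conv_exp rcis_def)
  also have "\<dots> = rcis (cmod z) (t + Arg z)" by (simp add: rcis_mult add.commute)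
  finally have "Re (z * exp (\<i> * complex_of_real t)) = cmod z * cos (t + Arg z)" by (simp add: rcis_def)
  then show ?thesis unfolding sum by (simp add: mult.assoc)
qed

section \<open>Rigidity\<close>

text \<open>
  Equal maxima force the phase combinations of the two potentials to agree up to the sign \<open>\<sigma>\<close>
  modulo \<open>2 pi\<close>; for \<open>\<sigma> = -1\<close> a reflection is used besides the translation.
\<close>

lemma translation_from_phases:
  fixes K :: "nat \<Rightarrow> real ^ 2"
  defines "J \<equiv> {1, 2, 3 :: nat}"
  assumes tp: "trig_potential J K" "trig_potential J (\<lambda>t. c *\<^sub>R K t)" and c: "c > 0"
    and A: "\<And>t. t \<in> J \<Longrightarrow> A t > 0"
    and nonpar: "\<And>t u. t \<in> J \<Longrightarrow> u \<in> J \<Longrightarrow> t \<noteq> u \<Longrightarrow> det2 (K t) (K u) \<noteq> 0"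
    and E: "trig_Hbar J a A \<theta> K 0 =
        trig_Hbar J a A \<theta>' (\<lambda>t. c *\<^sub>R K t) 0"
  shows "\<exists>c' x0. (c' = c \<or> c' = - c) \<and>
    (\<forall>x. trig_potential.pot J a A \<theta> K x = trig_potential.pot J a A \<theta>' (\<lambda>t. c *\<^sub>R K t) (x /\<^sub>R c' + x0))"
proof -
  interpret p: trig_potential J a A \<theta> K by (rule tp)
  interpret p': trig_potential J a A \<theta>' K by (rule tp)
  interpret q: trig_potential J a A \<theta>' "\<lambda>t. c *\<^sub>R K t" by (rule tp)
  have q: "q.pot x = p'.pot (c *\<^sub>R x)" for x
    by (simp add: q.pot_def q.phase_def p'.pot_def p'.phase_def)
  have J: "1 \<in> J" "2 \<in> J" "3 \<in> J" by (auto simp: J_def)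
  obtain x y z x' y' z' :: int where rel: "of_int x *\<^sub>R K 1 + of_int y *\<^sub>R K 2 + of_int z *\<^sub>R K 3 = 0"
    and nz: "z \<noteq> 0" and bezout: "x' * x + y' * y + z' * z = 1"
    by (rule primitive_relation[of "K 1" "K 2" "K 3"]) (use p.Kint J nonpar in auto)
  have np: "det2 (K 1) (K 2) \<noteq> 0" using nonpar J by simp
  have max: "(\<forall>x. p.pot x \<le> C) \<longleftrightarrow> (\<forall>x. p'.pot x \<le> C)" for C
  proof -
    have "(\<forall>x. p.pot x \<le> C) \<longleftrightarrow> (\<forall>x. q.pot x \<le> C)"
      using effective_Hamiltonian_zero_bound[OF p.pot_continuous p.pot_periodic, of C]
        effective_Hamiltonian_zero_bound[OF q.pot_continuous q.pot_periodic, of C] E by simp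
    also have "\<dots> \<longleftrightarrow> (\<forall>x. p'.pot x \<le> C)"
    proof
      assume "\<forall>x. q.pot x \<le> C"
      then have "p'.pot (c *\<^sub>R (x /\<^sub>R c)) \<le> C" for x unfolding q by blast
      then show "\<forall>x. p'.pot x \<le> C" using c by simp
    qed (simp add: q)
    finally show ?thesis .
  qed
  define T where "T = of_int x * \<theta> 1 + of_int y * \<theta> 2 + of_int z * \<theta> 3"
  define T' where "T' = of_int x * \<theta>' 1 + of_int y * \<theta>' 2 + of_int z * \<theta>' 3"
  have "\<not> \<bar>reduced T\<bar> < \<bar>reduced T'\<bar>"
  proof
    assume "\<bar>reduced T\<bar> < \<bar>reduced T'\<bar>"
    then obtain X where X: "\<And>Y. p'.pot Y < p.pot X"
      using maximum_decreases_with_phase[OF tp(1)[unfolded J_def] _ rel nz bezout np, of A \<theta> \<theta>' a] A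
      unfolding T_def T'_def J_def by blast
    obtain X' where X': "\<And>Y. p.pot Y \<le> p.pot X'"
      by (rule int_periodic_attains_max[OF p.pot_periodic p.pot_continuous]) blast
    obtain Y' where Y': "\<And>Y. p'.pot Y \<le> p'.pot Y'"
      by (rule int_periodic_attains_max[OF p'.pot_periodic p'.pot_continuous]) blast
    have "p.pot X \<le> p'.pot Y'" using max[of "p'.pot Y'"] Y' by blast
    then show False using X[of Y'] by linarith
  qed
  moreover have "\<not> \<bar>reduced T'\<bar> < \<bar>reduced T\<bar>"
  proof
    assume "\<bar>reduced T'\<bar> < \<bar>reduced T\<bar>"
    then obtain X where X: "\<And>Y. p.pot Y < p'.pot X"
      using maximum_decreases_with_phase[OF tp(1)[unfolded J_def] _ rel nz bezout np, of A \<theta>' \<theta> a] A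
      unfolding T_def T'_def J_def by blast
    obtain Y' where Y': "\<And>Y. p.pot Y \<le> p.pot Y'"
      by (rule int_periodic_attains_max[OF p.pot_periodic p.pot_continuous]) blast
    have "p'.pot X \<le> p.pot Y'" using max[of "p.pot Y'"] Y' by blast
    then show False using X[of Y'] by linarith
  qed
  ultimately have "reduced T = reduced T' \<or> reduced T = - reduced T'" by linarith
  then have "\<exists>\<sigma> :: real. (\<sigma> = 1 \<or> \<sigma> = -1) \<and> (\<exists>N :: int. \<sigma> * T - T' = 2 * pi * of_int N)"
  proof
    assume "reduced T = reduced T'"
    then have "1 * T - T' = 2 * pi * of_int (round (T / (2 * pi)) - round (T' / (2 * pi)))"
      by (simp add: reduced_def algebra_simps)
    then show ?thesis by blast
  next
    assume "reduced T = - reduced T'"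
    then have "- 1 * T - T' = 2 * pi * of_int (- round (T / (2 * pi)) - round (T' / (2 * pi)))"
      by (simp add: reduced_def algebra_simps)
    then show ?thesis by blast
  qed
  then obtain \<sigma> :: real and N :: int where \<sigma>: "\<sigma> = 1 \<or> \<sigma> = -1" and N: "\<sigma> * T - T' = 2 * pi * of_int N" by blast
  have "of_int x * (\<sigma> * \<theta> 1 - \<theta>' 1) + of_int y * (\<sigma> * \<theta> 2 - \<theta>' 2) + of_int z * (\<sigma> * \<theta> 3 - \<theta>' 3) = 2 * pi * of_int N"
    unfolding N[symmetric] T_def T'_def by (simp add: algebra_simps)
  then obtain X n1 n2 n3 where X: "2 * pi * (K 1 \<bullet> X) = (\<sigma> * \<theta> 1 - \<theta>' 1) + 2 * pi * of_int n1"
    "2 * pi * (K 2 \<bullet> X) = (\<sigma> * \<theta> 2 - \<theta>' 2) + 2 * pi * of_int n2"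
    "2 * pi * (K 3 \<bullet> X) = (\<sigma> * \<theta> 3 - \<theta>' 3) + 2 * pi * of_int n3"
    using phases_realizable[OF rel nz bezout np] by blast
  have cos_\<sigma>: "cos (\<sigma> * t) = cos t" for t using \<sigma> by auto
  have ph: "cos (p.phase j u) = cos (p'.phase j (\<sigma> *\<^sub>R u + X))" if "j \<in> J" for j u
  proof -
    have e: "p'.phase j (\<sigma> *\<^sub>R u + X) = \<sigma> * p.phase j u + (2 * pi * (K j \<bullet> X) - (\<sigma> * \<theta> j - \<theta>' j))" for j
      unfolding p.phase_def p'.phase_def by (simp add: inner_add_right algebra_simps)
    have "p'.phase 1 (\<sigma> *\<^sub>R u + X) = \<sigma> * p.phase 1 u + 2 * pi * of_int n1"
      "p'.phase 2 (\<sigma> *\<^sub>R u + X) = \<sigma> * p.phase 2 u + 2 * pi * of_int n2"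
      "p'.phase 3 (\<sigma> *\<^sub>R u + X) = \<sigma> * p.phase 3 u + 2 * pi * of_int n3"
      unfolding e X by simp_all
    then have "cos (p'.phase 1 (\<sigma> *\<^sub>R u + X)) = cos (p.phase 1 u)"
      "cos (p'.phase 2 (\<sigma> *\<^sub>R u + X)) = cos (p.phase 2 u)" "cos (p'.phase 3 (\<sigma> *\<^sub>R u + X)) = cos (p.phase 3 u)"
      by (simp_all only: trig_shift_integer(2)[OF Ints_of_int] cos_\<sigma>)
    then show ?thesis using that unfolding J_def by auto
  qed
  have "p.pot u = q.pot (u /\<^sub>R (\<sigma> * c) + X /\<^sub>R c)" for u
  proof -
    have "c *\<^sub>R (u /\<^sub>R (\<sigma> * c) + X /\<^sub>R c) = \<sigma> *\<^sub>R u + X"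
      using c \<sigma> by (auto simp: scaleR_add_right)
    then show ?thesis unfolding q p.pot_def p'.pot_def using ph by simp
  qed
  moreover have "\<sigma> * c = c \<or> \<sigma> * c = - c" using \<sigma> by auto
  ultimately show ?thesis by blast
qed

text \<open>
  The frequencies \<open>K\<close> are given signs so that they satisfy a relation with positive coefficients. The
  modes of the second potential are permuted and given signs so that their frequencies are positive
  multiples \<open>\<nu> j\<close> of these. Since the cosine is even, the signs pass to the phases.
\<close>

lemma trig_potential_rigidity:
  fixes K K' :: "nat \<Rightarrow> real ^ 2"
  defines "J \<equiv> {1, 2, 3 :: nat}"
  assumes tp: "trig_potential J K" "trig_potential J K'"
    and A: "\<And>t. t \<in> J \<Longrightarrow> A t > 0" "\<And>t. t \<in> J \<Longrightarrow> A' t > 0"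
    and nonpar: "\<And>t u. t \<in> J \<Longrightarrow> u \<in> J \<Longrightarrow> t \<noteq> u \<Longrightarrow> det2 (K t) (K u) \<noteq> 0"
      "\<And>t u. t \<in> J \<Longrightarrow> u \<in> J \<Longrightarrow> t \<noteq> u \<Longrightarrow> det2 (K' t) (K' u) \<noteq> 0"
    and E: "\<And>p. trig_Hbar J a A \<theta> K p =
        trig_Hbar J a' A' \<theta>' K' p"
  shows "\<exists>c x0. c \<in> \<rat> \<and> c \<noteq> 0 \<and>
    (\<forall>x. trig_potential.pot J a A \<theta> K x = trig_potential.pot J a' A' \<theta>' K' (x /\<^sub>R c + x0))"
proof -
  interpret p: trig_potential J a A \<theta> K by (rule tp)
  interpret p': trig_potential J a' A' \<theta>' K' by (rule tp)
  have J: "1 \<in> J" "2 \<in> J" "3 \<in> J" by (auto simp: J_def)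
  have K0: "K t \<noteq> 0" "K' t \<noteq> 0" if "t \<in> J" for t
  proof -
    obtain u where "u \<in> J" "t \<noteq> u" using J by (metis numeral_eq_one_iff semiring_norm(85))
    then show "K t \<noteq> 0" "K' t \<noteq> 0" using nonpar[OF that] by (auto simp: det2_def)
  qed
  have aa: "a = a'"
    by (rule first_order_match(1)[OF tp _ _ _ _ _ _ E]) (use A K0 nonpar in blast)+
  have "\<forall>j\<in>J. \<exists>i\<in>J. det2 (K j) (K' i) = 0 \<and> A' i = A j"
    by (rule first_order_match(2)[OF tp _ _ _ _ _ _ E]) (use A K0 nonpar in blast)+
  then obtain \<pi> where \<pi>: "\<And>j. j \<in> J \<Longrightarrow> \<pi> j \<in> J" "\<And>j. j \<in> J \<Longrightarrow> det2 (K j) (K' (\<pi> j)) = 0"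
    "\<And>j. j \<in> J \<Longrightarrow> A' (\<pi> j) = A j"
    by metis
  have "\<exists>r. K' (\<pi> j) = r *\<^sub>R K j" if "j \<in> J" for j
    by (rule det2_zero_imp_scale[OF \<pi>(2)[OF that] K0(1)[OF that]]) blast
  then obtain r0 where r0: "\<And>j. j \<in> J \<Longrightarrow> K' (\<pi> j) = r0 j *\<^sub>R K j" by metis
  have r0z: "r0 j \<noteq> 0" if "j \<in> J" for j using r0[OF that] K0(2)[OF \<pi>(1)[OF that]] by auto
  have inj: "inj_on \<pi> J"
  proof (rule inj_onI, rule ccontr)
    fix t u assume tu: "t \<in> J" "u \<in> J" "\<pi> t = \<pi> u" "t \<noteq> u"
    have "det2 (K t) (r0 u *\<^sub>R K u) = 0" using \<pi>(2)[OF tu(1)] r0[OF tu(2)] tu(3) by simp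
    then have "r0 u * det2 (K t) (K u) = 0" by (simp add: det2_def algebra_simps)
    then show False using nonpar(1)[OF tu(1,2,4)] r0z[OF tu(2)] by simp
  qed
  have bij: "bij_betw \<pi> J J"
    using endo_inj_surj[OF p.finJ _ inj] \<pi>(1) inj unfolding bij_betw_def by blast
  \<comment> \<open>By \<open>det2_relation\<close> these are the coefficients of a linear relation between the frequencies.\<close>
  define D where "D = (\<lambda>j :: nat. if j = 1 then det2 (K 2) (K 3) else if j = 2 then det2 (K 3) (K 1) else det2 (K 1) (K 2))"
  have D0: "D j \<noteq> 0" for j using nonpar(1) J unfolding D_def by auto
  define \<epsilon> where "\<epsilon> j = sgn (D j)" for j
  have \<epsilon>: "\<epsilon> j = 1 \<or> \<epsilon> j = -1" "\<bar>D j\<bar> * \<epsilon> j = D j" for j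
    using D0[of j] by (auto simp: \<epsilon>_def sgn_if)
  define L where "L j = \<epsilon> j *\<^sub>R K j" for j
  define r where "r j = (if j \<in> J then r0 j * \<epsilon> j else 1)" for j
  have rz: "r j \<noteq> 0" for j using r0z \<epsilon>(1)[of j] by (auto simp: r_def)
  have rL: "K' (\<pi> j) = r j *\<^sub>R L j" if "j \<in> J" for j
    using r0[OF that] that \<epsilon>(1)[of j] by (auto simp: r_def L_def)
  define \<nu> where "\<nu> j = \<bar>r j\<bar>" for j
  have \<nu>: "\<nu> j > 0" for j using rz by (simp add: \<nu>_def)
  define \<tau> where "\<tau> j = sgn (r j)" for j
  have \<tau>: "\<tau> j = 1 \<or> \<tau> j = -1" "r j = \<tau> j * \<nu> j" for j
    using rz[of j] by (auto simp: \<tau>_def \<nu>_def sgn_if)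
  define \<alpha> where "\<alpha> j = \<epsilon> j * \<theta> j" for j
  define \<beta> where "\<beta> j = \<tau> j * \<theta>' (\<pi> j)" for j
  have sign_cos: "cos (s * t) = cos t" if "s = 1 \<or> s = -1" for s t :: real using that by auto
  have tpL: "trig_potential J L"
    unfolding trig_potential_def
  proof (intro conjI allI impI p.finJ)
    fix j i assume j: "j \<in> J"
    show "L j $ i \<in> \<int>" using p.Kint[OF j, of i] \<epsilon>(1)[of j] by (auto simp: L_def)
  qed
  have tpN: "trig_potential J (\<lambda>t. \<nu> t *\<^sub>R L t)"
    unfolding trig_potential_def
  proof (intro conjI allI impI p.finJ)
    fix j i assume j: "j \<in> J"
    have "\<nu> j *\<^sub>R L j = \<tau> j *\<^sub>R K' (\<pi> j)" using rL[OF j] \<tau>[of j] by auto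
    then show "(\<nu> j *\<^sub>R L j) $ i \<in> \<int>" using p'.Kint[OF \<pi>(1)[OF j], of i] \<tau>(1)[of j] by auto
  qed
  interpret l: trig_potential J a A \<alpha> L by (rule tpL)
  interpret n: trig_potential J a A \<beta> "\<lambda>t. \<nu> t *\<^sub>R L t" by (rule tpN)
  have pl: "p.pot = l.pot"
  proof
    fix x
    have "l.phase j x = \<epsilon> j * p.phase j x" for j
      by (simp add: l.phase_def p.phase_def L_def \<alpha>_def algebra_simps)
    then show "p.pot x = l.pot x"
      unfolding p.pot_def l.pot_def using sign_cos[OF \<epsilon>(1)] by simp
  qed
  have pn: "p'.pot = n.pot"
  proof
    fix x
    have ph: "n.phase j x = \<tau> j * p'.phase (\<pi> j) x" if "j \<in> J" for j
      using \<tau>(1)[of j] \<tau>(2)[of j] rL[OF that]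
      by (auto simp: n.phase_def p'.phase_def \<beta>_def algebra_simps)
    have "(\<Sum>j\<in>J. A' j * cos (p'.phase j x)) = (\<Sum>j\<in>J. A' (\<pi> j) * cos (p'.phase (\<pi> j) x))"
      using sum.reindex_bij_betw[OF bij, of "\<lambda>j. A' j * cos (p'.phase j x)"] by simp
    also have "\<dots> = (\<Sum>j\<in>J. A j * cos (n.phase j x))"
      by (intro sum.cong refl) (simp add: ph sign_cos[OF \<tau>(1)] \<pi>(3))
    finally show "p'.pot x = n.pot x" unfolding p'.pot_def n.pot_def using aa by simp
  qed
  have npL: "det2 (L t) (L u) \<noteq> 0" if "t \<in> J" "u \<in> J" "t \<noteq> u" for t u
  proof -
    have "det2 (L t) (L u) = \<epsilon> t * \<epsilon> u * det2 (K t) (K u)" by (simp add: L_def det2_def algebra_simps)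
    then show ?thesis using nonpar(1)[OF that] \<epsilon>(1)[of t] \<epsilon>(1)[of u] by auto
  qed
  have rel: "\<bar>D 1\<bar> *\<^sub>R L 1 + \<bar>D 2\<bar> *\<^sub>R L 2 + \<bar>D 3\<bar> *\<^sub>R L 3 = 0"
    unfolding L_def scaleR_scaleR \<epsilon>(2) using det2_relation[of "K 2" "K 3" "K 1"] by (simp add: D_def)
  have En: "effective_Hamiltonian l.pot p = effective_Hamiltonian n.pot p" for p
    using E[of p] unfolding pl pn .
  have "\<nu> 1 = \<nu> 2 \<and> \<nu> 2 = \<nu> 3"
  proof (rule frequency_ratios_equal[where K=L and \<nu>=\<nu> and m="\<lambda>j. \<bar>D j\<bar>" and A=A and a=a and \<theta>=\<alpha> and \<theta>'=\<beta>])
    show "trig_Hbar {1, 2, 3} a A \<alpha> L p =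
        trig_Hbar {1, 2, 3} a A \<beta> (\<lambda>t. \<nu> t *\<^sub>R L t) p" for p
      using En[of p] unfolding J_def .
  qed (use tpL tpN A(1) npL rel \<nu> D0 J_def in force)+
  then have \<nu>c: "\<nu> j = \<nu> 1" if "j \<in> J" for j using that unfolding J_def by auto
  define c where "c = \<nu> 1"
  have c: "c > 0" using \<nu> by (simp add: c_def)
  have tpC: "trig_potential J (\<lambda>t. c *\<^sub>R L t)"
    using tpN \<nu>c unfolding trig_potential_def c_def by auto
  have nc: "n.pot = trig_potential.pot J a A \<beta> (\<lambda>t. c *\<^sub>R L t)"
  proof
    fix x
    interpret q: trig_potential J a A \<beta> "\<lambda>t. c *\<^sub>R L t" by (rule tpC)
    show "n.pot x = q.pot x"
      unfolding n.pot_def q.pot_def n.phase_def q.phase_def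
      by (intro arg_cong2[of _ _ _ _ "(+)"] sum.cong refl) (simp add: \<nu>c c_def)
  qed
  have "c \<in> \<rat>"
  proof -
    have "L 1 \<noteq> 0" using npL[OF J(1,2)] by (auto simp: det2_def)
    then obtain i where i: "L 1 $ i \<noteq> 0" by (auto simp: vec_eq_iff)
    have "L 1 $ i \<in> \<int>" "c * L 1 $ i \<in> \<int>"
      using tpL tpC J(1) unfolding trig_potential_def by auto
    then have "(c * L 1 $ i) / L 1 $ i \<in> \<rat>" by (intro Rats_divide) (use Ints_subset_Rats in auto)
    then show ?thesis using i by simp
  qed
  obtain c' x0 where c': "c' = c \<or> c' = - c"
    and eq: "\<And>x. l.pot x = trig_potential.pot J a A \<beta> (\<lambda>t. c *\<^sub>R L t) (x /\<^sub>R c' + x0)"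
  proof -
    have "\<exists>c' x0. (c' = c \<or> c' = - c) \<and>
      (\<forall>x. l.pot x = trig_potential.pot J a A \<beta> (\<lambda>t. c *\<^sub>R L t) (x /\<^sub>R c' + x0))"
      unfolding J_def
    proof (rule translation_from_phases)
      show "trig_Hbar {1, 2, 3} a A \<alpha> L 0 =
        trig_Hbar {1, 2, 3} a A \<beta> (\<lambda>t. c *\<^sub>R L t) 0"
        using En[of 0, unfolded nc] unfolding J_def .
    qed (use tpL tpC c A(1) npL in \<open>auto simp: J_def\<close>)
    then show thesis using that by blast
  qed
  have "\<forall>x. p.pot x = p'.pot (x /\<^sub>R c' + x0)" unfolding pl pn nc using eq by blast
  moreover have "c' \<in> \<rat>" "c' \<noteq> 0" using c' c \<open>c \<in> \<rat>\<close> by auto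
  ultimately show ?thesis by blast
qed

theorem theorem1p1:
  fixes V :: "nat \<Rightarrow> real ^ 2 \<Rightarrow> real"
    and a :: "nat \<Rightarrow> real"
    and lam :: "nat \<Rightarrow> nat \<Rightarrow> complex"
    and k :: "nat \<Rightarrow> nat \<Rightarrow> int ^ 2"
  assumes V: "\<And>l x. l \<in> {1, 2} \<Longrightarrow>
      complex_of_real (V l x) = complex_of_real (a l) +
        (\<Sum>j = 1..3. lam l j * exp (\<i> * complex_of_real (2 * pi * (real_vec (k l j) \<bullet> x)))
                  + cnj (lam l j) * exp (- \<i> * complex_of_real (2 * pi * (real_vec (k l j) \<bullet> x))))"
    and lam: "\<And>l j. l \<in> {1, 2} \<Longrightarrow> j \<in> {1..3} \<Longrightarrow> lam l j \<noteq> 0"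
    and k: "\<And>l j. l \<in> {1, 2} \<Longrightarrow> j \<in> {1..3} \<Longrightarrow> k l j \<noteq> 0"
    and nonparallel: "\<And>l i j. l \<in> {1, 2} \<Longrightarrow> i \<in> {1..3} \<Longrightarrow> j \<in> {1..3} \<Longrightarrow> i \<noteq> j \<Longrightarrow>
      \<not> parallel (real_vec (k l i)) (real_vec (k l j))"
    and Hbar: "\<And>p. effective_Hamiltonian (V 1) p = effective_Hamiltonian (V 2) p"
  shows "\<exists>c x0. c \<in> \<rat> \<and> c \<noteq> 0 \<and> (\<forall>x. V 1 x = V 2 (x /\<^sub>R c + x0))"
proof -
  define J where "J = {1, 2, 3 :: nat}"
  have J: "{1..3} = J" unfolding J_def by auto
  define K where "K l j = real_vec (k l j)" for l j
  define A where "A l j = 2 * cmod (lam l j)" for l j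
  define \<theta> where "\<theta> l j = Arg (lam l j)" for l j
  have tp: "trig_potential J (K l)" for l
    unfolding trig_potential_def K_def real_vec_def by (simp add: J_def)
  have pot: "V l = trig_potential.pot J (a l) (A l) (\<theta> l) (K l)" if l: "l \<in> {1, 2}" for l
  proof
    fix x
    interpret p: trig_potential J "a l" "A l" "\<theta> l" "K l" by (rule tp)
    have "complex_of_real (V l x) = complex_of_real (p.pot x)"
      unfolding V[OF l] complex_mode_eq_cos J p.pot_def p.phase_def by (simp add: A_def \<theta>_def K_def)
    then show "V l x = p.pot x" by (simp only: of_real_eq_iff)
  qed
  have A: "A l t > 0" if "l \<in> {1, 2}" "t \<in> J" for l t
    using lam[OF that(1), of t] that(2) unfolding J[symmetric] A_def by simp
  have np: "det2 (K l t) (K l u) \<noteq> 0" if "l \<in> {1, 2}" "t \<in> J" "u \<in> J" "t \<noteq> u" for l t u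
    using nonparallel[of l t u] that det2_zero_imp_parallel unfolding J[symmetric] K_def by blast
  have l: "1 \<in> {1, 2 :: nat}" "2 \<in> {1, 2 :: nat}" by auto
  have "\<exists>c x0. c \<in> \<rat> \<and> c \<noteq> 0 \<and> (\<forall>x. trig_potential.pot J (a 1) (A 1) (\<theta> 1) (K 1) x =
      trig_potential.pot J (a 2) (A 2) (\<theta> 2) (K 2) (x /\<^sub>R c + x0))"
    unfolding J_def
  proof (rule trig_potential_rigidity)
    show "effective_Hamiltonian (trig_potential.pot {1, 2, 3} (a 1) (A 1) (\<theta> 1) (K 1)) p =
        effective_Hamiltonian (trig_potential.pot {1, 2, 3} (a 2) (A 2) (\<theta> 2) (K 2)) p" for p
      using Hbar[of p] unfolding pot[OF l(1)] pot[OF l(2)] J_def .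
  qed (use tp A np l in \<open>simp_all only: J_def\<close>)
  then show ?thesis unfolding pot[OF l(1)] pot[OF l(2)] .
qed

end
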